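(* Let $A\in\mathcal H$ and let $n\ge0$. Then $A$ is an $n$-slice if and only if the following conditions hold: (1) $t_jA\to *$ is an isomorphism in $\mathcal H$ for every $1\le j\le n$; (2) the natural map $\tau^A_{\le n+1}:A\to t_{n+1}A$ is an isomorphism in $\mathcal H$.
   Context: $X$ is a Noetherian separated base scheme of finite Krull dimension, and $Sm_X$ is the category of smooth schemes of finite type over $X$, regarded as a site with the Nisnevich topology. Closed subsets are considered as closed subschemes with the reduced structure. $\mathcal M$ is the category of pointed simplicial presheaves on $Sm_X$ with Jardine's motivic (injective) model structure: cofibrations are the monomorphisms and weak equivalences are the motivic ($\mathbb A^1$-local Nisnevich) weak equivalences; $\mathcal H$ is its homotopy category and $\mathrm{Ho}:\mathcal M\to\mathcal H$ the localization functor. For $Y\in Sm_X$, $Y_+$ denotes the presheaf represented by $Y$ with a disjoint base point. For $Z$ closed in $Y$, $codim_Y Z$ is the infimum of $\dim \mathcal O_{Y,z}$ over the generic points $z$ of $Z$ (so it is $\infty$ if $Z=\emptyset$). For $n\ge 0$, $WB_n$ is the set of maps $\iota_{U,Y}:U_+\to Y_+$ induced by open immersions $U\to Y$ with $Y\in Sm_X$ irreducible, $Z=Y\setminus U\in Sm_X$ and $codim_Y Z\ge n+1$; $WB_n\mathcal M$ is the left Bousfield localization of $\mathcal M$ with respect to $WB_n$. The functors $\tau_n:\mathcal M\to\mathcal M$ ($n\ge1$), with natural transformations $\tau_{\le n}:id\to\tau_n$ and $\nu_n:\tau_{n+1}\to\tau_n$, are defined inductively using the functorial factorizations (trivial cofibration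 followed by fibration): $A\xrightarrow{\tau_{\le 1}^A}\tau_1A\to *$ is the factorization of $A\to *$ in $WB_0\mathcal M$; and given $\tau_{\le n}^A:A\to\tau_nA$, it is factored in $WB_n\mathcal M$ as a trivial cofibration $\tau_{\le n+1}^A:A\to\tau_{n+1}A$ followed by a fibration $\nu_n^A:\tau_{n+1}A\to\tau_nA$. For $n\ge1$, $\tilde s_nA$ is the pullback of $\nu_n^A$ along the base point $*\to\tau_nA$, with projection $i_n^A:\tilde s_nA\to\tau_{n+1}A$; $\tilde s_0=\tau_1$, and $i_0^A$ is the identity of $\tau_1A$. These induce functors $t_n,s_n:\mathcal H\to\mathcal H$ with $t_n\circ\mathrm{Ho}=\mathrm{Ho}\circ\tau_n$, $s_n\circ\mathrm{Ho}=\mathrm{Ho}\circ\tilde s_n$, $s_0=t_1$, and natural maps $\tau_{\le n}^A:A\to t_nA$, $\nu_n^A:t_{n+1}A\to t_nA$, $i_n^A:s_nA\to t_{n+1}A$ in $\mathcal H$. $A\in\mathcal H$ is called an $n$-slice ($n\ge0$) if $A\cong s_nA$ in $\mathcal H$ in the sense that both maps $\tau_{\le n+1}^A:A\to t_{n+1}A$ and $i_n^A:s_nA\to t_{n+1}A$ are isomorphisms in $\mathcal H$. *)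

theory Defs
  imports
    "HOL-Analysis.Analysis"
    "HOL-Homology.Simplices"
    "HOL-Library.Extended_Nat"
    "HOL-Algebra.UnivPoly"
    "HOL-Algebra.QuotRing"
    "HOL-Algebra.Generated_Rings"
    "HOL-Algebra.Ring_Divisibility"
begin

section \<open>Categories, localization and model structures\<close>

record ('o, 'm) cat =
  Ob  :: "'o set"
  Ar  :: "'m set"
  Dom :: "'m \<Rightarrow> 'o"
  Cod :: "'m \<Rightarrow> 'o"
  Idn :: "'o \<Rightarrow> 'm"
  Cmp :: "'m \<Rightarrow> 'm \<Rightarrow> 'm"  \<comment> \<open>\<open>Cmp C g f\<close> is \<open>g\<close> after \<open>f\<close>\<close>

definition arr :: "('o, 'm) cat \<Rightarrow> 'o \<Rightarrow> 'o \<Rightarrow> 'm set" where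
  "arr C A B = {f \<in> Ar C. Dom C f = A \<and> Cod C f = B}"

definition iso_in :: "('o, 'm) cat \<Rightarrow> 'm \<Rightarrow> bool" where
  "iso_in C f \<longleftrightarrow> f \<in> Ar C \<and>
     (\<exists>g \<in> arr C (Cod C f) (Dom C f).
        Cmp C g f = Idn C (Dom C f) \<and> Cmp C f g = Idn C (Cod C f))"

record ('o, 'm, 'p, 'n) fctr =
  fob :: "'o \<Rightarrow> 'p"
  far :: "'m \<Rightarrow> 'n"

subsection \<open>Localization of a category by zigzags\<close>

text \<open>
  The homotopy category is constructed as the localization at the weak equivalences:
  it has the same objects, and a morphism is a zigzag of arrows and formal inverses of
  weak equivalences, modulo the congruence generated by the relations \<open>zz_basic\<close>.
  A zigzag is a list that is read from its source to its target.
\<close>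

datatype 'm zz = Fwd 'm | Bwd 'm

fun zz_path :: "('o, 'm) cat \<Rightarrow> 'm set \<Rightarrow> 'o \<Rightarrow> 'm zz list \<Rightarrow> 'o \<Rightarrow> bool" where
  "zz_path C W A [] B \<longleftrightarrow> A \<in> Ob C \<and> A = B"
| "zz_path C W A (Fwd f # l) B \<longleftrightarrow> f \<in> Ar C \<and> Dom C f = A \<and> zz_path C W (Cod C f) l B"
| "zz_path C W A (Bwd w # l) B \<longleftrightarrow> w \<in> Ar C \<and> w \<in> W \<and> Cod C w = A \<and> zz_path C W (Dom C w) l B"

inductive zz_basic :: "('o, 'm) cat \<Rightarrow> 'm set \<Rightarrow> 'm zz list \<Rightarrow> 'm zz list \<Rightarrow> bool"
  for C W where
  "A \<in> Ob C \<Longrightarrow> zz_basic C W [Fwd (Idn C A)] []"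
| "f \<in> Ar C \<Longrightarrow> g \<in> Ar C \<Longrightarrow> Cod C f = Dom C g \<Longrightarrow> zz_basic C W [Fwd f, Fwd g] [Fwd (Cmp C g f)]"
| "w \<in> W \<Longrightarrow> zz_basic C W [Fwd w, Bwd w] []"
| "w \<in> W \<Longrightarrow> zz_basic C W [Bwd w, Fwd w] []"

definition zz_step :: "('o, 'm) cat \<Rightarrow> 'm set \<Rightarrow> 'o \<Rightarrow> 'o \<Rightarrow> 'm zz list \<Rightarrow> 'm zz list \<Rightarrow> bool" where
  "zz_step C W A B k l \<longleftrightarrow> zz_path C W A k B \<and> zz_path C W A l B \<and>
     (\<exists>p q r s. k = p @ r @ q \<and> l = p @ s @ q \<and> zz_basic C W r s)"

definition zz_cls :: "('o, 'm) cat \<Rightarrow> 'm set \<Rightarrow> 'o \<Rightarrow> 'o \<Rightarrow> 'm zz list \<Rightarrow> 'm zz list set" where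
  "zz_cls C W A B k = {l. equivclp (zz_step C W A B) k l}"

type_synonym ('o, 'm) loc_ar = "'o \<times> 'm zz list set \<times> 'o"

definition loc_cat :: "('o, 'm) cat \<Rightarrow> 'm set \<Rightarrow> ('o, ('o, 'm) loc_ar) cat" where
  "loc_cat C W =
     \<lparr>Ob = Ob C,
      Ar = {(A, zz_cls C W A B l, B) | A B l. zz_path C W A l B},
      Dom = fst,
      Cod = (\<lambda>f. snd (snd f)),
      Idn = (\<lambda>A. (A, zz_cls C W A A [], A)),
      Cmp = (\<lambda>g f. (fst f,
         zz_cls C W (fst f) (snd (snd g)) ((SOME k. k \<in> fst (snd f)) @ (SOME l. l \<in> fst (snd g))),
         snd (snd g)))\<rparr>"

text \<open>The localization functor is the identity on objects.\<close>

definition loc :: "('o, 'm) cat \<Rightarrow> 'm set \<Rightarrow> ('o, 'm, 'o, ('o, 'm) loc_ar) fctr" where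
  "loc C W = \<lparr>fob = (\<lambda>A. A), far = (\<lambda>f. (Dom C f, zz_cls C W (Dom C f) (Cod C f) [Fwd f], Cod C f))\<rparr>"

text \<open>
  For an endofunctor \<open>F\<close> that preserves \<open>W\<close>, \<open>induced C W F\<close> is the functor \<open>G\<close> on the
  localization with \<open>G \<circ> loc = loc \<circ> F\<close>: apply \<open>F\<close> to all entries of a zigzag.
\<close>

definition induced ::
  "('o, 'm) cat \<Rightarrow> 'm set \<Rightarrow> ('o, 'm, 'o, 'm) fctr \<Rightarrow> ('o, ('o, 'm) loc_ar, 'o, ('o, 'm) loc_ar) fctr"
  where
  "induced C W F = \<lparr>fob = fob F,
     far = (\<lambda>f. (fob F (fst f),
        zz_cls C W (fob F (fst f)) (fob F (snd (snd f))) (map (map_zz (far F)) (SOME l. l \<in> fst (snd f))),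
        fob F (snd (snd f))))\<rparr>"

subsection \<open>Model structures with functorial factorizations\<close>

text \<open>
  A functorial factorization sends \<open>f\<close> to \<open>ffR f \<circ> ffL f\<close>, and a commutative square
  \<open>v \<circ> f = g \<circ> u\<close> to the arrow \<open>ffM f g u v\<close> between the middle objects.
\<close>

record 'm ffact =
  ffL :: "'m \<Rightarrow> 'm"
  ffR :: "'m \<Rightarrow> 'm"
  ffM :: "'m \<Rightarrow> 'm \<Rightarrow> 'm \<Rightarrow> 'm \<Rightarrow> 'm"

definition square :: "('o, 'm) cat \<Rightarrow> 'm \<Rightarrow> 'm \<Rightarrow> 'm \<Rightarrow> 'm \<Rightarrow> bool" where
  "square C f g u v \<longleftrightarrow> f \<in> Ar C \<and> g \<in> Ar C \<and>
     u \<in> arr C (Dom C f) (Dom C g) \<and> v \<in> arr C (Cod C f) (Cod C g) \<and> Cmp C v f = Cmp C g u"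

definition functorial_factorization :: "('o, 'm) cat \<Rightarrow> 'm ffact \<Rightarrow> bool" where
  "functorial_factorization C \<Phi> \<longleftrightarrow>
     (\<forall>f \<in> Ar C. ffL \<Phi> f \<in> Ar C \<and> ffR \<Phi> f \<in> Ar C \<and> Dom C (ffL \<Phi> f) = Dom C f \<and>
        Cod C (ffL \<Phi> f) = Dom C (ffR \<Phi> f) \<and> Cod C (ffR \<Phi> f) = Cod C f \<and>
        Cmp C (ffR \<Phi> f) (ffL \<Phi> f) = f \<and>
        ffM \<Phi> f f (Idn C (Dom C f)) (Idn C (Cod C f)) = Idn C (Cod C (ffL \<Phi> f))) \<and>
     (\<forall>f g u v. square C f g u v \<longrightarrow>
        ffM \<Phi> f g u v \<in> arr C (Cod C (ffL \<Phi> f)) (Cod C (ffL \<Phi> g)) \<and>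
        Cmp C (ffM \<Phi> f g u v) (ffL \<Phi> f) = Cmp C (ffL \<Phi> g) u \<and>
        Cmp C (ffR \<Phi> g) (ffM \<Phi> f g u v) = Cmp C v (ffR \<Phi> f)) \<and>
     (\<forall>f g h u v u' v'. square C f g u v \<longrightarrow> square C g h u' v' \<longrightarrow>
        ffM \<Phi> f h (Cmp C u' u) (Cmp C v' v) = Cmp C (ffM \<Phi> g h u' v') (ffM \<Phi> f g u v))"

record 'm model =
  weq :: "'m set"
  cof :: "'m set"
  fib :: "'m set"
  fact_ctf :: "'m ffact"  \<comment> \<open>cofibration followed by trivial fibration\<close>
  fact_tcf :: "'m ffact"  \<comment> \<open>trivial cofibration followed by fibration\<close>

definition wide_subcat :: "('o, 'm) cat \<Rightarrow> 'm set \<Rightarrow> bool" where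
  "wide_subcat C S \<longleftrightarrow> S \<subseteq> Ar C \<and> Idn C ` Ob C \<subseteq> S \<and>
     (\<forall>f \<in> S. \<forall>g \<in> S. Cod C f = Dom C g \<longrightarrow> Cmp C g f \<in> S)"

definition arrow_retract :: "('o, 'm) cat \<Rightarrow> 'm \<Rightarrow> 'm \<Rightarrow> bool" where
  "arrow_retract C f g \<longleftrightarrow> (\<exists>u v r s. square C f g u v \<and> square C g f r s \<and>
     Cmp C r u = Idn C (Dom C f) \<and> Cmp C s v = Idn C (Cod C f))"

definition lifts :: "('o, 'm) cat \<Rightarrow> 'm \<Rightarrow> 'm \<Rightarrow> bool" where
  "lifts C i p \<longleftrightarrow> (\<forall>u v. square C i p u v \<longrightarrow>
     (\<exists>h \<in> arr C (Cod C i) (Dom C p). Cmp C h i = u \<and> Cmp C p h = v))"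

definition model_structure :: "('o, 'm) cat \<Rightarrow> 'm model \<Rightarrow> bool" where
  "model_structure C M \<longleftrightarrow>
     wide_subcat C (weq M) \<and> wide_subcat C (cof M) \<and> wide_subcat C (fib M) \<and>
     (\<forall>f \<in> Ar C. \<forall>g \<in> Ar C. Cod C f = Dom C g \<longrightarrow>
        (f \<in> weq M \<and> Cmp C g f \<in> weq M \<longrightarrow> g \<in> weq M) \<and>
        (g \<in> weq M \<and> Cmp C g f \<in> weq M \<longrightarrow> f \<in> weq M)) \<and>
     (\<forall>f g. arrow_retract C f g \<longrightarrow>
        (g \<in> weq M \<longrightarrow> f \<in> weq M) \<and> (g \<in> cof M \<longrightarrow> f \<in> cof M) \<and> (g \<in> fib M \<longrightarrow> f \<in> fib M)) \<and>
     (\<forall>i \<in> cof M. \<forall>p \<in> fib M. i \<in> weq M \<or> p \<in> weq M \<longrightarrow> lifts C i p) \<and>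
     functorial_factorization C (fact_ctf M) \<and> functorial_factorization C (fact_tcf M) \<and>
     (\<forall>f \<in> Ar C. ffL (fact_ctf M) f \<in> cof M \<and> ffR (fact_ctf M) f \<in> fib M \<inter> weq M) \<and>
     (\<forall>f \<in> Ar C. ffL (fact_tcf M) f \<in> cof M \<inter> weq M \<and> ffR (fact_tcf M) f \<in> fib M)"

section \<open>Simplicial sets and their weak equivalences\<close>

definition Delta :: "nat \<Rightarrow> nat \<Rightarrow> (nat \<Rightarrow> nat) set" where
  "Delta m n = {\<theta> \<in> {..m} \<rightarrow>\<^sub>E {..n}. mono_on {..m} \<theta>}"

record 'v sset =
  smp :: "nat \<Rightarrow> 'v set"
  sop :: "nat \<Rightarrow> nat \<Rightarrow> (nat \<Rightarrow> nat) \<Rightarrow> 'v \<Rightarrow> 'v"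
    \<comment> \<open>\<open>sop K m n \<theta>\<close> is the operator \<open>K\<^sub>n \<rightarrow> K\<^sub>m\<close> of \<open>\<theta> \<in> Delta m n\<close>\<close>

definition is_sset :: "'v sset \<Rightarrow> bool" where
  "is_sset K \<longleftrightarrow>
     (\<forall>m n. \<forall>\<theta> \<in> Delta m n. sop K m n \<theta> \<in> smp K n \<rightarrow> smp K m) \<and>
     (\<forall>n. \<forall>x \<in> smp K n. sop K n n (\<lambda>i\<in>{..n}. i) x = x) \<and>
     (\<forall>l m n. \<forall>\<theta> \<in> Delta l m. \<forall>\<psi> \<in> Delta m n. \<forall>x \<in> smp K n.
        sop K l n (compose {..l} \<psi> \<theta>) x = sop K l m \<theta> (sop K m n \<psi> x))"

definition sset_map :: "'v sset \<Rightarrow> 'w sset \<Rightarrow> (nat \<Rightarrow> 'v \<Rightarrow> 'w) \<Rightarrow> bool" where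
  "sset_map K L h \<longleftrightarrow> (\<forall>n. h n \<in> smp K n \<rightarrow> smp L n) \<and>
     (\<forall>m n. \<forall>\<theta> \<in> Delta m n. \<forall>x \<in> smp K n. h m (sop K m n \<theta> x) = sop L m n \<theta> (h n x))"

definition std_sset :: "nat \<Rightarrow> (nat \<Rightarrow> nat) sset" where
  "std_sset p = \<lparr>smp = (\<lambda>k. Delta k p), sop = (\<lambda>m n \<theta> \<alpha>. compose {..m} \<alpha> \<theta>)\<rparr>"

definition prod_sset :: "'v sset \<Rightarrow> 'w sset \<Rightarrow> ('v \<times> 'w) sset" where
  "prod_sset K L = \<lparr>smp = (\<lambda>k. smp K k \<times> smp L k),
     sop = (\<lambda>m n \<theta> z. (sop K m n \<theta> (fst z), sop L m n \<theta> (snd z)))\<rparr>"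

subsection \<open>Geometric realization\<close>

text \<open>
  The realization is the quotient of the disjoint union of the cells \<open>{x} \<times> standard_simplex n\<close>
  (\<open>x\<close> an \<open>n\<close>-simplex) by the relation \<open>(\<theta>\<^sup>*x, s) ~ (x, \<theta>\<^sub>*s)\<close>, with the quotient topology.
\<close>

type_synonym 'v cell = "nat \<times> 'v \<times> (nat \<Rightarrow> real)"

definition push :: "nat \<Rightarrow> (nat \<Rightarrow> nat) \<Rightarrow> (nat \<Rightarrow> real) \<Rightarrow> nat \<Rightarrow> real" where
  "push m \<theta> s = (\<lambda>j. \<Sum>i | i \<le> m \<and> \<theta> i = j. s i)"

definition glue :: "'v sset \<Rightarrow> 'v cell \<Rightarrow> 'v cell \<Rightarrow> bool" where
  "glue K a b \<longleftrightarrow> (\<exists>m n \<theta> x s. \<theta> \<in> Delta m n \<and> x \<in> smp K n \<and> s \<in> standard_simplex m \<and>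
     a = (m, sop K m n \<theta> x, s) \<and> b = (n, x, push m \<theta> s))"

definition rpt :: "'v sset \<Rightarrow> 'v cell \<Rightarrow> 'v cell set" where
  "rpt K a = {b. equivclp (glue K) a b}"

definition realization :: "'v sset \<Rightarrow> 'v cell set topology" where
  "realization K = topology (\<lambda>U.
     U \<subseteq> {rpt K (n, x, t) | n x t. x \<in> smp K n \<and> t \<in> standard_simplex n} \<and>
     (\<forall>n. \<forall>x \<in> smp K n. openin (subtopology (powertop_real UNIV) (standard_simplex n))
        {t \<in> standard_simplex n. rpt K (n, x, t) \<in> U}))"

definition rmap :: "'w sset \<Rightarrow> (nat \<Rightarrow> 'v \<Rightarrow> 'w) \<Rightarrow> 'v cell set \<Rightarrow> 'w cell set" where
  "rmap L h c = (THE d. \<exists>n x t. (n, x, t) \<in> c \<and> d = rpt L (n, h n x, t))"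

definition vertex :: "'v sset \<Rightarrow> 'v \<Rightarrow> 'v cell set" where
  "vertex K x = rpt K (0, x, \<lambda>i. if i = 0 then 1 else 0)"

subsection \<open>Homotopy groups and weak equivalences\<close>

definition pi0_map :: "'y topology \<Rightarrow> ('x \<Rightarrow> 'y) \<Rightarrow> 'x set \<Rightarrow> 'y set" where
  "pi0_map T h c = (THE d. \<exists>p \<in> c. d = path_component_of_set T (h p))"

text \<open>
  The underlying set of the \<open>n\<close>-th homotopy group: based maps from the \<open>n\<close>-cube that are constant
  on its boundary, modulo homotopy relative to the boundary.
\<close>

definition cube :: "nat \<Rightarrow> (nat \<Rightarrow> real) set" where
  "cube n = {t. (\<forall>i<n. 0 \<le> t i \<and> t i \<le> 1) \<and> (\<forall>i\<ge>n. t i = 0)}"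

definition cube_bd :: "nat \<Rightarrow> (nat \<Rightarrow> real) set" where
  "cube_bd n = {t \<in> cube n. \<exists>i<n. t i = 0 \<or> t i = 1}"

definition cube_top :: "nat \<Rightarrow> (nat \<Rightarrow> real) topology" where
  "cube_top n = subtopology (powertop_real UNIV) (cube n)"

definition spheroids :: "nat \<Rightarrow> 'x topology \<Rightarrow> 'x \<Rightarrow> ((nat \<Rightarrow> real) \<Rightarrow> 'x) set" where
  "spheroids n T x = {g. continuous_map (cube_top n) T g \<and> (\<forall>t \<in> cube_bd n. g t = x)}"

definition hpi_cls :: "nat \<Rightarrow> 'x topology \<Rightarrow> 'x \<Rightarrow> ((nat \<Rightarrow> real) \<Rightarrow> 'x) \<Rightarrow> ((nat \<Rightarrow> real) \<Rightarrow> 'x) set" where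
  "hpi_cls n T x g =
     {g' \<in> spheroids n T x. homotopic_with (\<lambda>k. \<forall>t \<in> cube_bd n. k t = x) (cube_top n) T g g'}"

definition hpi :: "nat \<Rightarrow> 'x topology \<Rightarrow> 'x \<Rightarrow> ((nat \<Rightarrow> real) \<Rightarrow> 'x) set set" where
  "hpi n T x = hpi_cls n T x ` spheroids n T x"

definition hpi_map ::
  "nat \<Rightarrow> 'y topology \<Rightarrow> 'y \<Rightarrow> ('x \<Rightarrow> 'y) \<Rightarrow> ((nat \<Rightarrow> real) \<Rightarrow> 'x) set \<Rightarrow> ((nat \<Rightarrow> real) \<Rightarrow> 'y) set" where
  "hpi_map n T y h c = (THE d. \<exists>g \<in> c. d = hpi_cls n T y (h \<circ> g))"

definition sset_weq :: "'v sset \<Rightarrow> 'w sset \<Rightarrow> (nat \<Rightarrow> 'v \<Rightarrow> 'w) \<Rightarrow> bool" where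
  "sset_weq K L h \<longleftrightarrow> sset_map K L h \<and>
     bij_betw (pi0_map (realization L) (rmap L h))
       (path_components_of (realization K)) (path_components_of (realization L)) \<and>
     (\<forall>n\<ge>1. \<forall>x \<in> smp K 0.
        bij_betw (hpi_map n (realization L) (vertex L (h 0 x)) (rmap L h))
          (hpi n (realization K) (vertex K x)) (hpi n (realization L) (vertex L (h 0 x))))"

section \<open>Simplicial presheaves on a site\<close>

text \<open>
  Sets are subsets of a type \<open>'v\<close>, which plays the role of a universe: the small object argument,
  and thus the model structures below, are available whenever \<open>'v\<close> has suitably large cardinality
  with respect to the site.  The site is a category \<open>C\<close> together with \<open>cov\<close>, which assigns
  to each object the set of its covering families (sets of arrows into it).
\<close>

record ('o, 'm, 'v) spsh =
  sval :: "'o \<Rightarrow> 'v sset"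
  srst :: "'m \<Rightarrow> nat \<Rightarrow> 'v \<Rightarrow> 'v"

definition is_spsh :: "('o, 'm) cat \<Rightarrow> ('o, 'm, 'v) spsh \<Rightarrow> bool" where
  "is_spsh C F \<longleftrightarrow>
     (\<forall>Y \<in> Ob C. is_sset (sval F Y)) \<and>
     (\<forall>f \<in> Ar C. sset_map (sval F (Cod C f)) (sval F (Dom C f)) (srst F f)) \<and>
     (\<forall>Y \<in> Ob C. \<forall>k. \<forall>x \<in> smp (sval F Y) k. srst F (Idn C Y) k x = x) \<and>
     (\<forall>f \<in> Ar C. \<forall>g \<in> Ar C. Cod C f = Dom C g \<longrightarrow>
        (\<forall>k. \<forall>x \<in> smp (sval F (Cod C g)) k. srst F (Cmp C g f) k x = srst F f k (srst F g k x)))"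

definition spsh_hom ::
  "('o, 'm) cat \<Rightarrow> ('o, 'm, 'v) spsh \<Rightarrow> ('o, 'm, 'w) spsh \<Rightarrow> ('o \<Rightarrow> nat \<Rightarrow> 'v \<Rightarrow> 'w) set" where
  "spsh_hom C F G = {\<phi> \<in> extensional (Ob C).
     (\<forall>Y \<in> Ob C. sset_map (sval F Y) (sval G Y) (\<phi> Y) \<and>
        (\<forall>k. \<phi> Y k \<in> extensional (smp (sval F Y) k))) \<and>
     (\<forall>f \<in> Ar C. \<forall>k. \<forall>x \<in> smp (sval F (Cod C f)) k.
        \<phi> (Dom C f) k (srst F f k x) = srst G f k (\<phi> (Cod C f) k x))}"

definition spsh_id :: "('o, 'm) cat \<Rightarrow> ('o, 'm, 'v) spsh \<Rightarrow> 'o \<Rightarrow> nat \<Rightarrow> 'v \<Rightarrow> 'v" where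
  "spsh_id C F = (\<lambda>Y\<in>Ob C. \<lambda>k. \<lambda>x\<in>smp (sval F Y) k. x)"

definition spsh_cmp ::
  "('o, 'm) cat \<Rightarrow> ('o, 'm, 'v) spsh \<Rightarrow> ('o \<Rightarrow> nat \<Rightarrow> 'w \<Rightarrow> 'x) \<Rightarrow> ('o \<Rightarrow> nat \<Rightarrow> 'v \<Rightarrow> 'w) \<Rightarrow> 'o \<Rightarrow> nat \<Rightarrow> 'v \<Rightarrow> 'x"
  where "spsh_cmp C F \<psi> \<phi> = (\<lambda>Y\<in>Ob C. \<lambda>k. compose (smp (sval F Y) k) (\<psi> Y k) (\<phi> Y k))"

definition spsh_mono :: "('o, 'm) cat \<Rightarrow> ('o, 'm, 'v) spsh \<Rightarrow> ('o \<Rightarrow> nat \<Rightarrow> 'v \<Rightarrow> 'w) \<Rightarrow> bool" where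
  "spsh_mono C F \<phi> \<longleftrightarrow> (\<forall>Y \<in> Ob C. \<forall>k. inj_on (\<phi> Y k) (smp (sval F Y) k))"

subsection \<open>Local weak equivalences\<close>

text \<open>
  \<open>E f\<close> and \<open>E' f\<close> are the values of two presheaves at an object \<open>f\<close> of the slice over \<open>U\<close>,
  \<open>\<eta> f : E f \<rightarrow> E' f\<close> a natural map, and \<open>\<rho> f\<close>, \<open>\<rho>' f\<close> the restrictions from \<open>U\<close> along \<open>f\<close>.  If
  the condition holds for all \<open>U\<close>, then \<open>\<eta>\<close> induces an isomorphism of associated sheaves.
\<close>

definition locally_bij ::
  "('o, 'm) cat \<Rightarrow> ('o \<Rightarrow> 'm set set) \<Rightarrow> 'o \<Rightarrow> ('m \<Rightarrow> 'e set) \<Rightarrow> ('m \<Rightarrow> 'e1 set) \<Rightarrow> ('m \<Rightarrow> 'e \<Rightarrow> 'e1) \<Rightarrow>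
   ('m \<Rightarrow> 'e \<Rightarrow> 'e) \<Rightarrow> ('m \<Rightarrow> 'e1 \<Rightarrow> 'e1) \<Rightarrow> bool" where
  "locally_bij C cov U E E' \<eta> \<rho> \<rho>' \<longleftrightarrow>
     (\<forall>c \<in> E (Idn C U). \<forall>d \<in> E (Idn C U). \<eta> (Idn C U) c = \<eta> (Idn C U) d \<longrightarrow>
        (\<exists>S \<in> cov U. \<forall>f \<in> S. \<rho> f c = \<rho> f d)) \<and>
     (\<forall>e \<in> E' (Idn C U). \<exists>S \<in> cov U. \<forall>f \<in> S. \<rho>' f e \<in> \<eta> f ` E f)"

abbreviation rlz :: "('o, 'm, 'v) spsh \<Rightarrow> 'o \<Rightarrow> 'v cell set topology" where
  "rlz F Y \<equiv> realization (sval F Y)"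

text \<open>
  Isomorphism of the sheaves of path components, and of the sheaves of homotopy groups of the
  restrictions to all slices \<open>C/U\<close>, for all base points over \<open>U\<close>.
\<close>

definition local_weq ::
  "('o, 'm) cat \<Rightarrow> ('o \<Rightarrow> 'm set set) \<Rightarrow> ('o, 'm, 'v) spsh \<Rightarrow> ('o, 'm, 'w) spsh \<Rightarrow> ('o \<Rightarrow> nat \<Rightarrow> 'v \<Rightarrow> 'w) \<Rightarrow> bool"
  where
  "local_weq C cov F G \<phi> \<longleftrightarrow>
     (\<forall>U \<in> Ob C. locally_bij C cov U
        (\<lambda>f. path_components_of (rlz F (Dom C f)))
        (\<lambda>f. path_components_of (rlz G (Dom C f)))
        (\<lambda>f. pi0_map (rlz G (Dom C f)) (rmap (sval G (Dom C f)) (\<phi> (Dom C f))))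
        (\<lambda>f. pi0_map (rlz F (Dom C f)) (rmap (sval F (Dom C f)) (srst F f)))
        (\<lambda>f. pi0_map (rlz G (Dom C f)) (rmap (sval G (Dom C f)) (srst G f)))) \<and>
     (\<forall>U \<in> Ob C. \<forall>x \<in> smp (sval F U) 0. \<forall>n\<ge>1.
        let a = (\<lambda>f. vertex (sval F (Dom C f)) (srst F f 0 x));
            b = (\<lambda>f. vertex (sval G (Dom C f)) (srst G f 0 (\<phi> U 0 x)))
        in locally_bij C cov U
          (\<lambda>f. hpi n (rlz F (Dom C f)) (a f))
          (\<lambda>f. hpi n (rlz G (Dom C f)) (b f))
          (\<lambda>f. hpi_map n (rlz G (Dom C f)) (b f) (rmap (sval G (Dom C f)) (\<phi> (Dom C f))))
          (\<lambda>f. hpi_map n (rlz F (Dom C f)) (a f) (rmap (sval F (Dom C f)) (srst F f)))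
          (\<lambda>f. hpi_map n (rlz G (Dom C f)) (b f) (rmap (sval G (Dom C f)) (srst G f))))"

subsection \<open>Function complexes and motivic weak equivalences\<close>

definition times_simplex :: "('o, 'm, 'v) spsh \<Rightarrow> nat \<Rightarrow> ('o, 'm, 'v \<times> (nat \<Rightarrow> nat)) spsh" where
  "times_simplex F p = \<lparr>sval = (\<lambda>Y. prod_sset (sval F Y) (std_sset p)),
     srst = (\<lambda>f k z. (srst F f k (fst z), snd z))\<rparr>"

type_synonym ('o, 'v, 'w) fc_smp = "'o \<Rightarrow> nat \<Rightarrow> 'v \<times> (nat \<Rightarrow> nat) \<Rightarrow> 'w"

definition map_sset ::
  "('o, 'm) cat \<Rightarrow> ('o, 'm, 'v) spsh \<Rightarrow> ('o, 'm, 'w) spsh \<Rightarrow> ('o, 'v, 'w) fc_smp sset" where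
  "map_sset C F Z = \<lparr>smp = (\<lambda>p. spsh_hom C (times_simplex F p) Z),
     sop = (\<lambda>m n \<theta> \<phi>. \<lambda>Y\<in>Ob C. \<lambda>k. \<lambda>z\<in>smp (sval F Y) k \<times> Delta k m.
        \<phi> Y k (fst z, compose {..k} \<theta> (snd z)))\<rparr>"

definition precomp ::
  "('o, 'm) cat \<Rightarrow> ('o, 'm, 'u) spsh \<Rightarrow> ('o \<Rightarrow> nat \<Rightarrow> 'u \<Rightarrow> 'v) \<Rightarrow> nat \<Rightarrow> ('o, 'v, 'w) fc_smp \<Rightarrow> ('o, 'u, 'w) fc_smp"
  where
  "precomp C E g p \<phi> = (\<lambda>Y\<in>Ob C. \<lambda>k. \<lambda>z\<in>smp (sval E Y) k \<times> Delta k p. \<phi> Y k (g Y k (fst z), snd z))"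

definition injective_fibrant ::
  "('o, 'm) cat \<Rightarrow> ('o \<Rightarrow> 'm set set) \<Rightarrow> ('o, 'm, 'v) spsh \<Rightarrow> bool" where
  "injective_fibrant C cov Z \<longleftrightarrow> is_spsh C Z \<and>
     (\<forall>(E::('o, 'm, 'v) spsh) (E'::('o, 'm, 'v) spsh). \<forall>i \<in> spsh_hom C E E'. \<forall>u \<in> spsh_hom C E Z.
        is_spsh C E \<longrightarrow> is_spsh C E' \<longrightarrow> spsh_mono C E i \<longrightarrow> local_weq C cov E E' i \<longrightarrow>
        (\<exists>v \<in> spsh_hom C E' Z. spsh_cmp C E v i = u))"

text \<open>\<open>A1\<close> is the set of all projections \<open>Y \<times> \<bbbA>\<^sup>1 \<rightarrow> Y\<close> in the site.\<close>

definition motivic_fibrant ::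
  "('o, 'm) cat \<Rightarrow> ('o \<Rightarrow> 'm set set) \<Rightarrow> 'm set \<Rightarrow> ('o, 'm, 'v) spsh \<Rightarrow> bool" where
  "motivic_fibrant C cov A1 Z \<longleftrightarrow> injective_fibrant C cov Z \<and>
     (\<forall>q \<in> A1. sset_weq (sval Z (Cod C q)) (sval Z (Dom C q)) (srst Z q))"

definition motivic_weq ::
  "('o, 'm) cat \<Rightarrow> ('o \<Rightarrow> 'm set set) \<Rightarrow> 'm set \<Rightarrow> ('o, 'm, 'v) spsh \<Rightarrow> ('o, 'm, 'v) spsh \<Rightarrow>
   ('o \<Rightarrow> nat \<Rightarrow> 'v \<Rightarrow> 'v) \<Rightarrow> bool" where
  "motivic_weq C cov A1 F G \<phi> \<longleftrightarrow> (\<forall>Z::('o, 'm, 'v) spsh. motivic_fibrant C cov A1 Z \<longrightarrow>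
     sset_weq (map_sset C G Z) (map_sset C F Z) (precomp C F \<phi>))"

subsection \<open>Pointed simplicial presheaves\<close>

type_synonym ('o, 'm, 'v) pob = "('o, 'm, 'v) spsh \<times> ('o \<Rightarrow> nat \<Rightarrow> 'v)"
type_synonym ('o, 'm, 'v) par =
  "('o, 'm, 'v) pob \<times> ('o \<Rightarrow> nat \<Rightarrow> 'v \<Rightarrow> 'v) \<times> ('o, 'm, 'v) pob"

definition is_pob :: "('o, 'm) cat \<Rightarrow> ('o, 'm, 'v) pob \<Rightarrow> bool" where
  "is_pob C A \<longleftrightarrow> is_spsh C (fst A) \<and>
     (\<forall>Y \<in> Ob C. \<forall>k. snd A Y k \<in> smp (sval (fst A) Y) k) \<and>
     (\<forall>Y \<in> Ob C. \<forall>m n. \<forall>\<theta> \<in> Delta m n. sop (sval (fst A) Y) m n \<theta> (snd A Y n) = snd A Y m) \<and>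
     (\<forall>f \<in> Ar C. \<forall>k. srst (fst A) f k (snd A (Cod C f) k) = snd A (Dom C f) k)"

definition pcat :: "('o, 'm) cat \<Rightarrow> (('o, 'm, 'v) pob, ('o, 'm, 'v) par) cat" where
  "pcat C =
     \<lparr>Ob = {A. is_pob C A},
      Ar = {(A, \<phi>, B) | A \<phi> B. is_pob C A \<and> is_pob C B \<and> \<phi> \<in> spsh_hom C (fst A) (fst B) \<and>
         (\<forall>Y \<in> Ob C. \<forall>k. \<phi> Y k (snd A Y k) = snd B Y k)},
      Dom = fst,
      Cod = (\<lambda>f. snd (snd f)),
      Idn = (\<lambda>A. (A, spsh_id C (fst A), A)),
      Cmp = (\<lambda>g f. (fst f, spsh_cmp C (fst (fst f)) (fst (snd g)) (fst (snd f)), snd (snd g)))\<rparr>"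

text \<open>A one-point presheaf; which element of \<open>'v\<close> is used is immaterial.\<close>

definition pt :: "('o, 'm, 'v) pob" where
  "pt = (\<lparr>sval = (\<lambda>Y. \<lparr>smp = (\<lambda>k. {undefined}), sop = (\<lambda>m n \<theta> x. x)\<rparr>), srst = (\<lambda>f k x. x)\<rparr>,
     \<lambda>Y k. undefined)"

definition to_pt :: "('o, 'm) cat \<Rightarrow> ('o, 'm, 'v) pob \<Rightarrow> ('o, 'm, 'v) par" where
  "to_pt C A = (A, \<lambda>Y\<in>Ob C. \<lambda>k. \<lambda>x\<in>smp (sval (fst A) Y) k. undefined, pt)"

definition pmap_sset ::
  "('o, 'm) cat \<Rightarrow> ('o, 'm, 'v) pob \<Rightarrow> ('o, 'm, 'v) pob \<Rightarrow> ('o, 'v, 'v) fc_smp sset" where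
  "pmap_sset C A Z = \<lparr>smp = (\<lambda>p. {\<phi> \<in> smp (map_sset C (fst A) (fst Z)) p.
        \<forall>Y \<in> Ob C. \<forall>k. \<forall>\<alpha> \<in> Delta k p. \<phi> Y k (snd A Y k, \<alpha>) = snd Z Y k}),
     sop = sop (map_sset C (fst A) (fst Z))\<rparr>"

text \<open>The fibre of \<open>f\<close> over the base point of its target, and its inclusion.\<close>

definition fibre :: "('o, 'm, 'v) par \<Rightarrow> ('o, 'm, 'v) pob" where
  "fibre f = (case f of (A, \<phi>, B) \<Rightarrow>
     (\<lparr>sval = (\<lambda>Y. \<lparr>smp = (\<lambda>k. {x \<in> smp (sval (fst A) Y) k. \<phi> Y k x = snd B Y k}),
                    sop = sop (sval (fst A) Y)\<rparr>),
       srst = srst (fst A)\<rparr>, snd A))"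

definition fibre_incl :: "('o, 'm) cat \<Rightarrow> ('o, 'm, 'v) par \<Rightarrow> ('o, 'm, 'v) par" where
  "fibre_incl C f = (fibre f, spsh_id C (fst (fibre f)), fst f)"

text \<open>
  \<open>rep C emb Y\<close> is the presheaf represented by \<open>Y\<close> with a disjoint base point \<open>emb None\<close>; an injection
  \<open>emb\<close> is used to regard arrows of \<open>C\<close> as elements of the type \<open>'v\<close> of elements of sets.
\<close>

definition rep :: "('o, 'm) cat \<Rightarrow> ('m option \<Rightarrow> 'v) \<Rightarrow> 'o \<Rightarrow> ('o, 'm, 'v) pob" where
  "rep C emb Y =
     (\<lparr>sval = (\<lambda>V. \<lparr>smp = (\<lambda>k. insert (emb None) ((\<lambda>g. emb (Some g)) ` arr C V Y)),
                    sop = (\<lambda>m n \<theta> x. x)\<rparr>),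
       srst = (\<lambda>f k x. emb (map_option (\<lambda>g. Cmp C g f) (inv_into UNIV emb x)))\<rparr>,
      \<lambda>V k. emb None)"

definition rep_map :: "('o, 'm) cat \<Rightarrow> ('m option \<Rightarrow> 'v) \<Rightarrow> 'm \<Rightarrow> ('o, 'm, 'v) par" where
  "rep_map C emb j = (rep C emb (Dom C j),
     \<lambda>V\<in>Ob C. \<lambda>k. \<lambda>x\<in>smp (sval (fst (rep C emb (Dom C j))) V) k.
       emb (map_option (\<lambda>g. Cmp C j g) (inv_into UNIV emb x)),
     rep C emb (Cod C j))"

subsection \<open>Left Bousfield localization\<close>

text \<open>
  Every object is cofibrant when the cofibrations are the monomorphisms, so that for fibrant \<open>Z\<close> the
  pointed function complex \<open>pmap_sset C A Z\<close> is a homotopy function complex.  The localization has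
  the same cofibrations and more weak equivalences, namely the local equivalences; its fibrations
  are then determined by the lifting property.
\<close>

definition local_obj ::
  "('o, 'm) cat \<Rightarrow> ('o, 'm, 'v) par model \<Rightarrow> ('o, 'm, 'v) par set \<Rightarrow> ('o, 'm, 'v) pob \<Rightarrow> bool" where
  "local_obj C M S Z \<longleftrightarrow> Z \<in> Ob (pcat C) \<and> to_pt C Z \<in> fib M \<and>
     (\<forall>(A, \<phi>, B) \<in> S. sset_weq (pmap_sset C B Z) (pmap_sset C A Z) (precomp C (fst A) \<phi>))"

definition local_equiv ::
  "('o, 'm) cat \<Rightarrow> ('o, 'm, 'v) par model \<Rightarrow> ('o, 'm, 'v) par set \<Rightarrow> ('o, 'm, 'v) par set" where
  "local_equiv C M S = {(A, \<phi>, B). (A, \<phi>, B) \<in> Ar (pcat C) \<and>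
     (\<forall>Z. local_obj C M S Z \<longrightarrow> sset_weq (pmap_sset C B Z) (pmap_sset C A Z) (precomp C (fst A) \<phi>))}"

definition left_Bousfield_localization ::
  "('o, 'm) cat \<Rightarrow> ('o, 'm, 'v) par model \<Rightarrow> ('o, 'm, 'v) par set \<Rightarrow> ('o, 'm, 'v) par model \<Rightarrow> bool" where
  "left_Bousfield_localization C M S N \<longleftrightarrow> model_structure (pcat C) N \<and>
     cof N = cof M \<and> weq M \<subseteq> weq N \<and> weq N = local_equiv C M S"

section \<open>Schemes\<close>

subsection \<open>Locally ringed spaces\<close>

record ('p, 's) lrs =
  sp  :: "'p topology"
  sec :: "'p set \<Rightarrow> 's ring"
  res :: "'p set \<Rightarrow> 'p set \<Rightarrow> 's \<Rightarrow> 's"  \<comment> \<open>\<open>res X U V\<close> restricts sections from \<open>U\<close> to \<open>V\<close>\<close>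

abbreviation pts :: "('p, 's) lrs \<Rightarrow> 'p set" where
  "pts X \<equiv> topspace (sp X)"

definition ringed_space :: "('p, 's) lrs \<Rightarrow> bool" where
  "ringed_space X \<longleftrightarrow>
     (\<forall>U. openin (sp X) U \<longrightarrow> cring (sec X U)) \<and>
     (\<forall>U V. openin (sp X) U \<longrightarrow> openin (sp X) V \<longrightarrow> V \<subseteq> U \<longrightarrow> res X U V \<in> ring_hom (sec X U) (sec X V)) \<and>
     (\<forall>U. openin (sp X) U \<longrightarrow> (\<forall>s \<in> carrier (sec X U). res X U U s = s)) \<and>
     (\<forall>U V W. openin (sp X) U \<longrightarrow> openin (sp X) V \<longrightarrow> openin (sp X) W \<longrightarrow> W \<subseteq> V \<longrightarrow> V \<subseteq> U \<longrightarrow>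
        (\<forall>s \<in> carrier (sec X U). res X V W (res X U V s) = res X U W s)) \<and>
     (\<forall>\<U>. (\<forall>V \<in> \<U>. openin (sp X) V) \<longrightarrow>
        (\<forall>s \<in> carrier (sec X (\<Union>\<U>)). \<forall>t \<in> carrier (sec X (\<Union>\<U>)).
           (\<forall>V \<in> \<U>. res X (\<Union>\<U>) V s = res X (\<Union>\<U>) V t) \<longrightarrow> s = t) \<and>
        (\<forall>\<sigma>. (\<forall>V \<in> \<U>. \<sigma> V \<in> carrier (sec X V)) \<longrightarrow>
           (\<forall>V \<in> \<U>. \<forall>W \<in> \<U>. res X V (V \<inter> W) (\<sigma> V) = res X W (V \<inter> W) (\<sigma> W)) \<longrightarrow>
           (\<exists>s \<in> carrier (sec X (\<Union>\<U>)). \<forall>V \<in> \<U>. res X (\<Union>\<U>) V s = \<sigma> V)))"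

type_synonym ('p, 's) germ = "('p set \<times> 's) set"

definition germ :: "('p, 's) lrs \<Rightarrow> 'p \<Rightarrow> 'p set \<Rightarrow> 's \<Rightarrow> ('p, 's) germ" where
  "germ X x U s = {(V, t). openin (sp X) V \<and> x \<in> V \<and> t \<in> carrier (sec X V) \<and>
     (\<exists>W. openin (sp X) W \<and> x \<in> W \<and> W \<subseteq> U \<inter> V \<and> res X U W s = res X V W t)}"

definition stalk :: "('p, 's) lrs \<Rightarrow> 'p \<Rightarrow> ('p, 's) germ ring" where
  "stalk X x =
     \<lparr>carrier = {germ X x U s | U s. openin (sp X) U \<and> x \<in> U \<and> s \<in> carrier (sec X U)},
      mult = (\<lambda>a b. THE c. \<exists>U s t. (U, s) \<in> a \<and> (U, t) \<in> b \<and> c = germ X x U (s \<otimes>\<^bsub>sec X U\<^esub> t)),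
      one = germ X x (pts X) \<one>\<^bsub>sec X (pts X)\<^esub>,
      zero = germ X x (pts X) \<zero>\<^bsub>sec X (pts X)\<^esub>,
      add = (\<lambda>a b. THE c. \<exists>U s t. (U, s) \<in> a \<and> (U, t) \<in> b \<and> c = germ X x U (s \<oplus>\<^bsub>sec X U\<^esub> t))\<rparr>"

definition max_ideal :: "('r, 'z) ring_scheme \<Rightarrow> 'r set" where
  "max_ideal R = (THE I. maximalideal I R)"

definition locally_ringed_space :: "('p, 's) lrs \<Rightarrow> bool" where
  "locally_ringed_space X \<longleftrightarrow> ringed_space X \<and>
     (\<forall>x \<in> pts X. cring (stalk X x) \<and> (\<exists>!I. maximalideal I (stalk X x)))"

text \<open>
  A morphism from \<open>X\<close> to \<open>Y\<close> is a pair of a map on points and of ring homomorphisms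
  from the sections of \<open>Y\<close> on \<open>V\<close> to those of \<open>X\<close> on the preimage of \<open>V\<close>.
\<close>

type_synonym ('p, 's, 'q, 't) lrs_map = "('p \<Rightarrow> 'q) \<times> ('q set \<Rightarrow> 't \<Rightarrow> 's)"

definition preim :: "('p, 's) lrs \<Rightarrow> ('p, 's, 'q, 't) lrs_map \<Rightarrow> 'q set \<Rightarrow> 'p set" where
  "preim X f V = {x \<in> pts X. fst f x \<in> V}"

definition stalk_map ::
  "('p, 's) lrs \<Rightarrow> ('p, 's, 'q, 't) lrs_map \<Rightarrow> 'p \<Rightarrow> ('q, 't) germ \<Rightarrow> ('p, 's) germ" where
  "stalk_map X f x g = (THE h. \<exists>V t. (V, t) \<in> g \<and> h = germ X x (preim X f V) (snd f V t))"

text \<open>The components of a morphism are extensional, so that equal morphisms are equal as pairs.\<close>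

definition lrs_hom :: "('p, 's) lrs \<Rightarrow> ('q, 't) lrs \<Rightarrow> ('p, 's, 'q, 't) lrs_map set" where
  "lrs_hom X Y = {f.
     fst f \<in> extensional (pts X) \<and> continuous_map (sp X) (sp Y) (fst f) \<and>
     snd f \<in> extensional {V. openin (sp Y) V} \<and>
     (\<forall>V. openin (sp Y) V \<longrightarrow> snd f V \<in> extensional (carrier (sec Y V)) \<and>
        snd f V \<in> ring_hom (sec Y V) (sec X (preim X f V))) \<and>
     (\<forall>V W. openin (sp Y) V \<longrightarrow> openin (sp Y) W \<longrightarrow> W \<subseteq> V \<longrightarrow> (\<forall>s \<in> carrier (sec Y V).
        snd f W (res Y V W s) = res X (preim X f V) (preim X f W) (snd f V s))) \<and>
     (\<forall>x \<in> pts X. stalk_map X f x ` max_ideal (stalk Y (fst f x)) \<subseteq> max_ideal (stalk X x))}"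

definition lrs_id :: "('p, 's) lrs \<Rightarrow> ('p, 's, 'p, 's) lrs_map" where
  "lrs_id X = (\<lambda>x\<in>pts X. x, \<lambda>V\<in>{V. openin (sp X) V}. \<lambda>s\<in>carrier (sec X V). s)"

definition lrs_cmp ::
  "('p, 's) lrs \<Rightarrow> ('u, 'w) lrs \<Rightarrow> ('q, 't, 'u, 'w) lrs_map \<Rightarrow> ('p, 's, 'q, 't) lrs_map \<Rightarrow>
   ('q, 't) lrs \<Rightarrow> ('p, 's, 'u, 'w) lrs_map" where
  "lrs_cmp X Z g f Y = (compose (pts X) (fst g) (fst f),
     \<lambda>V\<in>{V. openin (sp Z) V}. compose (carrier (sec Z V)) (snd f (preim Y g V)) (snd g V))"

definition lrs_isomorphic :: "('p, 's) lrs \<Rightarrow> ('q, 't) lrs \<Rightarrow> bool" where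
  "lrs_isomorphic X Y \<longleftrightarrow> (\<exists>f \<in> lrs_hom X Y. \<exists>g \<in> lrs_hom Y X.
     lrs_cmp X X g f Y = lrs_id X \<and> lrs_cmp Y Y f g X = lrs_id Y)"

definition open_sub :: "('p, 's) lrs \<Rightarrow> 'p set \<Rightarrow> ('p, 's) lrs" where
  "open_sub X U = X\<lparr>sp := subtopology (sp X) U\<rparr>"

subsection \<open>Spectra and schemes\<close>

text \<open>\<open>fraction R P a s\<close> is the fraction \<open>a/s\<close> in the localization of \<open>R\<close> at the prime ideal \<open>P\<close>.\<close>

definition fraction :: "'r ring \<Rightarrow> 'r set \<Rightarrow> 'r \<Rightarrow> 'r \<Rightarrow> ('r \<times> 'r) set" where
  "fraction R P a s = {(b, t). b \<in> carrier R \<and> t \<in> carrier R - P \<and>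
     (\<exists>w \<in> carrier R - P. w \<otimes>\<^bsub>R\<^esub> (a \<otimes>\<^bsub>R\<^esub> t) = w \<otimes>\<^bsub>R\<^esub> (b \<otimes>\<^bsub>R\<^esub> s))}"

definition localize :: "'r ring \<Rightarrow> 'r set \<Rightarrow> ('r \<times> 'r) set ring" where
  "localize R P =
     \<lparr>carrier = {fraction R P a s | a s. a \<in> carrier R \<and> s \<in> carrier R - P},
      mult = (\<lambda>x y. THE z. \<exists>a s b t. (a, s) \<in> x \<and> (b, t) \<in> y \<and>
         z = fraction R P (a \<otimes>\<^bsub>R\<^esub> b) (s \<otimes>\<^bsub>R\<^esub> t)),
      one = fraction R P \<one>\<^bsub>R\<^esub> \<one>\<^bsub>R\<^esub>,
      zero = fraction R P \<zero>\<^bsub>R\<^esub> \<one>\<^bsub>R\<^esub>,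
      add = (\<lambda>x y. THE z. \<exists>a s b t. (a, s) \<in> x \<and> (b, t) \<in> y \<and>
         z = fraction R P ((a \<otimes>\<^bsub>R\<^esub> t) \<oplus>\<^bsub>R\<^esub> (b \<otimes>\<^bsub>R\<^esub> s)) (s \<otimes>\<^bsub>R\<^esub> t))\<rparr>"

definition zariski :: "'r ring \<Rightarrow> 'r set topology" where
  "zariski R = topology (\<lambda>U. \<exists>S \<subseteq> carrier R. U = {P. primeideal P R \<and> \<not> S \<subseteq> P})"

definition Spec_sec :: "'r ring \<Rightarrow> 'r set set \<Rightarrow> ('r set \<Rightarrow> ('r \<times> 'r) set) set" where
  "Spec_sec R U = {\<sigma> \<in> (\<Pi>\<^sub>E P \<in> U. carrier (localize R P)). \<forall>P \<in> U. \<exists>V a f.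
     openin (zariski R) V \<and> P \<in> V \<and> V \<subseteq> U \<and> a \<in> carrier R \<and> f \<in> carrier R \<and>
     (\<forall>Q \<in> V. f \<notin> Q \<and> \<sigma> Q = fraction R Q a f)}"

definition Spec :: "'r ring \<Rightarrow> ('r set, 'r set \<Rightarrow> ('r \<times> 'r) set) lrs" where
  "Spec R =
     \<lparr>sp = zariski R,
      sec = (\<lambda>U. \<lparr>carrier = Spec_sec R U,
         mult = (\<lambda>\<sigma> \<tau>. \<lambda>P\<in>U. \<sigma> P \<otimes>\<^bsub>localize R P\<^esub> \<tau> P),
         one = (\<lambda>P\<in>U. \<one>\<^bsub>localize R P\<^esub>),
         zero = (\<lambda>P\<in>U. \<zero>\<^bsub>localize R P\<^esub>),
         add = (\<lambda>\<sigma> \<tau>. \<lambda>P\<in>U. \<sigma> P \<oplus>\<^bsub>localize R P\<^esub> \<tau> P)\<rparr>),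
      res = (\<lambda>U V \<sigma>. restrict \<sigma> V)\<rparr>"

text \<open>
  The ring is isomorphic to the ring of global sections, so that it may be taken with elements
  in the type of sections.
\<close>

definition affine_scheme :: "('p, 's) lrs \<Rightarrow> bool" where
  "affine_scheme X \<longleftrightarrow> locally_ringed_space X \<and> (\<exists>R::'s ring. cring R \<and> lrs_isomorphic X (Spec R))"

definition affine_open :: "('p, 's) lrs \<Rightarrow> 'p set \<Rightarrow> bool" where
  "affine_open X U \<longleftrightarrow> openin (sp X) U \<and> affine_scheme (open_sub X U)"

definition is_scheme :: "('p, 's) lrs \<Rightarrow> bool" where
  "is_scheme X \<longleftrightarrow> locally_ringed_space X \<and> (\<forall>x \<in> pts X. \<exists>U. x \<in> U \<and> affine_open X U)"

subsection \<open>Properties of schemes\<close>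

definition noetherian_scheme :: "('p, 's) lrs \<Rightarrow> bool" where
  "noetherian_scheme X \<longleftrightarrow> is_scheme X \<and> compact_space (sp X) \<and>
     (\<forall>x \<in> pts X. \<exists>U. x \<in> U \<and> affine_open X U \<and> noetherian_ring (sec X U))"

definition reduced_scheme :: "('p, 's) lrs \<Rightarrow> bool" where
  "reduced_scheme X \<longleftrightarrow> is_scheme X \<and> (\<forall>U. openin (sp X) U \<longrightarrow>
     (\<forall>s \<in> carrier (sec X U). \<forall>n::nat. s [^]\<^bsub>sec X U\<^esub> n = \<zero>\<^bsub>sec X U\<^esub> \<longrightarrow> s = \<zero>\<^bsub>sec X U\<^esub>))"

definition irreducible_in :: "'p topology \<Rightarrow> 'p set \<Rightarrow> bool" where
  "irreducible_in T S \<longleftrightarrow> S \<noteq> {} \<and> S \<subseteq> topspace T \<and>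
     (\<forall>C D. closedin T C \<longrightarrow> closedin T D \<longrightarrow> S \<subseteq> C \<union> D \<longrightarrow> S \<subseteq> C \<or> S \<subseteq> D)"

definition krull_dim_space :: "'p topology \<Rightarrow> enat" where
  "krull_dim_space T = Sup {enat n | n. \<exists>c::nat \<Rightarrow> 'p set.
     (\<forall>i\<le>n. closedin T (c i) \<and> irreducible_in T (c i)) \<and> (\<forall>i<n. c i \<subset> c (Suc i))}"

definition krull_dim_ring :: "('r, 'z) ring_scheme \<Rightarrow> enat" where
  "krull_dim_ring R = Sup {enat n | n. \<exists>c::nat \<Rightarrow> 'r set.
     (\<forall>i\<le>n. primeideal (c i) R) \<and> (\<forall>i<n. c i \<subset> c (Suc i))}"

text \<open>Points whose closure is an irreducible component of the closed set \<open>Z\<close>.\<close>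

definition generic_points :: "'p topology \<Rightarrow> 'p set \<Rightarrow> 'p set" where
  "generic_points T Z = {z \<in> Z. \<forall>S. closedin T S \<longrightarrow> irreducible_in T S \<longrightarrow> S \<subseteq> Z \<longrightarrow>
     T closure_of {z} \<subseteq> S \<longrightarrow> S = T closure_of {z}}"

definition codim :: "('p, 's) lrs \<Rightarrow> 'p set \<Rightarrow> enat" where
  "codim Y Z = Inf ((\<lambda>z. krull_dim_ring (stalk Y z)) ` generic_points (sp Y) Z)"

subsection \<open>Properties of morphisms\<close>

definition open_immersion :: "('p, 's) lrs \<Rightarrow> ('q, 't) lrs \<Rightarrow> ('p, 's, 'q, 't) lrs_map \<Rightarrow> bool" where
  "open_immersion U Y j \<longleftrightarrow> j \<in> lrs_hom U Y \<and> openin (sp Y) (fst j ` pts U) \<and>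
     homeomorphic_map (sp U) (subtopology (sp Y) (fst j ` pts U)) (fst j) \<and>
     (\<forall>V. openin (sp Y) V \<longrightarrow> V \<subseteq> fst j ` pts U \<longrightarrow>
        bij_betw (snd j V) (carrier (sec Y V)) (carrier (sec U (preim U j V))))"

definition closed_immersion :: "('p, 's) lrs \<Rightarrow> ('q, 't) lrs \<Rightarrow> ('p, 's, 'q, 't) lrs_map \<Rightarrow> bool" where
  "closed_immersion Z Y i \<longleftrightarrow> i \<in> lrs_hom Z Y \<and> closedin (sp Y) (fst i ` pts Z) \<and>
     homeomorphic_map (sp Z) (subtopology (sp Y) (fst i ` pts Z)) (fst i) \<and>
     (\<forall>z \<in> pts Z. stalk_map Z i z ` carrier (stalk Y (fst i z)) = carrier (stalk Z z))"

text \<open>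
  The product of \<open>X\<close> with itself in the category of schemes.  If \<open>X\<close> has points and sections in
  an infinite type \<open>'a\<close>, then this product can be realized with points and sections in
  \<open>'a set\<close>.
\<close>

definition is_square ::
  "('a, 'a) lrs \<Rightarrow> ('a set, 'a set) lrs \<Rightarrow> ('a set, 'a set, 'a, 'a) lrs_map \<Rightarrow>
   ('a set, 'a set, 'a, 'a) lrs_map \<Rightarrow> bool" where
  "is_square X P p q \<longleftrightarrow> is_scheme P \<and> p \<in> lrs_hom P X \<and> q \<in> lrs_hom P X \<and>
     (\<forall>T::('a set, 'a set) lrs. is_scheme T \<longrightarrow> (\<forall>f \<in> lrs_hom T X. \<forall>g \<in> lrs_hom T X.
        \<exists>!h. h \<in> lrs_hom T P \<and> lrs_cmp T X p h P = f \<and> lrs_cmp T X q h P = g))"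

definition separated_scheme :: "('a, 'a) lrs \<Rightarrow> bool" where
  "separated_scheme X \<longleftrightarrow> is_scheme X \<and> (\<exists>P p q d. is_square X P p q \<and> closed_immersion X P d \<and>
     lrs_cmp X X p d P = lrs_id X \<and> lrs_cmp X X q d P = lrs_id X)"

definition base_scheme :: "('a, 'a) lrs \<Rightarrow> bool" where
  "base_scheme X \<longleftrightarrow> noetherian_scheme X \<and> separated_scheme X \<and> krull_dim_space (sp X) < \<infinity>"

text \<open>
  Smooth and etale ring maps: of finite presentation and formally smooth (resp. formally etale).
  They are only used over Noetherian rings, where finite presentation is finite type.  Lifting
  through square-zero extensions is tested for rings \<open>A\<close> with elements in \<open>'a\<close>; since \<open>'a\<close> is infinite
  and \<open>S\<close> is of finite type over \<open>R\<close>, the universal test objects (the quotient of a polynomial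
  ring \<open>R[x\<^sub>1,\<dots>,x\<^sub>n]\<close> by the square of the kernel of a presentation of \<open>S\<close>, and the square-zero extension of
  \<open>S\<close> by its differentials) are among them.
\<close>

definition finite_type_ring_map :: "'a ring \<Rightarrow> 'a ring \<Rightarrow> ('a \<Rightarrow> 'a) \<Rightarrow> bool" where
  "finite_type_ring_map R S \<phi> \<longleftrightarrow> \<phi> \<in> ring_hom R S \<and>
     (\<exists>E \<subseteq> carrier S. finite E \<and> carrier S = generate_ring S (\<phi> ` carrier R \<union> E))"

definition sqzero_problem ::
  "'a ring \<Rightarrow> 'a ring \<Rightarrow> ('a \<Rightarrow> 'a) \<Rightarrow> 'a ring \<Rightarrow> 'a set \<Rightarrow> ('a \<Rightarrow> 'a) \<Rightarrow> ('a \<Rightarrow> 'a set) \<Rightarrow> bool" where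
  "sqzero_problem R S \<phi> A I g h \<longleftrightarrow> cring A \<and> ideal I A \<and>
     (\<forall>x \<in> I. \<forall>y \<in> I. x \<otimes>\<^bsub>A\<^esub> y = \<zero>\<^bsub>A\<^esub>) \<and> g \<in> ring_hom R A \<and> h \<in> ring_hom S (A Quot I) \<and>
     (\<forall>r \<in> carrier R. h (\<phi> r) = I +>\<^bsub>A\<^esub> g r)"

definition sqzero_lift ::
  "'a ring \<Rightarrow> 'a ring \<Rightarrow> ('a \<Rightarrow> 'a) \<Rightarrow> 'a ring \<Rightarrow> 'a set \<Rightarrow> ('a \<Rightarrow> 'a) \<Rightarrow> ('a \<Rightarrow> 'a set) \<Rightarrow> ('a \<Rightarrow> 'a) \<Rightarrow> bool" where
  "sqzero_lift R S \<phi> A I g h k \<longleftrightarrow> k \<in> ring_hom S A \<and> k \<in> extensional (carrier S) \<and>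
     (\<forall>r \<in> carrier R. k (\<phi> r) = g r) \<and> (\<forall>s \<in> carrier S. I +>\<^bsub>A\<^esub> k s = h s)"

definition smooth_ring_map :: "'a ring \<Rightarrow> 'a ring \<Rightarrow> ('a \<Rightarrow> 'a) \<Rightarrow> bool" where
  "smooth_ring_map R S \<phi> \<longleftrightarrow> finite_type_ring_map R S \<phi> \<and>
     (\<forall>A I g h. sqzero_problem R S \<phi> A I g h \<longrightarrow> (\<exists>k. sqzero_lift R S \<phi> A I g h k))"

definition etale_ring_map :: "'a ring \<Rightarrow> 'a ring \<Rightarrow> ('a \<Rightarrow> 'a) \<Rightarrow> bool" where
  "etale_ring_map R S \<phi> \<longleftrightarrow> finite_type_ring_map R S \<phi> \<and>
     (\<forall>A I g h. sqzero_problem R S \<phi> A I g h \<longrightarrow> (\<exists>!k. sqzero_lift R S \<phi> A I g h k))"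

type_synonym 'a sch = "('a, 'a) lrs"
type_synonym 'a smap = "('a, 'a, 'a, 'a) lrs_map"

definition locally_of_kind ::
  "('a ring \<Rightarrow> 'a ring \<Rightarrow> ('a \<Rightarrow> 'a) \<Rightarrow> bool) \<Rightarrow> 'a sch \<Rightarrow> 'a sch \<Rightarrow> 'a smap \<Rightarrow> bool" where
  "locally_of_kind K Y X f \<longleftrightarrow> f \<in> lrs_hom Y X \<and>
     (\<forall>y \<in> pts Y. \<exists>V U. affine_open Y V \<and> affine_open X U \<and> y \<in> V \<and> fst f ` V \<subseteq> U \<and>
        K (sec X U) (sec Y V) (\<lambda>s. res Y (preim Y f U) V (snd f U s)))"

definition smooth :: "'a sch \<Rightarrow> 'a sch \<Rightarrow> 'a smap \<Rightarrow> bool" where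
  "smooth Y X f \<longleftrightarrow> locally_of_kind smooth_ring_map Y X f"

definition etale :: "'a sch \<Rightarrow> 'a sch \<Rightarrow> 'a smap \<Rightarrow> bool" where
  "etale Y X f \<longleftrightarrow> locally_of_kind etale_ring_map Y X f"

definition quasi_compact :: "'a sch \<Rightarrow> 'a sch \<Rightarrow> 'a smap \<Rightarrow> bool" where
  "quasi_compact Y X f \<longleftrightarrow> (\<forall>U. openin (sp X) U \<longrightarrow> compactin (sp X) U \<longrightarrow> compactin (sp Y) (preim Y f U))"

definition finite_type :: "'a sch \<Rightarrow> 'a sch \<Rightarrow> 'a smap \<Rightarrow> bool" where
  "finite_type Y X f \<longleftrightarrow> locally_of_kind finite_type_ring_map Y X f \<and> quasi_compact Y X f"

definition residue_field :: "('p, 's) lrs \<Rightarrow> 'p \<Rightarrow> ('p, 's) germ set ring" where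
  "residue_field X x = stalk X x Quot max_ideal (stalk X x)"

definition residue_map ::
  "('p, 's) lrs \<Rightarrow> ('p, 's, 'q, 't) lrs_map \<Rightarrow> 'p \<Rightarrow> ('q, 't) germ set \<Rightarrow> ('p, 's) germ set" where
  "residue_map X f x c =
     (THE d. \<exists>g \<in> c. d = max_ideal (stalk X x) +>\<^bsub>stalk X x\<^esub> stalk_map X f x g)"

text \<open>
  The relative affine line over \<open>Y\<close>, i.e. the relative spectrum of \<open>\<O>\<^sub>Y[t]\<close>: over every affine open \<open>U\<close> of
  \<open>Y\<close> it is affine, and its ring is the polynomial ring in \<open>t\<close> over the ring of \<open>U\<close>.
\<close>

definition affine_line :: "'a sch \<Rightarrow> 'a sch \<Rightarrow> 'a smap \<Rightarrow> bool" where
  "affine_line W Y q \<longleftrightarrow> q \<in> lrs_hom W Y \<and> (\<exists>t \<in> carrier (sec W (pts W)). \<forall>U. affine_open Y U \<longrightarrow>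
     affine_open W (preim W q U) \<and>
     eval (sec Y U) (sec W (preim W q U)) (snd q U) (res W (pts W) (preim W q U) t)
       \<in> ring_iso (UP (sec Y U)) (sec W (preim W q U)))"

section \<open>The Nisnevich site of smooth schemes and the motivic model structure\<close>

text \<open>
  Schemes over \<open>X\<close> have points and sections in the same type \<open>'a\<close> as \<open>X\<close>.  As \<open>'a\<close> is infinite and \<open>X\<close>
  is Noetherian, every scheme of finite type over \<open>X\<close> is isomorphic to one of these, so that
  this is a small model of the category of smooth schemes of finite type over \<open>X\<close>.
\<close>

type_synonym 'a smob = "'a sch \<times> 'a smap"
type_synonym 'a smar = "'a smob \<times> 'a smap \<times> 'a smob"

definition Sm_obj :: "'a sch \<Rightarrow> 'a smob set" where
  "Sm_obj X = {(Y, f). is_scheme Y \<and> smooth Y X f \<and> finite_type Y X f}"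

definition Sm :: "'a sch \<Rightarrow> ('a smob, 'a smar) cat" where
  "Sm X =
     \<lparr>Ob = Sm_obj X,
      Ar = {((Y, f), h, (Y', f')) | Y f h Y' f'. (Y, f) \<in> Sm_obj X \<and> (Y', f') \<in> Sm_obj X \<and>
         h \<in> lrs_hom Y Y' \<and>
         lrs_cmp Y X f' h Y' = f},
      Dom = fst,
      Cod = (\<lambda>k. snd (snd k)),
      Idn = (\<lambda>Y. (Y, lrs_id (fst Y), Y)),
      Cmp = (\<lambda>k l. (fst l,
         lrs_cmp (fst (fst l)) (fst (snd (snd k))) (fst (snd k)) (fst (snd l)) (fst (fst k)),
         snd (snd k)))\<rparr>"

definition nis_cov :: "'a sch \<Rightarrow> 'a smob \<Rightarrow> 'a smar set set" where
  "nis_cov X Y = {S. S \<subseteq> Ar (Sm X) \<and>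
     (\<forall>(V, h, Y') \<in> S. Y' = Y \<and> etale (fst V) (fst Y) h) \<and>
     (\<forall>y \<in> pts (fst Y). \<exists>(V, h, Y') \<in> S. \<exists>v \<in> pts (fst V). fst h v = y \<and>
        bij_betw (residue_map (fst V) h v)
          (carrier (residue_field (fst Y) y)) (carrier (residue_field (fst V) v)))}"

definition A1_proj :: "'a sch \<Rightarrow> 'a smar set" where
  "A1_proj X = {(W, q, Y) | W q Y. (W, q, Y) \<in> Ar (Sm X) \<and> affine_line (fst W) (fst Y) q}"

type_synonym ('a, 'v) mob = "('a smob, 'a smar, 'v) pob"
type_synonym ('a, 'v) mar = "('a smob, 'a smar, 'v) par"

abbreviation Mcat :: "'a sch \<Rightarrow> (('a, 'v) mob, ('a, 'v) mar) cat" where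
  "Mcat X \<equiv> pcat (Sm X)"

definition motivic_model_structure :: "'a sch \<Rightarrow> ('a, 'v) mar model \<Rightarrow> bool" where
  "motivic_model_structure X M \<longleftrightarrow> model_structure (Mcat X) M \<and>
     cof M = {(A, \<phi>, B). (A, \<phi>, B) \<in> Ar (Mcat X) \<and> spsh_mono (Sm X) (fst A) \<phi>} \<and>
     weq M = {(A, \<phi>, B). (A, \<phi>, B) \<in> Ar (Mcat X) \<and>
        motivic_weq (Sm X) (nis_cov X) (A1_proj X) (fst A) (fst B) \<phi>}"

text \<open>
  The closed subset \<open>Y \<setminus> U\<close> with its reduced structure is given as a closed immersion \<open>i\<close> over \<open>X\<close> from
  a reduced scheme with this image.
\<close>

definition WB :: "'a sch \<Rightarrow> ('a smar option \<Rightarrow> 'v) \<Rightarrow> nat \<Rightarrow> ('a, 'v) mar set" where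
  "WB X emb n = {rep_map (Sm X) emb (U, j, Y) | U j Y.
     (U, j, Y) \<in> Ar (Sm X) \<and> open_immersion (fst U) (fst Y) j \<and>
     irreducible_in (sp (fst Y)) (pts (fst Y)) \<and>
     (\<exists>Z i. (Z, i, Y) \<in> Ar (Sm X) \<and> reduced_scheme (fst Z) \<and> closed_immersion (fst Z) (fst Y) i \<and>
        fst i ` pts (fst Z) = pts (fst Y) - fst j ` pts (fst U)) \<and>
     codim (fst Y) (pts (fst Y) - fst j ` pts (fst U)) \<ge> enat (n + 1)}"

section \<open>The tower and the slices\<close>

text \<open>
  \<open>L n\<close> is the localized model structure \<open>WB\<^sub>n\<M>\<close>.  With the convention that the zeroth stage is
  the point and \<open>tau_le 0 A\<close> is the map \<open>A \<rightarrow> *\<close>, the construction of the first stage becomes an instance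
  of the recursion.
\<close>

primrec tau_le :: "'a sch \<Rightarrow> (nat \<Rightarrow> ('a, 'v) mar model) \<Rightarrow> nat \<Rightarrow> ('a, 'v) mob \<Rightarrow> ('a, 'v) mar" where
  "tau_le X L 0 A = to_pt (Sm X) A"
| "tau_le X L (Suc n) A = ffL (fact_tcf (L n)) (tau_le X L n A)"

definition nu :: "'a sch \<Rightarrow> (nat \<Rightarrow> ('a, 'v) mar model) \<Rightarrow> nat \<Rightarrow> ('a, 'v) mob \<Rightarrow> ('a, 'v) mar" where
  "nu X L n A = ffR (fact_tcf (L n)) (tau_le X L n A)"

primrec tau_map :: "'a sch \<Rightarrow> (nat \<Rightarrow> ('a, 'v) mar model) \<Rightarrow> nat \<Rightarrow> ('a, 'v) mar \<Rightarrow> ('a, 'v) mar" where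
  "tau_map X L 0 f = Idn (Mcat X) pt"
| "tau_map X L (Suc n) f = ffM (fact_tcf (L n))
     (tau_le X L n (Dom (Mcat X) f)) (tau_le X L n (Cod (Mcat X) f)) f (tau_map X L n f)"

definition tau ::
  "'a sch \<Rightarrow> (nat \<Rightarrow> ('a, 'v) mar model) \<Rightarrow> nat \<Rightarrow> (('a, 'v) mob, ('a, 'v) mar, ('a, 'v) mob, ('a, 'v) mar) fctr"
  where
  "tau X L n = \<lparr>fob = (\<lambda>A. Cod (Mcat X) (tau_le X L n A)), far = tau_map X L n\<rparr>"

definition incl :: "'a sch \<Rightarrow> (nat \<Rightarrow> ('a, 'v) mar model) \<Rightarrow> nat \<Rightarrow> ('a, 'v) mob \<Rightarrow> ('a, 'v) mar" where
  "incl X L n A = (if n = 0 then Idn (Mcat X) (fob (tau X L 1) A) else fibre_incl (Sm X) (nu X L n A))"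

definition slice_pre ::
  "'a sch \<Rightarrow> (nat \<Rightarrow> ('a, 'v) mar model) \<Rightarrow> nat \<Rightarrow> (('a, 'v) mob, ('a, 'v) mar, ('a, 'v) mob, ('a, 'v) mar) fctr"
  where
  "slice_pre X L n = (if n = 0 then tau X L 1 else
     \<lparr>fob = (\<lambda>A. fibre (nu X L n A)),
      far = (\<lambda>f. let F = fibre (nu X L n (Dom (Mcat X) f)) in
        (F, \<lambda>Y\<in>Ob (Sm X). \<lambda>k. restrict (fst (snd (tau_map X L (n + 1) f)) Y k) (smp (sval (fst F) Y) k),
         fibre (nu X L n (Cod (Mcat X) f))))\<rparr>)"

type_synonym ('a, 'v) har = "(('a, 'v) mob, ('a, 'v) mar) loc_ar"

definition Hcat :: "'a sch \<Rightarrow> ('a, 'v) mar model \<Rightarrow> (('a, 'v) mob, ('a, 'v) har) cat" where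
  "Hcat X M = loc_cat (Mcat X) (weq M)"

definition Ho ::
  "'a sch \<Rightarrow> ('a, 'v) mar model \<Rightarrow> (('a, 'v) mob, ('a, 'v) mar, ('a, 'v) mob, ('a, 'v) har) fctr" where
  "Ho X M = loc (Mcat X) (weq M)"

definition t_fun ::
  "'a sch \<Rightarrow> ('a, 'v) mar model \<Rightarrow> (nat \<Rightarrow> ('a, 'v) mar model) \<Rightarrow> nat \<Rightarrow>
   (('a, 'v) mob, ('a, 'v) har, ('a, 'v) mob, ('a, 'v) har) fctr" where
  "t_fun X M L n = induced (Mcat X) (weq M) (tau X L n)"

definition s_fun ::
  "'a sch \<Rightarrow> ('a, 'v) mar model \<Rightarrow> (nat \<Rightarrow> ('a, 'v) mar model) \<Rightarrow> nat \<Rightarrow>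
   (('a, 'v) mob, ('a, 'v) har, ('a, 'v) mob, ('a, 'v) har) fctr" where
  "s_fun X M L n = induced (Mcat X) (weq M) (slice_pre X L n)"

text \<open>
  The natural maps \<open>A \<rightarrow> t\<^sub>n A\<close> and \<open>s\<^sub>n A \<rightarrow> t\<^sub>n\<^sub>+\<^sub>1 A\<close> and the map \<open>A \<rightarrow> *\<close> in the homotopy
  category, whose objects are those of the model category.
\<close>

definition h_tau_le ::
  "'a sch \<Rightarrow> ('a, 'v) mar model \<Rightarrow> (nat \<Rightarrow> ('a, 'v) mar model) \<Rightarrow> nat \<Rightarrow> ('a, 'v) mob \<Rightarrow> ('a, 'v) har" where
  "h_tau_le X M L n A = far (Ho X M) (tau_le X L n A)"

definition h_incl ::
  "'a sch \<Rightarrow> ('a, 'v) mar model \<Rightarrow> (nat \<Rightarrow> ('a, 'v) mar model) \<Rightarrow> nat \<Rightarrow> ('a, 'v) mob \<Rightarrow> ('a, 'v) har" where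
  "h_incl X M L n A = far (Ho X M) (incl X L n A)"

definition h_to_pt :: "'a sch \<Rightarrow> ('a, 'v) mar model \<Rightarrow> ('a, 'v) mob \<Rightarrow> ('a, 'v) har" where
  "h_to_pt X M A = far (Ho X M) (to_pt (Sm X) A)"

definition is_slice ::
  "'a sch \<Rightarrow> ('a, 'v) mar model \<Rightarrow> (nat \<Rightarrow> ('a, 'v) mar model) \<Rightarrow> nat \<Rightarrow> ('a, 'v) mob \<Rightarrow> bool" where
  "is_slice X M L n A \<longleftrightarrow> A \<in> Ob (Hcat X M) \<and>
     h_tau_le X M L (n + 1) A \<in> arr (Hcat X M) A (fob (t_fun X M L (n + 1)) A) \<and>
     iso_in (Hcat X M) (h_tau_le X M L (n + 1) A) \<and>
     h_incl X M L n A \<in> arr (Hcat X M) (fob (s_fun X M L n) A) (fob (t_fun X M L (n + 1)) A) \<and>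
     iso_in (Hcat X M) (h_incl X M L n A)"

end

theory Submission
  imports Defs
begin

text \<open>
  Let \<open>n \<ge> 1\<close>.  Every \<open>\<tau>\<^sub>k A\<close> is fibrant in \<open>WB\<^sub>k\<^sub>-\<^sub>1\<M>\<close>, so that a local weak equivalence \<open>\<tau>\<^sub>k A \<rightarrow> *\<close> is a
  trivial fibration, hence already a motivic one.  If the inclusion \<open>i\<close> of the fibre of \<open>\<nu>\<^sub>n\<close> is
  invertible in the homotopy category, then \<open>\<nu>\<^sub>n\<close> is null there since \<open>\<nu>\<^sub>n i\<close> is, and so is \<open>A \<rightarrow> \<tau>\<^sub>n A\<close>;
  as the latter is an equivalence in \<open>WB\<^sub>n\<^sub>-\<^sub>1\<M>\<close>, the stage \<open>\<tau>\<^sub>n A\<close> is contractible, and by two-out-of-three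
  so are the lower stages.  Conversely, the inclusion of the fibre of a fibration with a fibrant contractible base
  is a weak equivalence.
\<close>

text \<open>Invertibility in the homotopy category is a statement about zigzags modulo relations,
  while the argument needs facts about actual arrows. The bridge is a fibrant object
  \<open>B\<close>: weak equivalences act bijectively on homotopy classes of arrows into
  \<open>B\<close>, so these classes can be pulled back along zigzags, and equivalent zigzags pull
  back alike. The class \<open>W\<close> of inverted arrows only has to lie in \<open>weq M\<close>;
  hence motivic isomorphisms can be tested with the homotopies of a Bousfield localization, where
  \<open>A -> tau_n A\<close> is a weak equivalence. Passing from a contractible base to the
  inclusion of the fibre would usually be an instance of right properness; here a transport map,
  built from a product and a lift, gives it directly. Products in turn require pairs of elements to
  be coded inside the one type of elements of sets.\<close>

section \<open>Zigzags\<close>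

text \<open>The record \<open>cat\<close> carries no laws. They are collected in terms of hom-sets
  \<open>arr\<close>, so that composability is visible in the membership premises and needs no
  separate equations between sources and targets.\<close>

locale category =
  fixes C :: "('o, 'm) cat"
  assumes Idn_arr: "A \<in> Ob C \<Longrightarrow> Idn C A \<in> arr C A A"
    and arr_Ob: "f \<in> arr C A B \<Longrightarrow> A \<in> Ob C \<and> B \<in> Ob C"
    and Cmp_arr: "\<lbrakk>f \<in> arr C A B; g \<in> arr C B D\<rbrakk> \<Longrightarrow> Cmp C g f \<in> arr C A D"
    and Cmp_Idn: "f \<in> arr C A B \<Longrightarrow> Cmp C f (Idn C A) = f"
    and Idn_Cmp: "f \<in> arr C A B \<Longrightarrow> Cmp C (Idn C B) f = f"
    and Cmp_assoc: "\<lbrakk>f \<in> arr C A B; g \<in> arr C B D; h \<in> arr C D E\<rbrakk> \<Longrightarrow>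
      Cmp C (Cmp C h g) f = Cmp C h (Cmp C g f)"

lemma arrD: "f \<in> arr C A B \<Longrightarrow> f \<in> Ar C" "f \<in> arr C A B \<Longrightarrow> Dom C f = A"
  "f \<in> arr C A B \<Longrightarrow> Cod C f = B"
  by (auto simp: arr_def)

lemma arrI: "f \<in> Ar C \<Longrightarrow> f \<in> arr C (Dom C f) (Cod C f)"
  by (auto simp: arr_def)

context category
begin


lemma Ar_Ob: "f \<in> Ar C \<Longrightarrow> Dom C f \<in> Ob C \<and> Cod C f \<in> Ob C"
  using arr_Ob arrI by metis

lemma zz_path_source: "zz_path C W A l B \<Longrightarrow> A \<in> Ob C"
  using Ar_Ob by (cases "(C, W, A, l, B)" rule: zz_path.cases) auto

lemma zz_path_append: "zz_path C W A (k @ l) D \<longleftrightarrow> (\<exists>B. zz_path C W A k B \<and> zz_path C W B l D)"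
proof (induction k arbitrary: A)
  case Nil
  show ?case using zz_path_source by auto
next
  case (Cons x k)
  then show ?case by (cases x) auto
qed

lemma zz_path_Fwd: "f \<in> arr C A B \<Longrightarrow> zz_path C W A [Fwd f] B"
  using arr_Ob by (auto simp: arr_def)

lemma zz_path_Bwd: "w \<in> arr C A B \<Longrightarrow> w \<in> W \<Longrightarrow> zz_path C W B [Bwd w] A"
  using arr_Ob by (auto simp: arr_def)

lemma zz_cls_eq_iff: "zz_cls C W A B k = zz_cls C W A B l \<longleftrightarrow> equivclp (zz_step C W A B) k l"
proof
  assume "zz_cls C W A B k = zz_cls C W A B l"
  moreover have "l \<in> zz_cls C W A B l" by (simp add: zz_cls_def)
  ultimately have "l \<in> zz_cls C W A B k" by simp
  then show "equivclp (zz_step C W A B) k l" by (simp add: zz_cls_def)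
next
  assume e: "equivclp (zz_step C W A B) k l"
  show "zz_cls C W A B k = zz_cls C W A B l"
    unfolding zz_cls_def
    by (intro Collect_cong iffI, erule equivclp_trans[OF equivclp_sym[OF e]], erule equivclp_trans[OF e])
qed

text \<open>\<open>zz_cls\<close> makes sense for arbitrary lists. A step has genuine zigzags on
  both sides, so representatives that \<open>loc_cat\<close> picks by \<open>SOME\<close> from the
  class of a zigzag are composable again.\<close>

lemma zz_equiv_path:
  "equivclp (zz_step C W A B) k l \<Longrightarrow> zz_path C W A k B \<Longrightarrow> zz_path C W A l B"
  by (induction rule: equivclp_induct) (auto simp: zz_step_def)

lemma zz_step_append:
  assumes "zz_step C W A B k k'" and "zz_path C W B l D"
  shows "zz_step C W A D (k @ l) (k' @ l)"
  using assms unfolding zz_step_def zz_path_append by (metis append.assoc)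

lemma zz_step_prepend:
  assumes "zz_step C W B D l l'" and "zz_path C W A k B"
  shows "zz_step C W A D (k @ l) (k @ l')"
  using assms unfolding zz_step_def zz_path_append by (metis append.assoc)

lemma zz_equiv_append:
  assumes "equivclp (zz_step C W A B) k k'" and "zz_path C W B l D"
  shows "equivclp (zz_step C W A D) (k @ l) (k' @ l)"
  using assms(1)
proof (induction rule: equivclp_induct)
  case (step y y')
  then show ?case
    using zz_step_append[OF _ assms(2)] by (meson equivclp_into_equivclp)
qed simp

lemma zz_equiv_prepend:
  assumes "equivclp (zz_step C W B D) l l'" and "zz_path C W A k B"
  shows "equivclp (zz_step C W A D) (k @ l) (k @ l')"
  using assms(1)
proof (induction rule: equivclp_induct)
  case (step y y')
  then show ?case
    using zz_step_prepend[OF _ assms(2)] by (meson equivclp_into_equivclp)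
qed simp

text \<open>\<open>Cmp\<close> concatenates representatives chosen by \<open>SOME\<close>. The
  equivalence is a congruence for concatenation on either side, so the choice does not
  matter.\<close>

lemma loc_cat_Cmp:
  assumes k: "zz_path C W A k B" and l: "zz_path C W B l D"
  shows "Cmp (loc_cat C W) (B, zz_cls C W B D l, D) (A, zz_cls C W A B k, B)
    = (A, zz_cls C W A D (k @ l), D)"
proof -
  define k' where "k' = (SOME x. x \<in> zz_cls C W A B k)"
  define l' where "l' = (SOME x. x \<in> zz_cls C W B D l)"
  have "k' \<in> zz_cls C W A B k"
    unfolding k'_def by (rule someI[of _ k]) (simp add: zz_cls_def)
  then have kk: "equivclp (zz_step C W A B) k k'" by (simp add: zz_cls_def)
  have "l' \<in> zz_cls C W B D l"
    unfolding l'_def by (rule someI[of _ l]) (simp add: zz_cls_def)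
  then have ll: "equivclp (zz_step C W B D) l l'" by (simp add: zz_cls_def)
  have "equivclp (zz_step C W A D) (k @ l) (k' @ l')"
    using zz_equiv_append[OF kk l] zz_equiv_prepend[OF ll zz_equiv_path[OF kk k]]
    by (rule equivclp_trans)
  then show ?thesis
    by (simp add: loc_cat_def zz_cls_eq_iff[symmetric] flip: k'_def l'_def)
qed

lemma loc_arr:
  assumes "f \<in> arr C A B"
  shows "far (loc C W) f \<in> arr (loc_cat C W) A B"
  using zz_path_Fwd[OF assms] assms by (auto simp: loc_def loc_cat_def arr_def)

text \<open>An inverse is the class of some zigzag, so invertibility becomes two relations between
  lists. They are exploited one at a time: the first yields factorization through \<open>f\<close>,
  the second cancellation of \<open>f\<close>, both up to homotopy.\<close>

lemma iso_loc_iff: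
  assumes f: "f \<in> arr C A B"
  shows "iso_in (loc_cat C W) (far (loc C W) f) \<longleftrightarrow>
    (\<exists>l. zz_path C W B l A \<and> equivclp (zz_step C W A A) (Fwd f # l) []
       \<and> equivclp (zz_step C W B B) (l @ [Fwd f]) [])" (is "?L \<longleftrightarrow> ?R")
proof -
  have lf: "far (loc C W) f = (A, zz_cls C W A B [Fwd f], B)"
    using f by (simp add: loc_def arr_def)
  have comp: "Cmp (loc_cat C W) (B, zz_cls C W B A l, A) (A, zz_cls C W A B [Fwd f], B) = Idn (loc_cat C W) A
      \<longleftrightarrow> equivclp (zz_step C W A A) (Fwd f # l) []"
    "Cmp (loc_cat C W) (A, zz_cls C W A B [Fwd f], B) (B, zz_cls C W B A l, A) = Idn (loc_cat C W) B
      \<longleftrightarrow> equivclp (zz_step C W B B) (l @ [Fwd f]) []" if "zz_path C W B l A" for l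
    using loc_cat_Cmp[OF zz_path_Fwd[OF f] that] loc_cat_Cmp[OF that zz_path_Fwd[OF f]]
    by (simp_all add: zz_cls_eq_iff[symmetric]) (simp_all add: loc_cat_def)
  have ar: "far (loc C W) f \<in> Ar (loc_cat C W)"
    using loc_arr[OF f] by (auto simp: arr_def)
  have dc: "Dom (loc_cat C W) (far (loc C W) f) = A" "Cod (loc_cat C W) (far (loc C W) f) = B"
    using loc_arr[OF f] by (auto simp: arr_def)
  have hom: "g \<in> arr (loc_cat C W) B A \<longleftrightarrow> (\<exists>l. zz_path C W B l A \<and> g = (B, zz_cls C W B A l, A))" for g
    by (auto simp: arr_def loc_cat_def)
  have "?L \<longleftrightarrow> (\<exists>g \<in> arr (loc_cat C W) B A. Cmp (loc_cat C W) g (far (loc C W) f) = Idn (loc_cat C W) A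
      \<and> Cmp (loc_cat C W) (far (loc C W) f) g = Idn (loc_cat C W) B)"
    unfolding iso_in_def dc using ar by simp
  also have "\<dots> \<longleftrightarrow> ?R"
    unfolding Bex_def hom lf using comp by (metis (no_types))
  finally show ?thesis .
qed

lemma iso_loc_W:
  assumes w: "w \<in> arr C A B" and "w \<in> W"
  shows "iso_in (loc_cat C W) (far (loc C W) w)"
proof -
  note pF = zz_path_Fwd[OF w, of W] and pB = zz_path_Bwd[OF w assms(2)]
  have "zz_step C W A A [Fwd w, Bwd w] []"
    unfolding zz_step_def using pF pB arr_Ob[OF w] zz_basic.intros(3)[OF assms(2), of C]
    by (auto intro!: exI[of _ "[]"])
  moreover have "zz_step C W B B [Bwd w, Fwd w] []"
    unfolding zz_step_def using pF pB arr_Ob[OF w] zz_basic.intros(4)[OF assms(2), of C]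
    by (auto intro!: exI[of _ "[]"])
  ultimately show ?thesis
    unfolding iso_loc_iff[OF w] using pB by (auto intro!: exI[of _ "[Bwd w]"] r_into_equivclp)
qed

end

section \<open>Model categories\<close>

locale model_category = category +
  fixes M :: "'m model"
  assumes model: "model_structure C M"
begin

lemma fib_Ar: "fib M \<subseteq> Ar C"
  using model by (auto simp: model_structure_def wide_subcat_def)

lemma weq_Idn: "A \<in> Ob C \<Longrightarrow> Idn C A \<in> weq M" and fib_Idn: "A \<in> Ob C \<Longrightarrow> Idn C A \<in> fib M"
  using model by (auto simp: model_structure_def wide_subcat_def)

lemma weq_Cmp: "\<lbrakk>f \<in> arr C A B; g \<in> arr C B D; f \<in> weq M; g \<in> weq M\<rbrakk> \<Longrightarrow> Cmp C g f \<in> weq M"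
  and fib_Cmp: "\<lbrakk>f \<in> arr C A B; g \<in> arr C B D; f \<in> fib M; g \<in> fib M\<rbrakk> \<Longrightarrow> Cmp C g f \<in> fib M"
  using model by (auto simp: model_structure_def wide_subcat_def arr_def)

lemma two_of_three: "\<forall>f \<in> Ar C. \<forall>g \<in> Ar C. Cod C f = Dom C g \<longrightarrow>
    (f \<in> weq M \<and> Cmp C g f \<in> weq M \<longrightarrow> g \<in> weq M) \<and>
    (g \<in> weq M \<and> Cmp C g f \<in> weq M \<longrightarrow> f \<in> weq M)"
  and retracts: "\<forall>f g. arrow_retract C f g \<longrightarrow>
    (g \<in> weq M \<longrightarrow> f \<in> weq M) \<and> (g \<in> cof M \<longrightarrow> f \<in> cof M) \<and> (g \<in> fib M \<longrightarrow> f \<in> fib M)"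
  and lifting: "\<forall>i \<in> cof M. \<forall>p \<in> fib M. i \<in> weq M \<or> p \<in> weq M \<longrightarrow> lifts C i p"
  and tcf: "functorial_factorization C (fact_tcf M)"
    "\<forall>f \<in> Ar C. ffL (fact_tcf M) f \<in> cof M \<inter> weq M \<and> ffR (fact_tcf M) f \<in> fib M"
  and ctf: "functorial_factorization C (fact_ctf M)"
    "\<forall>f \<in> Ar C. ffL (fact_ctf M) f \<in> cof M \<and> ffR (fact_ctf M) f \<in> fib M \<inter> weq M"
  using model unfolding model_structure_def by - (elim conjE, assumption)+

lemma weq_left: "\<lbrakk>f \<in> arr C A B; g \<in> arr C B D; f \<in> weq M; Cmp C g f \<in> weq M\<rbrakk> \<Longrightarrow> g \<in> weq M"
  and weq_right: "\<lbrakk>f \<in> arr C A B; g \<in> arr C B D; g \<in> weq M; Cmp C g f \<in> weq M\<rbrakk> \<Longrightarrow> f \<in> weq M"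
  using two_of_three by (auto simp: arr_def)

lemma weq_retract: "arrow_retract C f g \<Longrightarrow> g \<in> weq M \<Longrightarrow> f \<in> weq M"
  and fib_retract: "arrow_retract C f g \<Longrightarrow> g \<in> fib M \<Longrightarrow> f \<in> fib M"
  using retracts by auto

lemma squareI:
  assumes "f \<in> arr C A A'" "g \<in> arr C B B'" "u \<in> arr C A B" "v \<in> arr C A' B'" "Cmp C v f = Cmp C g u"
  shows "square C f g u v"
  using assms by (auto simp: square_def arr_def)

lemma liftE:
  assumes "lifts C i p" "i \<in> arr C X Y" "p \<in> arr C E B" "u \<in> arr C X E" "v \<in> arr C Y B"
    "Cmp C v i = Cmp C p u"
  obtains h where "h \<in> arr C Y E" "Cmp C h i = u" "Cmp C p h = v"
  using assms squareI[OF assms(2,3,4,5,6)] unfolding lifts_def by (metis arrD(2,3))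

lemma lifts_tcof_fib: "\<lbrakk>i \<in> cof M; i \<in> weq M; p \<in> fib M\<rbrakk> \<Longrightarrow> lifts C i p"
  and lifts_cof_tfib: "\<lbrakk>i \<in> cof M; p \<in> fib M; p \<in> weq M\<rbrakk> \<Longrightarrow> lifts C i p"
  using lifting by auto

lemma factor_tcf:
  assumes f: "f \<in> arr C A B"
  defines "l \<equiv> ffL (fact_tcf M) f" and "r \<equiv> ffR (fact_tcf M) f"
  shows "l \<in> arr C A (Cod C l)" "r \<in> arr C (Cod C l) B" "Cmp C r l = f"
    "l \<in> cof M" "l \<in> weq M" "r \<in> fib M"
proof -
  note tcf
  then show "l \<in> arr C A (Cod C l)" "r \<in> arr C (Cod C l) B" "Cmp C r l = f"
    "l \<in> cof M" "l \<in> weq M" "r \<in> fib M"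
    using f unfolding functorial_factorization_def l_def r_def arr_def by auto
qed

lemma factor_ctf:
  assumes f: "f \<in> arr C A B"
  obtains Q l r where "l \<in> arr C A Q" "r \<in> arr C Q B" "Cmp C r l = f"
    "l \<in> cof M" "r \<in> fib M" "r \<in> weq M"
proof -
  note ctf
  then show ?thesis
    using f that[of "ffL (fact_ctf M) f" "Cod C (ffL (fact_ctf M) f)" "ffR (fact_ctf M) f"]
    unfolding functorial_factorization_def arr_def by auto
qed

text \<open>The retract argument: a diagonal in the square with the identity on top and
  \<open>r\<close> at the bottom splits the composite off \<open>r\<close>, with the codomain
  fixed.\<close>

lemma retract_of_right_factor:
  assumes l: "l \<in> arr C A Q" and r: "r \<in> arr C Q B" and "lifts C l (Cmp C r l)"
  shows "arrow_retract C (Cmp C r l) r"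
proof -
  have f: "Cmp C r l \<in> arr C A B" using Cmp_arr[OF l r] .
  have A: "A \<in> Ob C" and B: "B \<in> Ob C" using arr_Ob[OF f] by auto
  obtain h where h: "h \<in> arr C Q A" "Cmp C h l = Idn C A" "Cmp C (Cmp C r l) h = r"
    by (rule liftE[OF assms(3) l f Idn_arr[OF A] r]) (simp_all add: Cmp_Idn[OF f])
  have "square C (Cmp C r l) r l (Idn C B)"
    by (rule squareI[OF f r l Idn_arr[OF B]]) (simp add: Idn_Cmp[OF f])
  moreover have "square C r (Cmp C r l) h (Idn C B)"
    by (rule squareI[OF r f h(1) Idn_arr[OF B]]) (simp add: h Idn_Cmp[OF r])
  ultimately show ?thesis
    unfolding arrow_retract_def arrD(2,3)[OF f] using h Idn_Cmp[OF Idn_arr[OF B]] by blast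
qed

text \<open>The right factor of \<open>f\<close> is a fibration, and the retract argument makes
  \<open>f\<close> a retract of it. With \<open>tfib_if_lifts\<close> this shows that fibrations and
  trivial fibrations are determined by \<open>cof M\<close> and \<open>weq M\<close>, which allows
  model structures to be compared.\<close>

lemma fib_if_lifts:
  assumes "f \<in> Ar C" and "\<And>i. i \<in> cof M \<Longrightarrow> i \<in> weq M \<Longrightarrow> lifts C i f"
  shows "f \<in> fib M"
  using factor_tcf[OF arrI[OF assms(1)]] retract_of_right_factor assms(2) fib_retract by metis

lemma tfib_if_lifts:
  assumes "f \<in> Ar C" and "\<And>i. i \<in> cof M \<Longrightarrow> lifts C i f"
  shows "f \<in> fib M \<and> f \<in> weq M"
  using factor_ctf[OF arrI[OF assms(1)]] retract_of_right_factor assms(2) fib_retract weq_retract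
  by metis

text \<open>Among arrows, \<open>k\<close> is a retract of the idempotent
  \<open>Cmp C k \<rho>\<close>, by \<open>k\<close> and \<open>\<rho>\<close> on the sources and
  identities on the targets.\<close>

lemma weq_if_Cmp_retraction:
  assumes k: "k \<in> arr C F E" and \<rho>: "\<rho> \<in> arr C E F" and "Cmp C \<rho> k = Idn C F"
    and "Cmp C k \<rho> \<in> weq M"
  shows "k \<in> weq M" and "\<rho> \<in> weq M"
proof -
  have E: "E \<in> Ob C" using arr_Ob[OF k] by auto
  have k\<rho>: "Cmp C k \<rho> \<in> arr C E E" using Cmp_arr[OF \<rho> k] .
  have id: "Idn C E \<in> arr C E E" using Idn_arr[OF E] .
  have "square C k (Cmp C k \<rho>) k (Idn C E)"
    by (rule squareI[OF k k\<rho> k id]) (simp add: Idn_Cmp[OF k] Cmp_assoc[OF k \<rho> k] assms(3) Cmp_Idn[OF k])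
  moreover have "square C (Cmp C k \<rho>) k \<rho> (Idn C E)"
    by (rule squareI[OF k\<rho> k \<rho> id]) (simp add: Idn_Cmp[OF k\<rho>])
  ultimately have "arrow_retract C k (Cmp C k \<rho>)"
    unfolding arrow_retract_def arrD(2,3)[OF k] using assms(3) Idn_Cmp[OF id] by blast
  then show "k \<in> weq M" using assms(4) by (rule weq_retract)
  then show "\<rho> \<in> weq M" using weq_right[OF \<rho> k] assms(4) by blast
qed

end

section \<open>Model structures with the same cofibrations\<close>

lemma fib_mono:
  assumes "model_category C M" "model_category C N" "cof N = cof M" "weq M \<subseteq> weq N"
  shows "fib N \<subseteq> fib M"
proof
  interpret M: model_category C M by fact
  interpret N: model_category C N by fact
  fix f assume f: "f \<in> fib N"
  show "f \<in> fib M"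
    by (rule M.fib_if_lifts) (use f assms(3,4) N.fib_Ar N.lifts_tcof_fib in auto)
qed

text \<open>Trivial fibrations are the arrows with the right lifting property against all
  cofibrations, and the two structures share these. This carries contractibility of a locally
  fibrant object back to the motivic structure.\<close>

lemma tfib_mono:
  assumes "model_category C M" "model_category C N" "cof N = cof M" "f \<in> fib N" "f \<in> weq N"
  shows "f \<in> weq M"
proof -
  interpret M: model_category C M by fact
  interpret N: model_category C N by fact
  show ?thesis
    using M.tfib_if_lifts[of f] assms(3-) N.fib_Ar N.lifts_cof_tfib by auto
qed

section \<open>Pointed model categories in which split monomorphisms are cofibrations\<close>

locale pointed_category = category +
  fixes z :: 'o
  assumes zero_Ob: "z \<in> Ob C"
    and to_zero: "A \<in> Ob C \<Longrightarrow> \<exists>!f. f \<in> arr C A z"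
    and from_zero: "A \<in> Ob C \<Longrightarrow> \<exists>!f. f \<in> arr C z A"
    and products: "\<lbrakk>A \<in> Ob C; B \<in> Ob C\<rbrakk> \<Longrightarrow> \<exists>P p q. p \<in> arr C P A \<and> q \<in> arr C P B \<and>
      (\<forall>Y. \<forall>f \<in> arr C Y A. \<forall>g \<in> arr C Y B. \<exists>!h. h \<in> arr C Y P \<and> Cmp C p h = f \<and> Cmp C q h = g)"
begin

lemma to_zero_eq: "f \<in> arr C A z \<Longrightarrow> g \<in> arr C A z \<Longrightarrow> f = g"
  using to_zero arr_Ob by blast

lemma from_zero_eq: "f \<in> arr C z A \<Longrightarrow> g \<in> arr C z A \<Longrightarrow> f = g"
  using from_zero arr_Ob by blast

lemma productE:
  assumes "A \<in> Ob C" "B \<in> Ob C"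
  obtains P p q where "p \<in> arr C P A" "q \<in> arr C P B"
    "\<And>Y f g. \<lbrakk>f \<in> arr C Y A; g \<in> arr C Y B\<rbrakk> \<Longrightarrow> \<exists>h. h \<in> arr C Y P \<and> Cmp C p h = f \<and> Cmp C q h = g"
    "\<And>Y h h'. \<lbrakk>h \<in> arr C Y P; h' \<in> arr C Y P; Cmp C p h = Cmp C p h'; Cmp C q h = Cmp C q h'\<rbrakk> \<Longrightarrow> h = h'"
proof -
  obtain P p q where p: "p \<in> arr C P A" and q: "q \<in> arr C P B"
    and u: "\<forall>Y. \<forall>f \<in> arr C Y A. \<forall>g \<in> arr C Y B. \<exists>!h. h \<in> arr C Y P \<and> Cmp C p h = f \<and> Cmp C q h = g"
    using products[OF assms] by blast
  show ?thesis
  proof (rule that[OF p q])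
    fix Y h h'
    assume h: "h \<in> arr C Y P" "h' \<in> arr C Y P" and e: "Cmp C p h = Cmp C p h'" "Cmp C q h = Cmp C q h'"
    show "h = h'"
      using u[rule_format, OF Cmp_arr[OF h(1) p] Cmp_arr[OF h(1) q]] h e by metis
  qed (use u in blast)
qed

end

text \<open>That cofibrations are the monomorphisms enters through \<open>split_mono_cof\<close>. It
  covers the arrows out of \<open>z\<close>, which makes every object cofibrant, and also sections
  and graphs.\<close>

locale pointed_model_category = pointed_category + model_category +
  assumes split_mono_cof: "\<lbrakk>s \<in> arr C A B; r \<in> arr C B A; Cmp C r s = Idn C A\<rbrakk> \<Longrightarrow> s \<in> cof M"
begin

text \<open>The identity of \<open>Y\<close> lifts because \<open>z -> Y\<close> is split by
  \<open>Y -> z\<close>. The resulting section is a split monomorphism, and two-out-of-three makes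
  it trivial.\<close>

lemma tfib_section:
  assumes q: "q \<in> arr C Q Y" and "q \<in> fib M" "q \<in> weq M"
  obtains s where "s \<in> arr C Y Q" "Cmp C q s = Idn C Y" "s \<in> cof M" "s \<in> weq M"
proof -
  have ob: "Q \<in> Ob C" "Y \<in> Ob C" using arr_Ob[OF q] by auto
  obtain a where a: "a \<in> arr C z Y" using from_zero[OF ob(2)] by blast
  obtain b where b: "b \<in> arr C z Q" using from_zero[OF ob(1)] by blast
  obtain r where r: "r \<in> arr C Y z" using to_zero[OF ob(2)] by blast
  have "a \<in> cof M"
    using split_mono_cof[OF a r] to_zero_eq[OF Cmp_arr[OF a r] Idn_arr[OF zero_Ob]] by blast
  then have "lifts C a q" using lifts_cof_tfib assms by blast
  then obtain s where s: "s \<in> arr C Y Q" "Cmp C q s = Idn C Y"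
    by (rule liftE[OF _ a q b Idn_arr[OF ob(2)]])
      (subst Idn_Cmp[OF a], rule from_zero_eq[OF a Cmp_arr[OF b q]])
  then show ?thesis
    using that split_mono_cof[OF s(1) q s(2)] weq_right[OF s(1) q] assms(3) weq_Idn[OF ob(2)] by simp
qed

text \<open>
  Lifting the graph \<open>E \<rightarrow> E \<times> B\<close> against \<open>p\<close> gives a transport \<open>T: E \<times> B \<rightarrow> E\<close> with \<open>p (T (x, b)) = b\<close>
  and \<open>T (x, p x) = x\<close>; then \<open>x \<mapsto> T (x, *)\<close> retracts \<open>E\<close> onto the fibre.
\<close>

lemma fibre_weq:
  assumes p: "p \<in> arr C E B" "p \<in> fib M"
    and r: "r \<in> arr C B z" "r \<in> fib M" "r \<in> weq M"
    and i: "i \<in> arr C z B"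
    and k: "k \<in> arr C F E" and c: "c \<in> arr C F z" and pk: "Cmp C p k = Cmp C i c"
    and kernel: "\<And>Y f t. \<lbrakk>f \<in> arr C Y E; t \<in> arr C Y z; Cmp C p f = Cmp C i t\<rbrakk> \<Longrightarrow>
      \<exists>g \<in> arr C Y F. Cmp C k g = f"
    and k_mono: "\<And>Y g g'. \<lbrakk>g \<in> arr C Y F; g' \<in> arr C Y F; Cmp C k g = Cmp C k g'\<rbrakk> \<Longrightarrow> g = g'"
  shows "k \<in> weq M"
proof -
  have ob: "E \<in> Ob C" "B \<in> Ob C" "F \<in> Ob C" using arr_Ob p(1) k by auto
  note idE = Idn_arr[OF ob(1)] and idF = Idn_arr[OF ob(3)]
  obtain P p1 p2 where p1: "p1 \<in> arr C P E" and p2: "p2 \<in> arr C P B"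
    and pair: "\<And>Y f g. \<lbrakk>f \<in> arr C Y E; g \<in> arr C Y B\<rbrakk> \<Longrightarrow>
      \<exists>h. h \<in> arr C Y P \<and> Cmp C p1 h = f \<and> Cmp C p2 h = g"
    and uniq: "\<And>Y h h'. \<lbrakk>h \<in> arr C Y P; h' \<in> arr C Y P; Cmp C p1 h = Cmp C p1 h';
      Cmp C p2 h = Cmp C p2 h'\<rbrakk> \<Longrightarrow> h = h'"
    by (rule productE[OF ob(1,2)]) blast
  \<comment> \<open>\<open>p1\<close> is a base change of the trivial fibration \<open>r\<close>:
    the lift pairs the given \<open>v\<close> with an extension \<open>b\<close> of the second
    component, which exists because \<open>B\<close> is fibrant and contractible.\<close>
  have "lifts C j p1" if j: "j \<in> cof M" for j
    unfolding lifts_def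
  proof (intro allI impI)
    fix u v assume "square C j p1 u v"
    then obtain X Y where sq: "j \<in> arr C X Y" "u \<in> arr C X P" "v \<in> arr C Y E" "Cmp C v j = Cmp C p1 u"
      using p1 unfolding square_def by (auto simp: arr_def)
    obtain t where t: "t \<in> arr C Y z" using to_zero arr_Ob[OF sq(1)] by blast
    have "lifts C j r" using lifts_cof_tfib j r by blast
    then obtain b where b: "b \<in> arr C Y B" "Cmp C b j = Cmp C p2 u"
      by (rule liftE[OF _ sq(1) r(1) Cmp_arr[OF sq(2) p2] t])
        (rule to_zero_eq[OF Cmp_arr[OF sq(1) t] Cmp_arr[OF Cmp_arr[OF sq(2) p2] r(1)]])
    obtain h where h: "h \<in> arr C Y P" "Cmp C p1 h = v" "Cmp C p2 h = b"
      using pair[OF sq(3) b(1)] by blast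
    have "Cmp C h j = u"
      by (rule uniq[OF Cmp_arr[OF sq(1) h(1)] sq(2)])
        (simp_all add: Cmp_assoc[OF sq(1) h(1) p1, symmetric] Cmp_assoc[OF sq(1) h(1) p2, symmetric]
          h sq b)
    then show "\<exists>h \<in> arr C (Cod C j) (Dom C p1). Cmp C h j = u \<and> Cmp C p1 h = v"
      using h arrD[OF sq(1)] arrD[OF p1] by auto
  qed
  then have p1w: "p1 \<in> weq M" using tfib_if_lifts[of p1] arrD(1)[OF p1] by blast
  \<comment> \<open>As a section of the trivial fibration \<open>p1\<close>, the graph is a trivial
    cofibration, so its square with \<open>p\<close> has a diagonal \<open>T\<close>.\<close>
  obtain \<gamma> where \<gamma>: "\<gamma> \<in> arr C E P" "Cmp C p1 \<gamma> = Idn C E" "Cmp C p2 \<gamma> = p"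
    using pair[OF idE p(1)] by blast
  have "\<gamma> \<in> weq M" using weq_right[OF \<gamma>(1) p1 p1w] \<gamma>(2) weq_Idn[OF ob(1)] by simp
  then have "lifts C \<gamma> p"
    using lifts_tcof_fib split_mono_cof[OF \<gamma>(1) p1 \<gamma>(2)] p(2) by blast
  then obtain T where T: "T \<in> arr C P E" "Cmp C T \<gamma> = Idn C E" "Cmp C p T = p2"
    by (rule liftE[OF _ \<gamma>(1) p(1) idE p2]) (simp add: \<gamma> Cmp_Idn[OF p(1)])
  have Tw: "T \<in> weq M" using weq_left[OF \<gamma>(1) T(1) \<open>\<gamma> \<in> weq M\<close>] T(2) weq_Idn[OF ob(1)] by simp
  obtain e where e: "e \<in> arr C E z" using to_zero[OF ob(1)] by blast
  obtain \<epsilon> where \<epsilon>: "\<epsilon> \<in> arr C E P" "Cmp C p1 \<epsilon> = Idn C E" "Cmp C p2 \<epsilon> = Cmp C i e"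
    using pair[OF idE Cmp_arr[OF e i]] by blast
  have \<epsilon>w: "\<epsilon> \<in> weq M" using weq_right[OF \<epsilon>(1) p1 p1w] \<epsilon>(2) weq_Idn[OF ob(1)] by simp
  obtain \<rho> where \<rho>: "\<rho> \<in> arr C E F" "Cmp C k \<rho> = Cmp C T \<epsilon>"
    using kernel[OF Cmp_arr[OF \<epsilon>(1) T(1)] e]
    by (metis Cmp_assoc[OF \<epsilon>(1) T(1) p(1)] T(3) \<epsilon>(3))
  have "Cmp C \<epsilon> k = Cmp C \<gamma> k"
  proof (rule uniq[OF Cmp_arr[OF k \<epsilon>(1)] Cmp_arr[OF k \<gamma>(1)]])
    show "Cmp C p1 (Cmp C \<epsilon> k) = Cmp C p1 (Cmp C \<gamma> k)"
      by (simp add: Cmp_assoc[OF k _ p1, symmetric] \<epsilon> \<gamma>)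
    show "Cmp C p2 (Cmp C \<epsilon> k) = Cmp C p2 (Cmp C \<gamma> k)"
      by (simp add: Cmp_assoc[OF k _ p2, symmetric] \<epsilon> \<gamma> pk Cmp_assoc[OF k e i]
          to_zero_eq[OF Cmp_arr[OF k e] c])
  qed
  then have "Cmp C k (Cmp C \<rho> k) = Cmp C k (Idn C F)"
    by (metis Cmp_assoc[OF k \<rho>(1) k] \<rho>(2) Cmp_assoc[OF k \<epsilon>(1) T(1)] Cmp_assoc[OF k \<gamma>(1) T(1)]
        T(2) Idn_Cmp[OF k] Cmp_Idn[OF k])
  then have "Cmp C \<rho> k = Idn C F" by (rule k_mono[OF Cmp_arr[OF k \<rho>(1)] idF])
  then show ?thesis
    using weq_if_Cmp_retraction(1)[OF k \<rho>(1)] \<rho>(2) weq_Cmp[OF \<epsilon>(1) T(1) \<epsilon>w Tw] by simp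
qed

end

section \<open>Homotopy classes of maps into a fibrant object\<close>

text \<open>\<open>path_lift\<close> expresses that (d0, d1) is a fibration from \<open>P\<close> to
  the product of \<open>B\<close> with itself, phrased by components so that the product need not be
  carried along.\<close>

locale path_object = pointed_model_category +
  fixes B P :: 'o and \<sigma> d0 d1 :: 'm
  assumes fibrant: "r \<in> arr C B z \<Longrightarrow> r \<in> fib M"
    and path_arr: "\<sigma> \<in> arr C B P" "d0 \<in> arr C P B" "d1 \<in> arr C P B"
    and path_weq: "\<sigma> \<in> weq M"
    and d_sect: "Cmp C d0 \<sigma> = Idn C B" "Cmp C d1 \<sigma> = Idn C B"
    and path_lift: "\<lbrakk>j \<in> arr C X Y; j \<in> cof M; j \<in> weq M; h \<in> arr C X P; f \<in> arr C Y B; g \<in> arr C Y B;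
      Cmp C d0 h = Cmp C f j; Cmp C d1 h = Cmp C g j\<rbrakk> \<Longrightarrow>
      \<exists>H \<in> arr C Y P. Cmp C d0 H = f \<and> Cmp C d1 H = g"

context pointed_model_category
begin

text \<open>The diagonal of \<open>B\<close> is factored into a trivial cofibration
  \<open>\<sigma>\<close> and a fibration \<open>d\<close>; lifting against \<open>d\<close> gives
  \<open>path_lift\<close>.\<close>

lemma path_object_exists:
  assumes r: "r \<in> arr C B z" "r \<in> fib M"
  obtains P \<sigma> d0 d1 where "path_object C z M B P \<sigma> d0 d1"
proof -
  have ob: "B \<in> Ob C" using arr_Ob[OF r(1)] by auto
  note idB = Idn_arr[OF ob]
  obtain D p1 p2 where p1: "p1 \<in> arr C D B" and p2: "p2 \<in> arr C D B"
    and pair: "\<And>Y f g. \<lbrakk>f \<in> arr C Y B; g \<in> arr C Y B\<rbrakk> \<Longrightarrow>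
      \<exists>h. h \<in> arr C Y D \<and> Cmp C p1 h = f \<and> Cmp C p2 h = g"
    and uniq: "\<And>Y h h'. \<lbrakk>h \<in> arr C Y D; h' \<in> arr C Y D; Cmp C p1 h = Cmp C p1 h';
      Cmp C p2 h = Cmp C p2 h'\<rbrakk> \<Longrightarrow> h = h'"
    by (rule productE[OF ob ob]) blast
  obtain \<delta> where \<delta>: "\<delta> \<in> arr C B D" "Cmp C p1 \<delta> = Idn C B" "Cmp C p2 \<delta> = Idn C B"
    using pair[OF idB idB] by blast
  obtain P \<sigma> d where \<sigma>: "\<sigma> \<in> arr C B P" and d: "d \<in> arr C P D" and f: "Cmp C d \<sigma> = \<delta>"
    "\<sigma> \<in> weq M" "d \<in> fib M"
    using factor_tcf[OF \<delta>(1)] by blast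
  have "path_object C z M B P \<sigma> (Cmp C p1 d) (Cmp C p2 d)"
  proof
    show "t \<in> fib M" if "t \<in> arr C B z" for t using to_zero_eq[OF that r(1)] r(2) by simp
    show "\<sigma> \<in> arr C B P" "Cmp C p1 d \<in> arr C P B" "Cmp C p2 d \<in> arr C P B" "\<sigma> \<in> weq M"
      using \<sigma> f Cmp_arr[OF d p1] Cmp_arr[OF d p2] by auto
    show "Cmp C (Cmp C p1 d) \<sigma> = Idn C B" "Cmp C (Cmp C p2 d) \<sigma> = Idn C B"
      by (simp_all add: Cmp_assoc[OF \<sigma> d p1] Cmp_assoc[OF \<sigma> d p2] f \<delta>)
    fix j X Y h u v
    assume j: "j \<in> arr C X Y" "j \<in> cof M" "j \<in> weq M" and h: "h \<in> arr C X P"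
      and u: "u \<in> arr C Y B" and v: "v \<in> arr C Y B"
      and e: "Cmp C (Cmp C p1 d) h = Cmp C u j" "Cmp C (Cmp C p2 d) h = Cmp C v j"
    obtain w where w: "w \<in> arr C Y D" "Cmp C p1 w = u" "Cmp C p2 w = v"
      using pair[OF u v] by blast
    have "Cmp C w j = Cmp C d h"
      by (rule uniq[OF Cmp_arr[OF j(1) w(1)] Cmp_arr[OF h d]])
        (simp_all add: Cmp_assoc[OF j(1) w(1) p1, symmetric] Cmp_assoc[OF j(1) w(1) p2, symmetric]
          Cmp_assoc[OF h d p1, symmetric] Cmp_assoc[OF h d p2, symmetric] e w)
    then obtain H where "H \<in> arr C Y P" "Cmp C d H = w"
      using liftE[OF lifts_tcof_fib[OF j(2,3) f(3)] j(1) d h w(1)] by blast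
    then show "\<exists>H \<in> arr C Y P. Cmp C (Cmp C p1 d) H = u \<and> Cmp C (Cmp C p2 d) H = v"
      using w Cmp_assoc[OF _ d p1] Cmp_assoc[OF _ d p2] by metis
  qed
  then show ?thesis by (rule that)
qed

end

section \<open>Right homotopies and their behaviour under weak equivalences\<close>

context path_object
begin

text \<open>Right homotopy through the one path object fixed by the locale. Transitivity is supplied
  by closing under \<open>equivclp\<close>.\<close>

definition homotopy :: "'m \<Rightarrow> 'm \<Rightarrow> bool" where
  "homotopy f g \<longleftrightarrow> (\<exists>X. \<exists>h \<in> arr C X P. f = Cmp C d0 h \<and> g = Cmp C d1 h)"

abbreviation homotopic :: "'m \<Rightarrow> 'm \<Rightarrow> bool" (infix "\<asymp>" 50) where
  "f \<asymp> g \<equiv> equivclp homotopy f g"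

lemma homotopic_refl: "f \<asymp> f"
  and homotopic_sym: "f \<asymp> g \<Longrightarrow> g \<asymp> f"
  and homotopic_trans: "f \<asymp> g \<Longrightarrow> g \<asymp> h \<Longrightarrow> f \<asymp> h"
  by (simp, rule equivclp_sym, assumption, rule equivclp_trans)

lemma base_Ob: "B \<in> Ob C" using arr_Ob[OF path_arr(1)] by auto

lemma homotopy_arr: "homotopy f g \<Longrightarrow> f \<in> arr C X B \<longleftrightarrow> g \<in> arr C X B"
  unfolding homotopy_def using Cmp_arr path_arr by (metis arrD(2))

lemma homotopy_Cmp:
  assumes "homotopy f g" "f \<in> arr C X B" "u \<in> arr C Y X"
  shows "homotopy (Cmp C f u) (Cmp C g u)"
proof -
  obtain X' h where h: "h \<in> arr C X' P" and fg: "f = Cmp C d0 h" "g = Cmp C d1 h"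
    using assms(1) unfolding homotopy_def by blast
  have "X' = X" using Cmp_arr[OF h path_arr(2)] assms(2) fg(1) arrD(2) by metis
  then have h: "h \<in> arr C X P" using h by simp
  show ?thesis
    unfolding homotopy_def fg using Cmp_arr[OF assms(3) h] Cmp_assoc[OF assms(3) h] path_arr by blast
qed

lemma homotopic_arr: "f \<asymp> g \<Longrightarrow> f \<in> arr C X B \<Longrightarrow> g \<in> arr C X B"
  by (induction rule: equivclp_induct) (use homotopy_arr in blast)+

lemma homotopic_Cmp:
  assumes "f \<asymp> g" "f \<in> arr C X B" "u \<in> arr C Y X"
  shows "Cmp C f u \<asymp> Cmp C g u"
  using assms(1)
proof (induction rule: equivclp_induct)
  case (step g g')
  have "g \<in> arr C X B" "g' \<in> arr C X B"
    using homotopic_arr[OF step(1) assms(2)] step(2) homotopy_arr by blast+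
  then show ?case
    using step(2,3) homotopy_Cmp[OF _ _ assms(3)] by (meson equivclp_into_equivclp)
qed simp

text \<open>Both \<open>d0\<close> and \<open>d1\<close> are weak equivalences, being left inverses
  of \<open>\<sigma>\<close>; so either end of a homotopy \<open>h\<close> is a weak equivalence
  exactly when \<open>h\<close> is.\<close>

lemma homotopic_weq:
  assumes "f \<asymp> g" "f \<in> weq M"
  shows "g \<in> weq M"
  using assms(1)
proof (induction rule: equivclp_induct)
  case (step g g')
  have d: "d0 \<in> weq M" "d1 \<in> weq M"
    using weq_left[OF path_arr(1) path_arr(2) path_weq] weq_left[OF path_arr(1) path_arr(3) path_weq]
      d_sect weq_Idn[OF base_Ob] by simp_all
  have "Cmp C d0 h \<in> weq M \<longleftrightarrow> Cmp C d1 h \<in> weq M" if "h \<in> arr C X P" for h X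
    using d that path_arr weq_right weq_Cmp by blast
  then show ?case
    using step unfolding homotopy_def by auto
qed (use assms in simp)

lemma tcof_extend:
  assumes j: "j \<in> arr C X Y" "j \<in> cof M" "j \<in> weq M" and f: "f \<in> arr C X B"
  obtains g where "g \<in> arr C Y B" "Cmp C g j = f"
proof -
  obtain r where r: "r \<in> arr C B z" using to_zero base_Ob by blast
  obtain t where t: "t \<in> arr C Y z" using to_zero arr_Ob[OF j(1)] by blast
  show ?thesis
    by (rule liftE[OF lifts_tcof_fib[OF j(2,3) fibrant[OF r]] j(1) r f t])
      (use to_zero_eq[OF Cmp_arr[OF j(1) t] Cmp_arr[OF f r]] that in auto)
qed

lemma tcof_reflects_homotopy:
  assumes j: "j \<in> arr C X Y" "j \<in> cof M" "j \<in> weq M" and f: "f \<in> arr C Y B" and g: "g \<in> arr C Y B"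
    and "homotopy (Cmp C f j) (Cmp C g j)"
  shows "homotopy f g"
proof -
  obtain X' h where h: "h \<in> arr C X' P" and fg: "Cmp C f j = Cmp C d0 h" "Cmp C g j = Cmp C d1 h"
    using assms(6) unfolding homotopy_def by blast
  have "X' = X" using Cmp_arr[OF h path_arr(2)] Cmp_arr[OF j(1) f] fg(1) arrD(2) by metis
  then show ?thesis
    using path_lift[OF j _ f g fg[symmetric]] h unfolding homotopy_def by metis
qed

lemma homotopy_refl: "f \<in> arr C X B \<Longrightarrow> homotopy f f"
proof -
  assume f: "f \<in> arr C X B"
  have "f = Cmp C d0 (Cmp C \<sigma> f)" "f = Cmp C d1 (Cmp C \<sigma> f)"
    using Cmp_assoc[OF f path_arr(1)] path_arr(2,3) d_sect Idn_Cmp[OF f] by metis+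
  then show "homotopy f f"
    unfolding homotopy_def using Cmp_arr[OF f path_arr(1)] by blast
qed

text \<open>The intermediate maps of a chain of homotopies on \<open>X\<close> are not given as
  restrictions from \<open>Y\<close>. Each is extended along \<open>j\<close> because
  \<open>B\<close> is fibrant, and then the single homotopies lift. The constant homotopy handles
  two extensions of the same map, which is why the induction ranges over all extensions
  \<open>g'\<close> of the current end.\<close>

lemma tcof_reflects_homotopic:
  assumes j: "j \<in> arr C X Y" "j \<in> cof M" "j \<in> weq M" and f: "f \<in> arr C Y B" and g: "g \<in> arr C Y B"
    and "Cmp C f j \<asymp> Cmp C g j"
  shows "f \<asymp> g"
proof -
  have "f \<asymp> g'" if "Cmp C f j \<asymp> b" "g' \<in> arr C Y B" "Cmp C g' j = b" for b g'
    using that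
  proof (induction arbitrary: g' rule: equivclp_induct)
    case base
    then show ?case
      using tcof_reflects_homotopy[OF j f base(1)] homotopy_refl[OF Cmp_arr[OF j(1) f]]
      by (simp add: r_into_equivclp)
  next
    case (step b c)
    have "c \<in> arr C X B" using step(5) Cmp_arr[OF j(1) step(4)] by simp
    then have "b \<in> arr C X B" using step(2) homotopy_arr by blast
    then obtain g0 where g0: "g0 \<in> arr C Y B" "Cmp C g0 j = b" by (rule tcof_extend[OF j])
    have "homotopy g0 g' \<or> homotopy g' g0"
      using tcof_reflects_homotopy[OF j g0(1) step(4)] tcof_reflects_homotopy[OF j step(4) g0(1)]
        step(2,5) g0(2) by auto
    then show ?case using step(3)[OF g0] by (meson equivclp_into_equivclp)
  qed
  then show ?thesis using assms by blast
qed

text \<open>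
  A weak equivalence factors as a trivial cofibration \<open>j\<close> followed by a trivial fibration, which is a
  retraction of a trivial cofibration \<open>s\<close>; so it is enough that \<open>j\<close> and \<open>s\<close> act bijectively on classes.
\<close>

lemma weq_factor:
  assumes w: "w \<in> arr C X Y" "w \<in> weq M"
  obtains Q j q s where "j \<in> arr C X Q" "j \<in> cof M" "j \<in> weq M" "q \<in> arr C Q Y" "Cmp C q j = w"
    "s \<in> arr C Y Q" "s \<in> cof M" "s \<in> weq M" "Cmp C q s = Idn C Y"
proof -
  obtain Q j q where j: "j \<in> arr C X Q" "j \<in> cof M" "j \<in> weq M" and q: "q \<in> arr C Q Y" "Cmp C q j = w"
    "q \<in> fib M"
    using factor_tcf[OF w(1)] by blast
  have "q \<in> weq M" using weq_left[OF j(1) q(1) j(3)] q(2) w(2) by simp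
  then show ?thesis using tfib_section[OF q(1,3)] that j q by metis
qed

lemma weq_reflects_homotopic:
  assumes w: "w \<in> arr C X Y" "w \<in> weq M" and f: "f \<in> arr C Y B" and g: "g \<in> arr C Y B"
    and "Cmp C f w \<asymp> Cmp C g w"
  shows "f \<asymp> g"
proof -
  obtain Q j q s where j: "j \<in> arr C X Q" "j \<in> cof M" "j \<in> weq M" and q: "q \<in> arr C Q Y" "Cmp C q j = w"
    and s: "s \<in> arr C Y Q" "Cmp C q s = Idn C Y"
    using weq_factor[OF w] by metis
  have "Cmp C f q \<asymp> Cmp C g q"
    using tcof_reflects_homotopic[OF j Cmp_arr[OF q(1) f] Cmp_arr[OF q(1) g]] assms(5)
    by (simp add: Cmp_assoc[OF j(1) q(1)] f g q(2) Cmp_assoc[OF j(1) q(1) f] Cmp_assoc[OF j(1) q(1) g])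
  then have "Cmp C (Cmp C f q) s \<asymp> Cmp C (Cmp C g q) s"
    by (rule homotopic_Cmp[OF _ Cmp_arr[OF q(1) f] s(1)])
  then show ?thesis
    by (simp add: Cmp_assoc[OF s(1) q(1) f] Cmp_assoc[OF s(1) q(1) g] s(2) Cmp_Idn[OF f] Cmp_Idn[OF g])
qed

lemma weq_extend:
  assumes w: "w \<in> arr C X Y" "w \<in> weq M" and f: "f \<in> arr C X B"
  obtains g where "g \<in> arr C Y B" "Cmp C g w \<asymp> f"
proof -
  obtain Q j q s where j: "j \<in> arr C X Q" "j \<in> cof M" "j \<in> weq M" and q: "q \<in> arr C Q Y" "Cmp C q j = w"
    and s: "s \<in> arr C Y Q" "s \<in> cof M" "s \<in> weq M" "Cmp C q s = Idn C Y"
    using weq_factor[OF w] by metis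
  obtain f' where f': "f' \<in> arr C Q B" "Cmp C f' j = f" by (rule tcof_extend[OF j f])
  have g: "Cmp C f' s \<in> arr C Y B" using Cmp_arr[OF s(1) f'(1)] .
  have gq: "Cmp C (Cmp C f' s) q \<in> arr C Q B" using Cmp_arr[OF q(1) g] .
  \<comment> \<open>Both sides restrict to \<open>Cmp C f' s\<close> along the trivial cofibration
    \<open>s\<close>, because \<open>q\<close> retracts \<open>s\<close>.\<close>
  have "Cmp C (Cmp C f' s) q \<asymp> f'"
    by (rule tcof_reflects_homotopic[OF s(1-3) gq f'(1)])
      (simp add: Cmp_assoc[OF s(1) q(1) g] s(4) Cmp_Idn[OF g])
  then have "Cmp C (Cmp C (Cmp C f' s) q) j \<asymp> Cmp C f' j"
    by (rule homotopic_Cmp[OF _ gq j(1)])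
  then show ?thesis
    using that[OF g] by (simp add: Cmp_assoc[OF j(1) q(1) g] q(2) f'(2))
qed

text \<open>
  \<open>pulls l a b\<close>: pulling back the class of \<open>b\<close> along the zigzag \<open>l\<close> gives the class of \<open>a\<close>.
\<close>

fun pulls :: "'m zz list \<Rightarrow> 'm \<Rightarrow> 'm \<Rightarrow> bool" where
  "pulls [] a b \<longleftrightarrow> a \<asymp> b"
| "pulls (Fwd f # l) a b \<longleftrightarrow> (\<exists>c \<in> arr C (Cod C f) B. pulls l c b \<and> a \<asymp> Cmp C c f)"
| "pulls (Bwd w # l) a b \<longleftrightarrow> (\<exists>c \<in> arr C (Dom C w) B. pulls l c b \<and> Cmp C a w \<asymp> c)"

lemma pulls_homotopic:
  assumes path: "zz_path C W X l Y" and p: "pulls l a b" and e: "a \<asymp> a'" and a: "a \<in> arr C X B"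
  shows "pulls l a' b"
proof (cases l)
  case Nil
  then show ?thesis using p homotopic_trans[OF homotopic_sym[OF e]] by simp
next
  case (Cons x l')
  show ?thesis
  proof (cases x)
    case (Fwd f)
    then obtain c where c: "c \<in> arr C (Cod C f) B" "pulls l' c b" "a \<asymp> Cmp C c f"
      using p Cons by auto
    have "a' \<asymp> Cmp C c f" by (rule homotopic_trans[OF homotopic_sym[OF e] c(3)])
    then show ?thesis using Cons Fwd c by auto
  next
    case (Bwd w)
    then obtain c where c: "c \<in> arr C (Dom C w) B" "pulls l' c b" "Cmp C a w \<asymp> c"
      using p Cons by auto
    have "w \<in> arr C (Dom C w) X" using path Cons Bwd by (auto simp: arr_def)
    then have "Cmp C a' w \<asymp> c"
      by (rule homotopic_trans[OF homotopic_sym[OF homotopic_Cmp[OF e a]] c(3)])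
    then show ?thesis using Cons Bwd c by auto
  qed
qed

text \<open>The first two relations amount to functoriality of precomposition. The other two say
  that a weak equivalence acts on classes surjectively (\<open>weq_extend\<close>, for
  \<open>w\<close> followed by its inverse) and injectively (\<open>weq_reflects_homotopic\<close>,
  for the opposite order).\<close>

lemma pulls_basic:
  assumes "zz_basic C W r s" and W: "W \<subseteq> weq M"
    and path: "zz_path C W X (r @ q) Y" "zz_path C W X (s @ q) Y" and a: "a \<in> arr C X B"
  shows "pulls (r @ q) a b \<longleftrightarrow> pulls (s @ q) a b"
  using assms(1)
proof cases
  case (1 A)
  have X: "A = X" using path(1) 1 arrD(2)[OF Idn_arr[OF 1(3)]] by simp
  note id = Idn_arr[OF 1(3)[unfolded X]]
  have q: "zz_path C W X q Y" using path(2) 1 by simp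
  have "pulls (r @ q) a b \<longleftrightarrow> (\<exists>c \<in> arr C X B. pulls q c b \<and> a \<asymp> Cmp C c (Idn C X))"
    using 1 X arrD(3)[OF id] by simp
  also have "\<dots> \<longleftrightarrow> pulls q a b"
  proof
    assume "\<exists>c \<in> arr C X B. pulls q c b \<and> a \<asymp> Cmp C c (Idn C X)"
    then obtain c where c: "c \<in> arr C X B" "pulls q c b" "a \<asymp> c" using Cmp_Idn by auto
    then show "pulls q a b" using pulls_homotopic[OF q c(2) homotopic_sym[OF c(3)] c(1)] by simp
  qed (use a Cmp_Idn[OF a] homotopic_refl in auto)
  finally show ?thesis using 1 by simp
next
  case (2 f g)
  have f: "f \<in> arr C X (Cod C f)" and g: "g \<in> arr C (Cod C f) (Cod C g)"
    using path(1) 2 by (auto simp: arr_def)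
  have "pulls (r @ q) a b \<longleftrightarrow> (\<exists>d \<in> arr C (Cod C g) B. pulls q d b \<and>
      (\<exists>c \<in> arr C (Cod C f) B. c \<asymp> Cmp C d g \<and> a \<asymp> Cmp C c f))"
    using 2 by auto
  also have "\<dots> \<longleftrightarrow> (\<exists>d \<in> arr C (Cod C g) B. pulls q d b \<and> a \<asymp> Cmp C d (Cmp C g f))"
  proof (intro bex_cong refl conj_cong)
    fix d assume d: "d \<in> arr C (Cod C g) B"
    show "(\<exists>c \<in> arr C (Cod C f) B. c \<asymp> Cmp C d g \<and> a \<asymp> Cmp C c f) \<longleftrightarrow> a \<asymp> Cmp C d (Cmp C g f)"
      unfolding Cmp_assoc[OF f g d, symmetric]
    proof
      assume "\<exists>c \<in> arr C (Cod C f) B. c \<asymp> Cmp C d g \<and> a \<asymp> Cmp C c f"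
      then obtain c where c: "c \<in> arr C (Cod C f) B" "c \<asymp> Cmp C d g" "a \<asymp> Cmp C c f" by blast
      show "a \<asymp> Cmp C (Cmp C d g) f"
        by (rule homotopic_trans[OF c(3) homotopic_Cmp[OF c(2,1) f]])
    qed (use Cmp_arr[OF g d] homotopic_refl in blast)
  qed
  finally show ?thesis using 2 arrD(3)[OF Cmp_arr[OF f g]] by simp
next
  case (3 w)
  have w: "w \<in> arr C X (Cod C w)" using path(1) 3 by (auto simp: arr_def)
  have ww: "w \<in> weq M" using 3 W by auto
  have dw: "Dom C w = X" using arrD(2)[OF w] .
  have q: "zz_path C W X q Y" using path(2) 3 by simp
  have "pulls (r @ q) a b \<longleftrightarrow> (\<exists>c \<in> arr C (Cod C w) B. (\<exists>d \<in> arr C X B. pulls q d b \<and> Cmp C c w \<asymp> d) \<and>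
      a \<asymp> Cmp C c w)"
    using 3 dw by auto
  also have "\<dots> \<longleftrightarrow> pulls q a b"
  proof
    assume "\<exists>c \<in> arr C (Cod C w) B. (\<exists>d \<in> arr C X B. pulls q d b \<and> Cmp C c w \<asymp> d) \<and> a \<asymp> Cmp C c w"
    then obtain c d where d: "d \<in> arr C X B" "pulls q d b" "Cmp C c w \<asymp> d" "a \<asymp> Cmp C c w" by blast
    show "pulls q a b"
      by (rule pulls_homotopic[OF q d(2) homotopic_sym[OF homotopic_trans[OF d(4,3)]] d(1)])
  next
    assume p: "pulls q a b"
    obtain c where "c \<in> arr C (Cod C w) B" "Cmp C c w \<asymp> a" by (rule weq_extend[OF w ww a])
    then show "\<exists>c \<in> arr C (Cod C w) B. (\<exists>d \<in> arr C X B. pulls q d b \<and> Cmp C c w \<asymp> d) \<and> a \<asymp> Cmp C c w"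
      using p a homotopic_sym by blast
  qed
  finally show ?thesis using 3 by simp
next
  case (4 w)
  have w: "w \<in> arr C (Dom C w) X" using path(1) 4 by (auto simp: arr_def)
  have ww: "w \<in> weq M" using 4 W by auto
  have cw: "Cod C w = X" using arrD(3)[OF w] .
  have q: "zz_path C W X q Y" using path(2) 4 by simp
  have "pulls (r @ q) a b \<longleftrightarrow> (\<exists>c \<in> arr C (Dom C w) B. (\<exists>d \<in> arr C X B. pulls q d b \<and> c \<asymp> Cmp C d w) \<and>
      Cmp C a w \<asymp> c)"
    using 4 cw by auto
  also have "\<dots> \<longleftrightarrow> pulls q a b"
  proof
    assume "\<exists>c \<in> arr C (Dom C w) B. (\<exists>d \<in> arr C X B. pulls q d b \<and> c \<asymp> Cmp C d w) \<and> Cmp C a w \<asymp> c"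
    then obtain c d where d: "d \<in> arr C X B" "pulls q d b" "c \<asymp> Cmp C d w" "Cmp C a w \<asymp> c" by blast
    have "d \<asymp> a"
      by (rule weq_reflects_homotopic[OF w ww d(1) a homotopic_sym[OF homotopic_trans[OF d(4,3)]]])
    then show "pulls q a b" by (rule pulls_homotopic[OF q d(2) _ d(1)])
  next
    assume "pulls q a b"
    then show "\<exists>c \<in> arr C (Dom C w) B. (\<exists>d \<in> arr C X B. pulls q d b \<and> c \<asymp> Cmp C d w) \<and> Cmp C a w \<asymp> c"
      using a Cmp_arr[OF w a] homotopic_refl by blast
  qed
  finally show ?thesis using 4 by simp
qed

text \<open>The map \<open>a\<close> has to vary in the induction: reading a letter of the prefix
  replaces it by another map.\<close>

lemma pulls_step:
  assumes "zz_basic C W r s" and W: "W \<subseteq> weq M"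
  shows "\<lbrakk>zz_path C W X (p @ r @ q) Y; zz_path C W X (p @ s @ q) Y; a \<in> arr C X B\<rbrakk> \<Longrightarrow>
    pulls (p @ r @ q) a b \<longleftrightarrow> pulls (p @ s @ q) a b"
proof (induction p arbitrary: X a)
  case Nil
  then show ?case using pulls_basic[OF assms] by simp
next
  case (Cons x p)
  show ?case
  proof (cases x)
    case (Fwd f)
    then show ?thesis using Cons.IH[of "Cod C f"] Cons.prems by auto
  next
    case (Bwd w)
    then show ?thesis using Cons.IH[of "Dom C w"] Cons.prems by auto
  qed
qed

lemma pulls_equiv:
  assumes "equivclp (zz_step C W X Y) k l" and W: "W \<subseteq> weq M" and a: "a \<in> arr C X B"
  shows "pulls k a b \<longleftrightarrow> pulls l a b"
  using assms(1)
proof (induction rule: equivclp_induct)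
  case (step l l')
  have "pulls l a b \<longleftrightarrow> pulls l' a b" if "zz_step C W X Y l l'" for l l'
    using that pulls_step[OF _ W _ _ a] unfolding zz_step_def by blast
  then show ?case using step by blast
qed simp

text \<open>A zigzag ending with \<open>f\<close> sees \<open>b\<close> only through
  \<open>Cmp C b f\<close>.\<close>

lemma pulls_append_Fwd:
  assumes "Cmp C b f = Cmp C b' f" "b \<in> arr C (Cod C f) B" "b' \<in> arr C (Cod C f) B" "f \<in> Ar C"
    "pulls (l @ [Fwd f]) a b"
  shows "pulls (l @ [Fwd f]) a b'"
  using assms(5)
proof (induction l arbitrary: a)
  case Nil
  then obtain c where c: "c \<in> arr C (Cod C f) B" "c \<asymp> b" "a \<asymp> Cmp C c f" by auto
  then have "Cmp C c f \<asymp> Cmp C b f" using homotopic_Cmp arrI[OF assms(4)] by blast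
  then have "a \<asymp> Cmp C b' f" using homotopic_trans[OF c(3)] assms(1) by simp
  then show ?case using assms(3) homotopic_refl[of b'] by (auto intro!: bexI[of _ b'])
next
  case (Cons x l)
  then show ?case by (cases x) auto
qed

text \<open>If \<open>l\<close> inverts \<open>f\<close>, then pulling \<open>b\<close> back along
  \<open>f\<close> and then along \<open>l\<close> recovers its class, and this depends on
  \<open>Cmp C b f\<close> alone.\<close>

lemma iso_loc_cancel:
  assumes f: "f \<in> arr C X Y" and "iso_in (loc_cat C W) (far (loc C W) f)" and W: "W \<subseteq> weq M"
    and b: "b \<in> arr C Y B" "b' \<in> arr C Y B" "Cmp C b f = Cmp C b' f"
  shows "b \<asymp> b'"
proof -
  obtain l where l: "equivclp (zz_step C W Y Y) (l @ [Fwd f]) []"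
    using assms(2) iso_loc_iff[OF f] by blast
  have "pulls (l @ [Fwd f]) b b" using pulls_equiv[OF l W b(1)] by simp
  then have "pulls (l @ [Fwd f]) b b'"
    using pulls_append_Fwd[OF b(3)] b arrD[OF f] by simp
  then show ?thesis using pulls_equiv[OF l W b(1)] by simp
qed

lemma iso_loc_factors:
  assumes f: "f \<in> arr C X Y" and "iso_in (loc_cat C W) (far (loc C W) f)" and W: "W \<subseteq> weq M"
    and a: "a \<in> arr C X B"
  obtains c where "c \<in> arr C Y B" "a \<asymp> Cmp C c f"
proof -
  obtain l where l: "equivclp (zz_step C W X X) (Fwd f # l) []"
    using assms(2) iso_loc_iff[OF f] by blast
  have "pulls (Fwd f # l) a a" using pulls_equiv[OF l W a] by simp
  then show ?thesis using that arrD[OF f] by auto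
qed

end

section \<open>Detecting contractibility of fibrant objects in the localization\<close>

context pointed_model_category
begin

lemma weq_to_zero_if_Cmp_weq:
  assumes "c \<in> arr C z B" "r \<in> arr C B z" "Cmp C c r \<in> weq M"
  shows "r \<in> weq M"
  using weq_if_Cmp_retraction(2)[OF assms(1,2) _ assms(3)]
    to_zero_eq[OF Cmp_arr[OF assms(1,2)] Idn_arr[OF zero_Ob]] by blast

text \<open>Applied to the identity of \<open>B\<close>, \<open>iso_loc_factors\<close> makes it
  homotopic to an endomorphism through \<open>z\<close>. That endomorphism is then a weak
  equivalence, and \<open>r\<close> is one of the two halves of its splitting.\<close>

lemma weq_to_zero_if_iso_loc:
  assumes r: "r \<in> arr C B z" "r \<in> fib M" and "W \<subseteq> weq M"
    and "iso_in (loc_cat C W) (far (loc C W) r)"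
  shows "r \<in> weq M"
proof -
  obtain P \<sigma> d0 d1 where "path_object C z M B P \<sigma> d0 d1" by (rule path_object_exists[OF r])
  then interpret path_object C z M B P \<sigma> d0 d1 .
  obtain c where "c \<in> arr C z B" "homotopic (Idn C B) (Cmp C c r)"
    by (rule iso_loc_factors[OF r(1) assms(4,3) Idn_arr[OF base_Ob]])
  then show ?thesis
    using weq_to_zero_if_Cmp_weq r(1) homotopic_weq weq_Idn[OF base_Ob] by blast
qed

text \<open>The endomorphism \<open>Cmp C i r\<close> of \<open>B\<close> turns every arrow into the
  null one. Hence \<open>\<nu>\<close> and its composite with \<open>Cmp C i r\<close> agree after
  \<open>k\<close>, and cancelling \<open>k\<close> makes them homotopic. Precomposing with
  \<open>t\<close> then makes \<open>Cmp C i r\<close> itself a weak equivalence by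
  two-out-of-three.\<close>

lemma weq_to_zero_if_null:
  assumes r: "r \<in> arr C B z" "r \<in> fib M" and W: "W \<subseteq> weq M"
    and k: "k \<in> arr C F E" "iso_in (loc_cat C W) (far (loc C W) k)"
    and \<nu>: "\<nu> \<in> arr C E B" and c: "c \<in> arr C F z" and i: "i \<in> arr C z B"
    and "Cmp C \<nu> k = Cmp C i c"
    and t: "t \<in> arr C A E" "Cmp C \<nu> t \<in> weq M"
  shows "r \<in> weq M"
proof -
  obtain P \<sigma> d0 d1 where "path_object C z M B P \<sigma> d0 d1" by (rule path_object_exists[OF r(1,2)])
  then interpret path_object C z M B P \<sigma> d0 d1 .
  have ir: "Cmp C i r \<in> arr C B B" using Cmp_arr[OF r(1) i] .
  note \<nu>t = Cmp_arr[OF t(1) \<nu>]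
  have irg: "Cmp C (Cmp C i r) g = Cmp C i e"
    if "g \<in> arr C Y B" "e \<in> arr C Y z" for g Y e
    using Cmp_assoc[OF that(1) r(1) i] to_zero_eq[OF Cmp_arr[OF that(1) r(1)] that(2)] by simp
  have "Cmp C \<nu> k = Cmp C (Cmp C (Cmp C i r) \<nu>) k"
    using assms(9) irg[OF Cmp_arr[OF k(1) \<nu>] c] Cmp_assoc[OF k(1) \<nu> ir] by simp
  then have "homotopic \<nu> (Cmp C (Cmp C i r) \<nu>)"
    by (rule iso_loc_cancel[OF k W \<nu> Cmp_arr[OF \<nu> ir]])
  then have "homotopic (Cmp C \<nu> t) (Cmp C (Cmp C i r) (Cmp C \<nu> t))"
    unfolding Cmp_assoc[OF t(1) \<nu> ir, symmetric] by (rule homotopic_Cmp[OF _ \<nu> t(1)])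
  then have "Cmp C (Cmp C i r) (Cmp C \<nu> t) \<in> weq M" using t(2) by (rule homotopic_weq)
  then have "Cmp C i r \<in> weq M" by (rule weq_left[OF \<nu>t ir t(2)])
  then show ?thesis by (rule weq_to_zero_if_Cmp_weq[OF i r(1)])
qed

end

section \<open>Pointed simplicial presheaves\<close>

definition pointed_hom :: "('o, 'm) cat \<Rightarrow> ('o, 'm, 'v) pob \<Rightarrow> ('o, 'm, 'v) pob \<Rightarrow> ('o \<Rightarrow> nat \<Rightarrow> 'v \<Rightarrow> 'v) set" where
  "pointed_hom C A B = {\<phi> \<in> spsh_hom C (fst A) (fst B). \<forall>Y \<in> Ob C. \<forall>k. \<phi> Y k (snd A Y k) = snd B Y k}"

lemma arr_pcat_iff:
  "f \<in> arr (pcat C) A B \<longleftrightarrow> is_pob C A \<and> is_pob C B \<and> (\<exists>\<phi> \<in> pointed_hom C A B. f = (A, \<phi>, B))"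
  by (cases A; cases B) (auto simp: arr_def pcat_def pointed_hom_def)

lemma arr_pcatI:
  "\<lbrakk>is_pob C A; is_pob C B; \<phi> \<in> pointed_hom C A B\<rbrakk> \<Longrightarrow> (A, \<phi>, B) \<in> arr (pcat C) A B"
  by (simp add: arr_pcat_iff)

abbreviation elems :: "('o, 'm, 'v) pob \<Rightarrow> 'o \<Rightarrow> nat \<Rightarrow> 'v set" where
  "elems A Y k \<equiv> smp (sval (fst A) Y) k"

lemma is_pobD:
  assumes "is_pob C A"
  shows "Y \<in> Ob C \<Longrightarrow> \<theta> \<in> Delta m n \<Longrightarrow> x \<in> elems A Y n \<Longrightarrow> sop (sval (fst A) Y) m n \<theta> x \<in> elems A Y m"
    and "Y \<in> Ob C \<Longrightarrow> x \<in> elems A Y n \<Longrightarrow> sop (sval (fst A) Y) n n (\<lambda>i\<in>{..n}. i) x = x"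
    and "Y \<in> Ob C \<Longrightarrow> \<theta> \<in> Delta l m \<Longrightarrow> \<psi> \<in> Delta m n \<Longrightarrow> x \<in> elems A Y n \<Longrightarrow>
      sop (sval (fst A) Y) l n (compose {..l} \<psi> \<theta>) x
        = sop (sval (fst A) Y) l m \<theta> (sop (sval (fst A) Y) m n \<psi> x)"
    and "f \<in> Ar C \<Longrightarrow> x \<in> elems A (Cod C f) k \<Longrightarrow> srst (fst A) f k x \<in> elems A (Dom C f) k"
    and "f \<in> Ar C \<Longrightarrow> \<theta> \<in> Delta m n \<Longrightarrow> x \<in> elems A (Cod C f) n \<Longrightarrow>
      srst (fst A) f m (sop (sval (fst A) (Cod C f)) m n \<theta> x)
        = sop (sval (fst A) (Dom C f)) m n \<theta> (srst (fst A) f n x)"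
    and "Y \<in> Ob C \<Longrightarrow> x \<in> elems A Y k \<Longrightarrow> srst (fst A) (Idn C Y) k x = x"
    and "f \<in> Ar C \<Longrightarrow> g \<in> Ar C \<Longrightarrow> Cod C f = Dom C g \<Longrightarrow> x \<in> elems A (Cod C g) k \<Longrightarrow>
      srst (fst A) (Cmp C g f) k x = srst (fst A) f k (srst (fst A) g k x)"
    and "Y \<in> Ob C \<Longrightarrow> snd A Y k \<in> elems A Y k"
    and "Y \<in> Ob C \<Longrightarrow> \<theta> \<in> Delta m n \<Longrightarrow> sop (sval (fst A) Y) m n \<theta> (snd A Y n) = snd A Y m"
    and "f \<in> Ar C \<Longrightarrow> srst (fst A) f k (snd A (Cod C f) k) = snd A (Dom C f) k"
  using assms by (simp_all add: is_pob_def is_spsh_def is_sset_def sset_map_def Pi_iff)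

lemma is_pobI:
  assumes "\<And>Y \<theta> m n x. Y \<in> Ob C \<Longrightarrow> \<theta> \<in> Delta m n \<Longrightarrow> x \<in> elems A Y n \<Longrightarrow>
      sop (sval (fst A) Y) m n \<theta> x \<in> elems A Y m"
    and "\<And>Y n x. Y \<in> Ob C \<Longrightarrow> x \<in> elems A Y n \<Longrightarrow> sop (sval (fst A) Y) n n (\<lambda>i\<in>{..n}. i) x = x"
    and "\<And>Y l m n \<theta> \<psi> x. Y \<in> Ob C \<Longrightarrow> \<theta> \<in> Delta l m \<Longrightarrow> \<psi> \<in> Delta m n \<Longrightarrow> x \<in> elems A Y n \<Longrightarrow>
      sop (sval (fst A) Y) l n (compose {..l} \<psi> \<theta>) x
        = sop (sval (fst A) Y) l m \<theta> (sop (sval (fst A) Y) m n \<psi> x)"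
    and "\<And>f x k. f \<in> Ar C \<Longrightarrow> x \<in> elems A (Cod C f) k \<Longrightarrow> srst (fst A) f k x \<in> elems A (Dom C f) k"
    and "\<And>f \<theta> m n x. f \<in> Ar C \<Longrightarrow> \<theta> \<in> Delta m n \<Longrightarrow> x \<in> elems A (Cod C f) n \<Longrightarrow>
      srst (fst A) f m (sop (sval (fst A) (Cod C f)) m n \<theta> x)
        = sop (sval (fst A) (Dom C f)) m n \<theta> (srst (fst A) f n x)"
    and "\<And>Y x k. Y \<in> Ob C \<Longrightarrow> x \<in> elems A Y k \<Longrightarrow> srst (fst A) (Idn C Y) k x = x"
    and "\<And>f g x k. f \<in> Ar C \<Longrightarrow> g \<in> Ar C \<Longrightarrow> Cod C f = Dom C g \<Longrightarrow> x \<in> elems A (Cod C g) k \<Longrightarrow>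
      srst (fst A) (Cmp C g f) k x = srst (fst A) f k (srst (fst A) g k x)"
    and "\<And>Y k. Y \<in> Ob C \<Longrightarrow> snd A Y k \<in> elems A Y k"
    and "\<And>Y \<theta> m n. Y \<in> Ob C \<Longrightarrow> \<theta> \<in> Delta m n \<Longrightarrow> sop (sval (fst A) Y) m n \<theta> (snd A Y n) = snd A Y m"
    and "\<And>f k. f \<in> Ar C \<Longrightarrow> srst (fst A) f k (snd A (Cod C f) k) = snd A (Dom C f) k"
  shows "is_pob C A"
  unfolding is_pob_def is_spsh_def is_sset_def sset_map_def
  by (intro conjI ballI allI impI funcsetI) (rule assms; assumption)+

lemma pointed_homD:
  assumes "\<phi> \<in> pointed_hom C A B"
  shows "\<phi> \<in> extensional (Ob C)"
    and "Y \<in> Ob C \<Longrightarrow> \<phi> Y k \<in> extensional (elems A Y k)"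
    and "Y \<in> Ob C \<Longrightarrow> x \<in> elems A Y k \<Longrightarrow> \<phi> Y k x \<in> elems B Y k"
    and "Y \<in> Ob C \<Longrightarrow> \<theta> \<in> Delta m n \<Longrightarrow> x \<in> elems A Y n \<Longrightarrow>
      \<phi> Y m (sop (sval (fst A) Y) m n \<theta> x) = sop (sval (fst B) Y) m n \<theta> (\<phi> Y n x)"
    and "f \<in> Ar C \<Longrightarrow> x \<in> elems A (Cod C f) k \<Longrightarrow>
      \<phi> (Dom C f) k (srst (fst A) f k x) = srst (fst B) f k (\<phi> (Cod C f) k x)"
    and "Y \<in> Ob C \<Longrightarrow> \<phi> Y k (snd A Y k) = snd B Y k"
  using assms by (simp_all add: pointed_hom_def spsh_hom_def sset_map_def Pi_iff)

lemma pointed_homI: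
  assumes "\<phi> \<in> extensional (Ob C)"
    and "\<And>Y k. Y \<in> Ob C \<Longrightarrow> \<phi> Y k \<in> extensional (elems A Y k)"
    and "\<And>Y k x. Y \<in> Ob C \<Longrightarrow> x \<in> elems A Y k \<Longrightarrow> \<phi> Y k x \<in> elems B Y k"
    and "\<And>Y \<theta> m n x. Y \<in> Ob C \<Longrightarrow> \<theta> \<in> Delta m n \<Longrightarrow> x \<in> elems A Y n \<Longrightarrow>
      \<phi> Y m (sop (sval (fst A) Y) m n \<theta> x) = sop (sval (fst B) Y) m n \<theta> (\<phi> Y n x)"
    and "\<And>f x k. f \<in> Ar C \<Longrightarrow> x \<in> elems A (Cod C f) k \<Longrightarrow>
      \<phi> (Dom C f) k (srst (fst A) f k x) = srst (fst B) f k (\<phi> (Cod C f) k x)"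
    and "\<And>Y k. Y \<in> Ob C \<Longrightarrow> \<phi> Y k (snd A Y k) = snd B Y k"
  shows "\<phi> \<in> pointed_hom C A B"
  unfolding pointed_hom_def spsh_hom_def sset_map_def mem_Collect_eq
  by (intro conjI ballI allI impI funcsetI) (rule assms; assumption)+

text \<open>\<open>spsh_hom\<close> requires extensionality in the object and in the element, so
  equality of arrows can be checked on elements.\<close>

lemma pointed_hom_eqI:
  assumes \<phi>: "\<phi> \<in> pointed_hom C A B" and \<psi>: "\<psi> \<in> pointed_hom C A D"
    and eq: "\<And>Y k x. Y \<in> Ob C \<Longrightarrow> x \<in> elems A Y k \<Longrightarrow> \<phi> Y k x = \<psi> Y k x"
  shows "\<phi> = \<psi>"
proof (rule extensionalityI[OF pointed_homD(1)[OF \<phi>] pointed_homD(1)[OF \<psi>]])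
  fix Y assume Y: "Y \<in> Ob C"
  show "\<phi> Y = \<psi> Y"
    by (rule ext, rule extensionalityI[OF pointed_homD(2)[OF \<phi> Y] pointed_homD(2)[OF \<psi> Y]])
      (rule eq[OF Y])
qed

lemma pcat_simps:
  "Ob (pcat C) = {A. is_pob C A}" "Dom (pcat C) f = fst f" "Cod (pcat C) f = snd (snd f)"
  "Idn (pcat C) A = (A, spsh_id C (fst A), A)"
  "Cmp (pcat C) (B, \<psi>, D) (A, \<phi>, B') = (A, spsh_cmp C (fst A) \<psi> \<phi>, D)"
  by (simp_all add: pcat_def)

text \<open>Functoriality is a clause of \<open>is_spsh\<close>; what the pointwise arguments ask of
  \<open>C\<close> is that restriction maps run between values at objects.\<close>

locale site =
  fixes C :: "('o, 'm) cat"
  assumes Dom_Cod: "f \<in> Ar C \<Longrightarrow> Dom C f \<in> Ob C \<and> Cod C f \<in> Ob C"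
begin

lemma spsh_id_pointed: "is_pob C A \<Longrightarrow> spsh_id C (fst A) \<in> pointed_hom C A A"
  by (rule pointed_homI) (auto simp: spsh_id_def is_pobD Dom_Cod)

lemma spsh_cmp_apply:
  "Y \<in> Ob C \<Longrightarrow> x \<in> smp (sval F Y) k \<Longrightarrow> spsh_cmp C F \<psi> \<phi> Y k x = \<psi> Y k (\<phi> Y k x)"
  by (simp add: spsh_cmp_def compose_def)

lemma spsh_cmp_pointed:
  assumes A: "is_pob C A" and \<phi>: "\<phi> \<in> pointed_hom C A B" and \<psi>: "\<psi> \<in> pointed_hom C B D"
  shows "spsh_cmp C (fst A) \<psi> \<phi> \<in> pointed_hom C A D"
proof (rule pointed_homI)
  show "spsh_cmp C (fst A) \<psi> \<phi> \<in> extensional (Ob C)" by (simp add: spsh_cmp_def)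
  show "spsh_cmp C (fst A) \<psi> \<phi> Y k \<in> extensional (elems A Y k)" if "Y \<in> Ob C" for Y k
    using that by (simp add: spsh_cmp_def compose_def)
qed (simp_all add: spsh_cmp_apply is_pobD[OF A] pointed_homD[OF \<phi>] pointed_homD[OF \<psi>] Dom_Cod)

lemma pcat_Cmp_arr:
  "\<lbrakk>f \<in> arr (pcat C) A B; g \<in> arr (pcat C) B D\<rbrakk> \<Longrightarrow> Cmp (pcat C) g f \<in> arr (pcat C) A D"
  by (auto simp: arr_pcat_iff pcat_simps intro: spsh_cmp_pointed)

lemma arr_pcat_eqI:
  assumes "f \<in> arr (pcat C) A B" "g \<in> arr (pcat C) A B"
    and "\<And>Y k x. Y \<in> Ob C \<Longrightarrow> x \<in> elems A Y k \<Longrightarrow> fst (snd f) Y k x = fst (snd g) Y k x"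
  shows "f = g"
proof -
  obtain \<phi> \<psi> where "\<phi> \<in> pointed_hom C A B" "f = (A, \<phi>, B)" "\<psi> \<in> pointed_hom C A B" "g = (A, \<psi>, B)"
    using assms(1,2) by (auto simp: arr_pcat_iff)
  then show ?thesis using pointed_hom_eqI[of \<phi> C A B \<psi> B] assms(3) by simp
qed

lemma pcat_apply:
  "\<lbrakk>f \<in> arr (pcat C) A B; g \<in> arr (pcat C) B D; Y \<in> Ob C; x \<in> elems A Y k\<rbrakk> \<Longrightarrow>
    fst (snd (Cmp (pcat C) g f)) Y k x = fst (snd g) Y k (fst (snd f) Y k x)"
  by (auto simp: arr_pcat_iff pcat_simps spsh_cmp_apply)

lemma pcat_Idn_apply:
  "Y \<in> Ob C \<Longrightarrow> x \<in> elems A Y k \<Longrightarrow> fst (snd (Idn (pcat C) A)) Y k x = x"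
  by (simp add: pcat_simps spsh_id_def)

lemma pcat_mem:
  "\<lbrakk>f \<in> arr (pcat C) A B; Y \<in> Ob C; x \<in> elems A Y k\<rbrakk> \<Longrightarrow> fst (snd f) Y k x \<in> elems B Y k"
  by (auto simp: arr_pcat_iff pointed_homD)

lemma category_pcat: "category (pcat C)"
proof
  show Idn: "Idn (pcat C) A \<in> arr (pcat C) A A" if "A \<in> Ob (pcat C)" for A :: "('o, 'm, 'v) pob"
    using that by (auto simp: arr_pcat_iff pcat_simps spsh_id_pointed)
  show Ob: "A \<in> Ob (pcat C) \<and> B \<in> Ob (pcat C)" if "f \<in> arr (pcat C) A B" for f and A B :: "('o, 'm, 'v) pob"
    using that by (simp add: arr_pcat_iff pcat_simps)
  show "Cmp (pcat C) g f \<in> arr (pcat C) A D"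
    if "f \<in> arr (pcat C) A B" "g \<in> arr (pcat C) B D" for f g and A B D :: "('o, 'm, 'v) pob"
    using that by (rule pcat_Cmp_arr)
  show "Cmp (pcat C) f (Idn (pcat C) A) = f" if f: "f \<in> arr (pcat C) A B" for f and A B :: "('o, 'm, 'v) pob"
  proof -
    have id: "Idn (pcat C) A \<in> arr (pcat C) A A" using Idn Ob f by blast
    show ?thesis
      by (rule arr_pcat_eqI[OF pcat_Cmp_arr[OF id f] f])
        (simp add: pcat_apply[OF id f] pcat_Idn_apply)
  qed
  show "Cmp (pcat C) (Idn (pcat C) B) f = f" if f: "f \<in> arr (pcat C) A B" for f and A B :: "('o, 'm, 'v) pob"
  proof -
    have id: "Idn (pcat C) B \<in> arr (pcat C) B B" using Idn Ob f by blast
    show ?thesis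
      by (rule arr_pcat_eqI[OF pcat_Cmp_arr[OF f id] f])
        (simp add: pcat_apply[OF f id] pcat_Idn_apply pcat_mem[OF f])
  qed
  show "Cmp (pcat C) (Cmp (pcat C) h g) f = Cmp (pcat C) h (Cmp (pcat C) g f)"
    if f: "f \<in> arr (pcat C) A B" and g: "g \<in> arr (pcat C) B D" and h: "h \<in> arr (pcat C) D E"
    for f g h and A B D E :: "('o, 'm, 'v) pob"
    by (rule arr_pcat_eqI[OF pcat_Cmp_arr[OF f pcat_Cmp_arr[OF g h]] pcat_Cmp_arr[OF pcat_Cmp_arr[OF f g] h]])
      (simp add: pcat_apply[OF f pcat_Cmp_arr[OF g h]] pcat_apply[OF pcat_Cmp_arr[OF f g] h]
        pcat_apply[OF f g] pcat_apply[OF g h] pcat_mem[OF f])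
qed

subsection \<open>The zero object\<close>

lemma pt_elems: "elems pt Y k = {undefined}" and pt_base: "snd pt Y k = undefined"
  by (simp_all add: pt_def)

lemma is_pob_pt: "is_pob C pt"
  by (rule is_pobI) (auto simp: pt_def)

lemma to_pt_arr: "is_pob C A \<Longrightarrow> to_pt C A \<in> arr (pcat C) A pt"
  unfolding to_pt_def
  by (intro arr_pcatI is_pob_pt pointed_homI) (auto simp: pt_def is_pobD Dom_Cod)

lemma arr_to_pt_eq: "f \<in> arr (pcat C) A pt \<Longrightarrow> g \<in> arr (pcat C) A pt \<Longrightarrow> f = g"
  by (rule arr_pcat_eqI) (auto dest!: pcat_mem simp: pt_elems)

definition from_pt :: "('o, 'm, 'v) pob \<Rightarrow> ('o, 'm, 'v) par" where
  "from_pt A = (pt, \<lambda>Y\<in>Ob C. \<lambda>k. \<lambda>x\<in>{undefined}. snd A Y k, A)"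

lemma from_pt_arr: "is_pob C A \<Longrightarrow> from_pt A \<in> arr (pcat C) pt A"
  unfolding from_pt_def
  by (intro arr_pcatI is_pob_pt pointed_homI) (auto simp: pt_def is_pobD Dom_Cod)

lemma arr_base: "f \<in> arr (pcat C) A B \<Longrightarrow> Y \<in> Ob C \<Longrightarrow> fst (snd f) Y k (snd A Y k) = snd B Y k"
  by (auto simp: arr_pcat_iff pointed_homD)

lemma arr_from_pt_eq:
  fixes A :: "('o, 'm, 'v) pob"
  assumes f: "f \<in> arr (pcat C) pt A" and g: "g \<in> arr (pcat C) pt A"
  shows "f = g"
proof (rule arr_pcat_eqI[OF f g])
  fix Y k and x :: 'v assume Y: "Y \<in> Ob C" and "x \<in> elems (pt :: ('o, 'm, 'v) pob) Y k"
  then have "x = snd (pt :: ('o, 'm, 'v) pob) Y k" by (simp add: pt_elems pt_base)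
  then show "fst (snd f) Y k x = fst (snd g) Y k x"
    by (simp only: arr_base[OF f Y] arr_base[OF g Y])
qed

subsection \<open>Fibres\<close>

lemma fibre_elems:
  "elems (fibre f) Y k = {x \<in> elems (fst f) Y k. fst (snd f) Y k x = snd (snd (snd f)) Y k}"
  "sop (sval (fst (fibre f)) Y) = sop (sval (fst (fst f)) Y)" "srst (fst (fibre f)) = srst (fst (fst f))"
  "snd (fibre f) = snd (fst f)"
  by (simp_all add: fibre_def split: prod.split)

lemma is_pob_fibre:
  assumes f: "f \<in> arr (pcat C) A B"
  shows "is_pob C (fibre f)"
proof -
  obtain \<phi> where A: "is_pob C A" and B: "is_pob C B" and \<phi>: "\<phi> \<in> pointed_hom C A B" and f: "f = (A, \<phi>, B)"
    using f by (auto simp: arr_pcat_iff)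
  show ?thesis
    by (rule is_pobI)
      (auto simp: fibre_elems f is_pobD[OF A] is_pobD[OF B] pointed_homD[OF \<phi>] Dom_Cod)
qed

lemma fibre_incl_arr:
  assumes f: "f \<in> arr (pcat C) A B"
  shows "fibre_incl C f \<in> arr (pcat C) (fibre f) A"
proof -
  have A: "is_pob C A" and fA: "fst f = A" using f by (auto simp: arr_pcat_iff)
  show ?thesis
    unfolding fibre_incl_def fA
    by (intro arr_pcatI is_pob_fibre[OF f] A pointed_homI)
      (auto simp: fibre_elems fA spsh_id_def is_pobD[OF A] is_pobD[OF is_pob_fibre[OF f], unfolded fibre_elems fA mem_Collect_eq] Dom_Cod)
qed

lemma fibre_incl_apply: "Y \<in> Ob C \<Longrightarrow> x \<in> elems (fibre f) Y k \<Longrightarrow> fst (snd (fibre_incl C f)) Y k x = x"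
  by (simp add: fibre_incl_def spsh_id_def)

lemma from_pt_apply: "Y \<in> Ob C \<Longrightarrow> fst (snd (from_pt A)) Y k undefined = snd A Y k"
  by (simp add: from_pt_def)

lemma null_apply:
  assumes "c \<in> arr (pcat C) Y' pt" "is_pob C A" "Y \<in> Ob C" "x \<in> elems Y' Y k"
  shows "fst (snd (Cmp (pcat C) (from_pt A) c)) Y k x = snd A Y k"
  using pcat_apply[OF assms(1) from_pt_arr[OF assms(2)] assms(3,4)] pcat_mem[OF assms(1,3,4)]
    from_pt_apply[OF assms(3)] by (simp add: pt_elems)

lemma fibre_incl_null:
  assumes f: "f \<in> arr (pcat C) A B" and c: "c \<in> arr (pcat C) (fibre f) pt"
  shows "Cmp (pcat C) f (fibre_incl C f) = Cmp (pcat C) (from_pt B) c"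
proof -
  note k = fibre_incl_arr[OF f]
  have B: "is_pob C B" and fB: "snd (snd f) = B" using f by (auto simp: arr_pcat_iff)
  show ?thesis
    by (rule arr_pcat_eqI[OF pcat_Cmp_arr[OF k f] pcat_Cmp_arr[OF c from_pt_arr[OF B]]])
      (simp add: pcat_apply[OF k f] null_apply[OF c B] fibre_incl_apply, simp add: fibre_elems fB)
qed

lemma fibre_incl_mono:
  assumes f: "f \<in> arr (pcat C) A B"
    and g: "g \<in> arr (pcat C) D (fibre f)" "g' \<in> arr (pcat C) D (fibre f)"
    and "Cmp (pcat C) (fibre_incl C f) g = Cmp (pcat C) (fibre_incl C f) g'"
  shows "g = g'"
proof (rule arr_pcat_eqI[OF g])
  note k = fibre_incl_arr[OF f]
  fix Y k x assume "Y \<in> Ob C" "x \<in> elems D Y k"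
  then show "fst (snd g) Y k x = fst (snd g') Y k x"
    using pcat_apply[OF g(1) k] pcat_apply[OF g(2) k] assms(4) fibre_incl_apply pcat_mem[OF g(1)]
      pcat_mem[OF g(2)] by metis
qed

lemma fibre_incl_kernel:
  assumes f: "f \<in> arr (pcat C) A B" and g: "g \<in> arr (pcat C) D A" and t: "t \<in> arr (pcat C) D pt"
    and "Cmp (pcat C) f g = Cmp (pcat C) (from_pt B) t"
  shows "\<exists>h \<in> arr (pcat C) D (fibre f). Cmp (pcat C) (fibre_incl C f) h = g"
proof -
  obtain \<phi> where A: "is_pob C A" and B: "is_pob C B" and \<phi>: "\<phi> \<in> pointed_hom C A B" and f': "f = (A, \<phi>, B)"
    using f by (auto simp: arr_pcat_iff)
  obtain \<gamma> where D: "is_pob C D" and \<gamma>: "\<gamma> \<in> pointed_hom C D A" and g': "g = (D, \<gamma>, A)"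
    using g by (auto simp: arr_pcat_iff)
  have "\<phi> Y k (\<gamma> Y k x) = snd B Y k" if "Y \<in> Ob C" "x \<in> elems D Y k" for Y k x
    using pcat_apply[OF g f that] null_apply[OF t B that] assms(4) by (simp add: f' g')
  \<comment> \<open>The fibre is a subpresheaf, so the factorization is the same function with a
    smaller target.\<close>
  then have "\<gamma> \<in> pointed_hom C D (fibre f)"
    by (intro pointed_homI) (auto simp: fibre_elems f' pointed_homD[OF \<gamma>])
  then have h: "(D, \<gamma>, fibre f) \<in> arr (pcat C) D (fibre f)"
    using D is_pob_fibre[OF f] by (simp add: arr_pcat_iff)
  note k = fibre_incl_arr[OF f]
  have "Cmp (pcat C) (fibre_incl C f) (D, \<gamma>, fibre f) = g"
  proof (rule arr_pcat_eqI[OF pcat_Cmp_arr[OF h k] g])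
    fix Y k' x assume x: "Y \<in> Ob C" "x \<in> elems D Y k'"
    have "\<gamma> Y k' x \<in> elems (fibre f) Y k'" using pcat_mem[OF h x] by simp
    then show "fst (snd (Cmp (pcat C) (fibre_incl C f) (D, \<gamma>, fibre f))) Y k' x = fst (snd g) Y k' x"
      using pcat_apply[OF h k x] fibre_incl_apply[OF x(1)] by (simp add: g')
  qed
  then show ?thesis using h by blast
qed

subsection \<open>Products\<close>

lemma split_mono_spsh_mono:
  assumes s: "s \<in> arr (pcat C) A B" and r: "r \<in> arr (pcat C) B A" and e: "Cmp (pcat C) r s = Idn (pcat C) A"
  shows "spsh_mono C (fst A) (fst (snd s))"
  unfolding spsh_mono_def
proof (intro ballI allI inj_on_inverseI)
  fix Y k x assume "Y \<in> Ob C" "x \<in> elems A Y k"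
  then show "fst (snd r) Y k (fst (snd s) Y k x) = x"
    using pcat_apply[OF s r] pcat_Idn_apply e by metis
qed

text \<open>All values are subsets of the single type \<open>'v\<close>, so pairs have to be coded
  in it; \<open>e\<close> is an injection, available because \<open>'v\<close> is infinite.\<close>

definition pprod :: "('v \<times> 'v \<Rightarrow> 'v) \<Rightarrow> ('o, 'm, 'v) pob \<Rightarrow> ('o, 'm, 'v) pob \<Rightarrow> ('o, 'm, 'v) pob" where
  "pprod e A B =
     (\<lparr>sval = (\<lambda>Y. \<lparr>smp = (\<lambda>k. e ` (elems A Y k \<times> elems B Y k)),
         sop = (\<lambda>m n \<theta> v. e (sop (sval (fst A) Y) m n \<theta> (fst (inv_into UNIV e v)), sop (sval (fst B) Y) m n \<theta> (snd (inv_into UNIV e v))))\<rparr>),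
       srst = (\<lambda>f k v. e (srst (fst A) f k (fst (inv_into UNIV e v)), srst (fst B) f k (snd (inv_into UNIV e v))))\<rparr>,
      \<lambda>Y k. e (snd A Y k, snd B Y k))"

lemma pcat_products:
  fixes A B :: "('o, 'm, 'v) pob" and e :: "'v \<times> 'v \<Rightarrow> 'v"
  assumes e: "inj e" and A: "is_pob C A" and B: "is_pob C B"
  shows "\<exists>P p q. p \<in> arr (pcat C) P A \<and> q \<in> arr (pcat C) P B \<and>
    (\<forall>D. \<forall>f \<in> arr (pcat C) D A. \<forall>g \<in> arr (pcat C) D B.
      \<exists>!h. h \<in> arr (pcat C) D P \<and> Cmp (pcat C) p h = f \<and> Cmp (pcat C) q h = g)"
proof -
  define P where "P = pprod e A B"
  define p where "p = (P, \<lambda>Y\<in>Ob C. \<lambda>k. \<lambda>v\<in>elems P Y k. fst (inv_into UNIV e v), A)"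
  define q where "q = (P, \<lambda>Y\<in>Ob C. \<lambda>k. \<lambda>v\<in>elems P Y k. snd (inv_into UNIV e v), B)"
  have inv: "inv_into UNIV e (e z) = z" for z using e by simp
  have eP: "elems P Y k = e ` (elems A Y k \<times> elems B Y k)" for Y k
    by (simp add: P_def pprod_def)
  have sP: "sop (sval (fst P) Y) m n \<theta> (e (a, b))
      = e (sop (sval (fst A) Y) m n \<theta> a, sop (sval (fst B) Y) m n \<theta> b)" for Y m n \<theta> a b
    by (simp add: P_def pprod_def inv)
  have rP: "srst (fst P) f k (e (a, b)) = e (srst (fst A) f k a, srst (fst B) f k b)" for f k a b
    by (simp add: P_def pprod_def inv)
  have bP: "snd P Y k = e (snd A Y k, snd B Y k)" for Y k
    by (simp add: P_def pprod_def)
  have P: "is_pob C P"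
    by (rule is_pobI) (auto simp: eP sP rP bP is_pobD[OF A] is_pobD[OF B])
  have p: "p \<in> arr (pcat C) P A"
    unfolding p_def
    by (intro arr_pcatI P A pointed_homI)
      (auto simp: eP sP rP bP is_pobD[OF A] is_pobD[OF B] inv Dom_Cod inj_eq[OF e])
  have q: "q \<in> arr (pcat C) P B"
    unfolding q_def
    by (intro arr_pcatI P B pointed_homI)
      (auto simp: eP sP rP bP is_pobD[OF A] is_pobD[OF B] inv Dom_Cod inj_eq[OF e])
  have pq: "fst (snd p) Y k (e (a, b)) = a" "fst (snd q) Y k (e (a, b)) = b"
    if "Y \<in> Ob C" "a \<in> elems A Y k" "b \<in> elems B Y k" for Y k a b
    using that by (auto simp: p_def q_def eP inv)
  have "\<exists>!h. h \<in> arr (pcat C) D P \<and> Cmp (pcat C) p h = f \<and> Cmp (pcat C) q h = g"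
    if f: "f \<in> arr (pcat C) D A" and g: "g \<in> arr (pcat C) D B" for D f g
  proof -
    obtain \<phi> where D: "is_pob C D" and \<phi>: "\<phi> \<in> pointed_hom C D A" and f': "f = (D, \<phi>, A)"
      using f by (auto simp: arr_pcat_iff)
    obtain \<gamma> where \<gamma>: "\<gamma> \<in> pointed_hom C D B" and g': "g = (D, \<gamma>, B)"
      using g by (auto simp: arr_pcat_iff)
    define h where "h = (D, \<lambda>Y\<in>Ob C. \<lambda>k. \<lambda>x\<in>elems D Y k. e (\<phi> Y k x, \<gamma> Y k x), P)"
    have h: "h \<in> arr (pcat C) D P"
      unfolding h_def
      by (intro arr_pcatI P D pointed_homI)
        (auto simp: eP sP rP bP is_pobD[OF D] pointed_homD[OF \<phi>] pointed_homD[OF \<gamma>] Dom_Cod)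
    have hx: "fst (snd h) Y k x = e (\<phi> Y k x, \<gamma> Y k x)" if "Y \<in> Ob C" "x \<in> elems D Y k" for Y k x
      using that by (simp add: h_def)
    have "Cmp (pcat C) p h = f"
      by (rule arr_pcat_eqI[OF pcat_Cmp_arr[OF h p] f])
        (simp add: pcat_apply[OF h p] hx pq pointed_homD[OF \<phi>] pointed_homD[OF \<gamma>] f')
    moreover have "Cmp (pcat C) q h = g"
      by (rule arr_pcat_eqI[OF pcat_Cmp_arr[OF h q] g])
        (simp add: pcat_apply[OF h q] hx pq pointed_homD[OF \<phi>] pointed_homD[OF \<gamma>] g')
    moreover have "h' = h" if h': "h' \<in> arr (pcat C) D P" "Cmp (pcat C) p h' = f" "Cmp (pcat C) q h' = g" for h'
    proof (rule arr_pcat_eqI[OF h'(1) h])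
      fix Y k x assume x: "Y \<in> Ob C" "x \<in> elems D Y k"
      obtain a b where ab: "fst (snd h') Y k x = e (a, b)" "a \<in> elems A Y k" "b \<in> elems B Y k"
        using pcat_mem[OF h'(1) x] by (auto simp: eP)
      have "a = \<phi> Y k x" "b = \<gamma> Y k x"
        using pcat_apply[OF h'(1) p x] pcat_apply[OF h'(1) q x] h'(2,3) ab pq[OF x(1) ab(2,3)]
        by (auto simp: f' g')
      then show "fst (snd h') Y k x = fst (snd h) Y k x" using ab hx[OF x] by simp
    qed
    ultimately show ?thesis using h by blast
  qed
  then show ?thesis using p q by blast
qed

end

section \<open>The tower and the slices\<close>

lemma inj_pairing_exists:
  assumes "infinite (UNIV :: 'v set)"
  shows "\<exists>e :: 'v \<times> 'v \<Rightarrow> 'v. inj e"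
proof -
  have "\<exists>f :: 'v \<times> 'v \<Rightarrow> 'v. bij_betw f (UNIV \<times> UNIV) UNIV"
    using card_of_Times_same_infinite[OF assms] card_of_ordIso by blast
  then show ?thesis by (auto simp: bij_betw_def)
qed

text \<open>Localization keeps the cofibrations, so one statement about a variable \<open>N\<close>
  serves the motivic structure and all \<open>L k\<close>.\<close>

lemma pointed_model_category_pcat:
  fixes N :: "('o, 'm, 'v) par model"
  assumes "site C" and "infinite (UNIV :: 'v set)" and "model_structure (pcat C) N"
    and cof: "cof N = {(A, \<phi>, B). (A, \<phi>, B) \<in> Ar (pcat C) \<and> spsh_mono C (fst A) \<phi>}"
  shows "pointed_model_category (pcat C) pt N"
proof -
  interpret site C by fact
  interpret category "pcat C :: (('o, 'm, 'v) pob, ('o, 'm, 'v) par) cat" by (rule category_pcat)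
  obtain e :: "'v \<times> 'v \<Rightarrow> 'v" where e: "inj e" using inj_pairing_exists[OF assms(2)] by blast
  show ?thesis
  proof
    show "pt \<in> Ob (pcat C)" using is_pob_pt by (simp add: pcat_simps)
    show "\<exists>!f. f \<in> arr (pcat C) A pt" if "A \<in> Ob (pcat C)" for A :: "('o, 'm, 'v) pob"
    proof -
      have "is_pob C A" using that by (simp add: pcat_simps)
      from to_pt_arr[OF this] show ?thesis by (rule ex1I) (rule arr_to_pt_eq[OF _ to_pt_arr[OF \<open>is_pob C A\<close>]])
    qed
    show "\<exists>!f. f \<in> arr (pcat C) pt A" if "A \<in> Ob (pcat C)" for A :: "('o, 'm, 'v) pob"
    proof -
      have "is_pob C A" using that by (simp add: pcat_simps)
      from from_pt_arr[OF this] show ?thesis by (rule ex1I) (rule arr_from_pt_eq[OF _ from_pt_arr[OF \<open>is_pob C A\<close>]])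
    qed
    show "model_structure (pcat C) N" by fact
    show "s \<in> cof N" if "s \<in> arr (pcat C) A B" "r \<in> arr (pcat C) B A" "Cmp (pcat C) r s = Idn (pcat C) A"
      for s r and A B :: "('o, 'm, 'v) pob"
      using split_mono_spsh_mono[OF that] that(1) unfolding cof arr_pcat_iff
      by (auto simp: pcat_def pointed_hom_def)
  next
    fix A B :: "('o, 'm, 'v) pob"
    assume "A \<in> Ob (pcat C)" "B \<in> Ob (pcat C)"
    then show "\<exists>P p q. p \<in> arr (pcat C) P A \<and> q \<in> arr (pcat C) P B \<and>
      (\<forall>Y. \<forall>f \<in> arr (pcat C) Y A. \<forall>g \<in> arr (pcat C) Y B.
        \<exists>!h. h \<in> arr (pcat C) Y P \<and> Cmp (pcat C) p h = f \<and> Cmp (pcat C) q h = g)"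
      using pcat_products[OF e, of A B] by (simp add: pcat_simps)
  qed
qed

lemma site_Sm: "site (Sm X)"
  by (rule site.intro) (auto simp: Sm_def)

text \<open>A larger \<open>S\<close> leaves fewer local objects, and fewer test objects give more
  local equivalences.\<close>

lemma left_Bousfield_localization_mono:
  assumes "left_Bousfield_localization C M S N" "left_Bousfield_localization C M S' N'" "S \<subseteq> S'"
  shows "weq N \<subseteq> weq N'"
proof -
  have "local_obj C M S Z" if "local_obj C M S' Z" for Z
    using that assms(3) unfolding local_obj_def by blast
  then show ?thesis
    using assms(1,2) unfolding left_Bousfield_localization_def local_equiv_def by auto
qed

lemma WB_Suc_subset: "WB X emb (Suc n) \<subseteq> WB X emb n"
proof -
  have "enat (n + 1) \<le> c" if "enat (Suc n + 1) \<le> c" for c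
    using order_trans[OF _ that] by simp
  then show ?thesis unfolding WB_def by blast
qed

text \<open>The localizations enter the tower through their common cofibrations and their weak
  equivalences: these contain the motivic ones and decrease with \<open>k\<close>, since
  \<open>WB\<close> shrinks as the bound on the codimension grows.\<close>

locale slice_tower =
  fixes X :: "'a sch" and M :: "('a, 'v) mar model" and L :: "nat \<Rightarrow> ('a, 'v) mar model"
  assumes model_M: "pointed_model_category (Mcat X) pt M"
    and model_L: "pointed_model_category (Mcat X) pt (L k)"
    and cof_L: "cof (L k) = cof M"
    and weq_M_L: "weq M \<subseteq> weq (L k)"
    and weq_L_Suc: "weq (L (Suc k)) \<subseteq> weq (L k)"
begin

sublocale site "Sm X" by (rule site_Sm)

sublocale M: pointed_model_category "Mcat X" pt M by (rule model_M)

sublocale L: pointed_model_category "Mcat X" pt "L k" for k by (rule model_L)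

abbreviation stage :: "nat \<Rightarrow> ('a, 'v) mob \<Rightarrow> ('a, 'v) mob" where
  "stage n A \<equiv> fob (tau X L n) A"

lemma stage_def: "stage n A = Cod (Mcat X) (tau_le X L n A)"
  by (simp add: tau_def)

lemma weq_L_antimono: "i \<le> k \<Longrightarrow> weq (L k) \<subseteq> weq (L i)"
  using weq_L_Suc by (rule lift_Suc_antimono_le)

lemma fib_L_M: "fib (L k) \<subseteq> fib M"
  by (rule fib_mono) (use M.model_category_axioms L.model_category_axioms cof_L weq_M_L in auto)

lemma fib_L_Suc: "fib (L k) \<subseteq> fib (L (Suc k))"
  by (rule fib_mono) (use L.model_category_axioms cof_L weq_L_Suc in auto)

lemma tfib_L_M: "f \<in> fib (L k) \<Longrightarrow> f \<in> weq (L k) \<Longrightarrow> f \<in> weq M"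
  by (rule tfib_mono) (use M.model_category_axioms L.model_category_axioms cof_L in auto)

context
  fixes A :: "('a, 'v) mob"
  assumes A: "is_pob (Sm X) A"
begin

lemma tau_le_arr: "tau_le X L n A \<in> arr (Mcat X) A (stage n A)"
proof (induction n)
  case 0
  show ?case unfolding stage_def using to_pt_arr[OF A] by (simp add: to_pt_def pcat_simps)
next
  case (Suc n)
  show ?case unfolding stage_def using L.factor_tcf(1)[OF Suc, of n] by simp
qed

lemma is_pob_stage: "is_pob (Sm X) (stage n A)"
  using tau_le_arr by (simp add: arr_pcat_iff)

lemma nu_arr: "nu X L n A \<in> arr (Mcat X) (stage (Suc n) A) (stage n A)"
  and nu_fib: "nu X L n A \<in> fib (L n)"
  and nu_tau_le: "Cmp (Mcat X) (nu X L n A) (tau_le X L (Suc n) A) = tau_le X L n A"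
  and tau_le_weq: "tau_le X L (Suc n) A \<in> weq (L n)"
  using L.factor_tcf[OF tau_le_arr, of n n] unfolding nu_def stage_def[of "Suc n"] by simp_all

lemma to_pt_stage_arr: "to_pt (Sm X) (stage n A) \<in> arr (Mcat X) (stage n A) pt"
  by (rule to_pt_arr[OF is_pob_stage])

lemma to_pt_stage_Suc_fib:
  assumes "to_pt (Sm X) (stage n A) \<in> fib (L n)"
  shows "to_pt (Sm X) (stage (Suc n) A) \<in> fib (L n)"
  using L.fib_Cmp[OF nu_arr to_pt_stage_arr nu_fib assms]
    arr_to_pt_eq[OF M.Cmp_arr[OF nu_arr to_pt_stage_arr] to_pt_stage_arr] by simp

text \<open>For \<open>n = Suc m\<close> the stage is even fibrant in \<open>L m\<close>, by
  \<open>to_pt_stage_Suc_fib\<close>. The weaker form in \<open>L n\<close> makes sense for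
  \<open>stage 0\<close> as well and is what composes with \<open>nu X L n A\<close>, a fibration of
  \<open>L n\<close>.\<close>

lemma to_pt_stage_fib: "to_pt (Sm X) (stage n A) \<in> fib (L n)"
proof (induction n)
  case 0
  have "stage 0 A = pt" by (simp add: stage_def to_pt_def pcat_simps)
  then have "to_pt (Sm X) (stage 0 A) = Idn (Mcat X) pt"
    using arr_to_pt_eq[OF to_pt_stage_arr[of 0]] M.Idn_arr[OF M.zero_Ob] by simp
  then show ?case using L.fib_Idn[OF M.zero_Ob] by simp
next
  case (Suc n)
  then show ?case using to_pt_stage_Suc_fib fib_L_Suc by blast
qed

lemma to_pt_stage_tau_le: "Cmp (Mcat X) (to_pt (Sm X) (stage n A)) (tau_le X L n A) = to_pt (Sm X) A"
  by (rule arr_to_pt_eq[OF M.Cmp_arr[OF tau_le_arr to_pt_stage_arr] to_pt_arr[OF A]])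

text \<open>The maps from \<open>A\<close> to \<open>stage (Suc m) A\<close> and to
  \<open>stage (Suc i) A\<close> are both weak equivalences in \<open>L i\<close>, so
  contractibility passes through \<open>A\<close> inside \<open>L i\<close>. It returns to
  \<open>M\<close> because \<open>stage (Suc i) A\<close> is fibrant in \<open>L i\<close>.\<close>

lemma stage_contractible_antimono:
  assumes w: "to_pt (Sm X) (stage (Suc m) A) \<in> weq M" and "i \<le> m"
  shows "to_pt (Sm X) (stage (Suc i) A) \<in> weq M"
proof -
  have "tau_le X L (Suc m) A \<in> weq (L i)"
    using tau_le_weq weq_L_antimono[OF assms(2)] by blast
  moreover have "to_pt (Sm X) (stage (Suc m) A) \<in> weq (L i)" using w weq_M_L by blast
  ultimately have "to_pt (Sm X) A \<in> weq (L i)"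
    by (rule L.weq_Cmp[OF tau_le_arr to_pt_stage_arr, unfolded to_pt_stage_tau_le])
  then have "to_pt (Sm X) (stage (Suc i) A) \<in> weq (L i)"
    by (rule L.weq_left[OF tau_le_arr to_pt_stage_arr tau_le_weq, unfolded to_pt_stage_tau_le])
  then show ?thesis using tfib_L_M to_pt_stage_Suc_fib[OF to_pt_stage_fib] by blast
qed

lemma incl_arr: "n \<ge> 1 \<Longrightarrow> incl X L n A \<in> arr (Mcat X) (fibre (nu X L n A)) (stage (Suc n) A)"
  using fibre_incl_arr[OF nu_arr] by (simp add: incl_def)

lemma stage_contractible_if_iso_incl:
  assumes "n = Suc m" and "iso_in (Hcat X M) (h_incl X M L n A)"
  shows "to_pt (Sm X) (stage n A) \<in> weq M"
proof -
  have n: "n \<ge> 1" and incl: "incl X L n A = fibre_incl (Sm X) (nu X L n A)"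
    using assms(1) by (simp_all add: incl_def)
  have c: "to_pt (Sm X) (fibre (nu X L n A)) \<in> arr (Mcat X) (fibre (nu X L n A)) pt"
    by (rule to_pt_arr[OF is_pob_fibre[OF nu_arr]])
  have fib: "to_pt (Sm X) (stage n A) \<in> fib (L m)"
    unfolding assms(1) by (rule to_pt_stage_Suc_fib[OF to_pt_stage_fib])
  have "to_pt (Sm X) (stage n A) \<in> weq (L m)"
  \<comment> \<open>The inclusion is inverted motivically, but the homotopies are taken in
    \<open>L m\<close>, the structure in which \<open>tau_le X L (Suc m) A\<close> is a weak
    equivalence.\<close>
  proof (rule L.weq_to_zero_if_null[OF to_pt_stage_arr fib weq_M_L incl_arr[OF n] _ nu_arr c
        from_pt_arr[OF is_pob_stage] _ tau_le_arr])
    show "iso_in (loc_cat (Mcat X) (weq M)) (far (loc (Mcat X) (weq M)) (incl X L n A))"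
      using assms(2) by (simp add: Hcat_def h_incl_def Ho_def)
    show "Cmp (Mcat X) (nu X L n A) (incl X L n A)
        = Cmp (Mcat X) (from_pt (stage n A)) (to_pt (Sm X) (fibre (nu X L n A)))"
      unfolding incl by (rule fibre_incl_null[OF nu_arr c])
    show "Cmp (Mcat X) (nu X L n A) (tau_le X L (Suc n) A) \<in> weq (L m)"
      unfolding nu_tau_le assms(1) by (rule tau_le_weq)
  qed
  then show ?thesis using tfib_L_M fib by blast
qed

lemma incl_weq_if_stage_contractible:
  assumes "n \<ge> 1" and "to_pt (Sm X) (stage n A) \<in> weq M"
  shows "incl X L n A \<in> weq M"
proof -
  have incl: "incl X L n A = fibre_incl (Sm X) (nu X L n A)"
    using assms(1) by (simp add: incl_def)
  have c: "to_pt (Sm X) (fibre (nu X L n A)) \<in> arr (Mcat X) (fibre (nu X L n A)) pt"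
    by (rule to_pt_arr[OF is_pob_fibre[OF nu_arr]])
  show ?thesis
    unfolding incl
  proof (rule M.fibre_weq[OF nu_arr _ to_pt_stage_arr _ assms(2) from_pt_arr[OF is_pob_stage]
        fibre_incl_arr[OF nu_arr] c fibre_incl_null[OF nu_arr c]])
    show "nu X L n A \<in> fib M" "to_pt (Sm X) (stage n A) \<in> fib M"
      using nu_fib to_pt_stage_fib fib_L_M by blast+
  qed (rule fibre_incl_kernel[OF nu_arr] fibre_incl_mono[OF nu_arr]; assumption)+
qed

lemma stage_contractible_iff_iso:
  "iso_in (Hcat X M) (h_to_pt X M (stage n A)) \<longleftrightarrow> to_pt (Sm X) (stage n A) \<in> weq M"
proof
  assume "iso_in (Hcat X M) (h_to_pt X M (stage n A))"
  then have "iso_in (loc_cat (Mcat X) (weq M)) (far (loc (Mcat X) (weq M)) (to_pt (Sm X) (stage n A)))"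
    by (simp add: Hcat_def h_to_pt_def Ho_def)
  then show "to_pt (Sm X) (stage n A) \<in> weq M"
    by (rule M.weq_to_zero_if_iso_loc[OF to_pt_stage_arr _ subset_refl, rotated])
      (use to_pt_stage_fib fib_L_M in blast)
next
  assume "to_pt (Sm X) (stage n A) \<in> weq M"
  then show "iso_in (Hcat X M) (h_to_pt X M (stage n A))"
    using M.iso_loc_W[OF to_pt_stage_arr] by (simp add: Hcat_def h_to_pt_def Ho_def)
qed

lemma is_slice_iff:
  "is_slice X M L n A \<longleftrightarrow>
    (\<forall>j. 1 \<le> j \<and> j \<le> n \<longrightarrow> iso_in (Hcat X M) (h_to_pt X M (stage j A))) \<and>
    iso_in (Hcat X M) (h_tau_le X M L (n + 1) A)"
proof -
  have incl_arr': "incl X L n A \<in> arr (Mcat X) (fob (slice_pre X L n) A) (stage (Suc n) A)"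
  \<comment> \<open>For \<open>n = 0\<close> the slice is the first stage and \<open>incl\<close>
    its identity; correspondingly there is no \<open>j\<close> with 1 \<le> j \<le> 0.\<close>
  proof (cases "n = 0")
    case True
    then show ?thesis
      using M.Idn_arr[of "stage (Suc 0) A"] is_pob_stage[of "Suc 0"]
      by (simp add: incl_def slice_pre_def pcat_simps(1))
  qed (use incl_arr in \<open>simp add: slice_pre_def\<close>)
  have ob: "A \<in> Ob (Hcat X M)" using A by (simp add: Hcat_def loc_cat_def pcat_simps)
  \<comment> \<open>The clauses of \<open>is_slice\<close> about sources and targets hold by
    construction, because \<open>induced\<close> keeps the action of a functor on objects.\<close>
  have slice: "is_slice X M L n A \<longleftrightarrow>
      iso_in (Hcat X M) (h_tau_le X M L (n + 1) A) \<and> iso_in (Hcat X M) (h_incl X M L n A)"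
    unfolding is_slice_def
    using ob M.loc_arr[OF tau_le_arr[of "Suc n"]] M.loc_arr[OF incl_arr']
    by (simp add: Hcat_def h_tau_le_def h_incl_def Ho_def t_fun_def s_fun_def induced_def)
  have "iso_in (Hcat X M) (h_incl X M L n A) \<longleftrightarrow>
      (\<forall>j. 1 \<le> j \<and> j \<le> n \<longrightarrow> to_pt (Sm X) (stage j A) \<in> weq M)"
  proof
    assume iso: "iso_in (Hcat X M) (h_incl X M L n A)"
    show "\<forall>j. 1 \<le> j \<and> j \<le> n \<longrightarrow> to_pt (Sm X) (stage j A) \<in> weq M"
    proof (intro allI impI)
      fix j assume j: "1 \<le> j \<and> j \<le> n"
      then obtain m i where "n = Suc m" "j = Suc i" by (metis One_nat_def Suc_le_D order_trans)
      then show "to_pt (Sm X) (stage j A) \<in> weq M"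
        using stage_contractible_antimono[of m i] stage_contractible_if_iso_incl[OF _ iso] j by simp
    qed
  next
    assume c: "\<forall>j. 1 \<le> j \<and> j \<le> n \<longrightarrow> to_pt (Sm X) (stage j A) \<in> weq M"
    have "incl X L n A \<in> weq M"
    proof (cases "n = 0")
      case True
      then show ?thesis
        using M.weq_Idn is_pob_stage[of "Suc 0"] by (simp add: incl_def pcat_simps(1))
    qed (use incl_weq_if_stage_contractible c in simp)
    then show "iso_in (Hcat X M) (h_incl X M L n A)"
      using M.iso_loc_W[OF incl_arr'] by (simp add: Hcat_def h_incl_def Ho_def)
  qed
  then show ?thesis unfolding slice stage_contractible_iff_iso by blast
qed

end

end

theorem theorem7p5:
  fixes X :: "('a, 'a) lrs"
    and emb :: "'a smar option \<Rightarrow> 'v"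
    and M :: "('a, 'v) mar model"
    and L :: "nat \<Rightarrow> ('a, 'v) mar model"
    and A :: "('a, 'v) mob"
    and n :: nat
  assumes "infinite (UNIV :: 'a set)"
    and "inj emb"
    and "base_scheme X"
    and "motivic_model_structure X M"
    and "\<forall>k. left_Bousfield_localization (Sm X) M (WB X emb k) (L k)"
    and "A \<in> Ob (Hcat X M)"
  shows "is_slice X M L n A \<longleftrightarrow>
    (\<forall>j. 1 \<le> j \<and> j \<le> n \<longrightarrow> iso_in (Hcat X M) (h_to_pt X M (fob (t_fun X M L j) A))) \<and>
    iso_in (Hcat X M) (h_tau_le X M L (n + 1) A)"
proof -
  \<comment> \<open>\<open>emb\<close> embeds the arrows of the site into \<open>'v\<close>, and
    their type involves functions on the infinite type \<open>'a\<close>.\<close>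
  have inf_v: "infinite (UNIV :: 'v set)"
  proof
    assume "finite (UNIV :: 'v set)"
    then have "finite (range emb)" by (rule finite_subset[rotated]) simp
    then have "finite (UNIV :: 'a smar option set)" using assms(2) by (rule finite_imageD)
    then have "finite (UNIV :: 'a smar set)" by simp
    then have "finite (UNIV :: 'a smap set)" by (auto simp: finite_prod)
    then have "finite (UNIV :: ('a \<Rightarrow> 'a) set)" by (auto simp: finite_prod)
    then have "finite (UNIV :: 'a set)" by (rule finite_fun_UNIVD2)
    then show False using assms(1) by simp
  qed
  have cof: "cof M = {(A, \<phi>, B). (A, \<phi>, B) \<in> Ar (Mcat X) \<and> spsh_mono (Sm X) (fst A) \<phi>}"
    and M: "model_structure (Mcat X) M"
    using assms(4) unfolding motivic_model_structure_def by blast+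
  have L: "model_structure (Mcat X) (L k)" "cof (L k) = cof M" "weq M \<subseteq> weq (L k)" for k
    using assms(5) unfolding left_Bousfield_localization_def by blast+
  interpret slice_tower X M L
  proof (rule slice_tower.intro)
    show "pointed_model_category (Mcat X) pt M"
      by (rule pointed_model_category_pcat[OF site_Sm inf_v M cof])
    show "pointed_model_category (Mcat X) pt (L k)" for k
      by (rule pointed_model_category_pcat[OF site_Sm inf_v L(1)]) (simp add: L(2) cof)
    show "cof (L k) = cof M" "weq M \<subseteq> weq (L k)" for k by (rule L)+
    show "weq (L (Suc k)) \<subseteq> weq (L k)" for k
      using left_Bousfield_localization_mono assms(5) WB_Suc_subset by blast
  qed
  have "is_pob (Sm X) A" using assms(6) by (simp add: Hcat_def loc_cat_def pcat_simps)
  then show ?thesis using is_slice_iff[of A n] by (simp add: t_fun_def induced_def)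
qed

end
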